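(* Let $(\mathcal E,\mathcal F)$ be a Dirichlet form on $L^2(A,\tau)$. Let $\omega,\omega'\in A^*_+$ be such that $\omega'\le\omega$ and $\omega$ has finite energy. Then $\omega'$ has finite energy, the potential of $\omega'$ is dominated by the potential of $\omega$, $$G(\omega')\le G(\omega),\qquad\text{meaning } G(\omega)-G(\omega')\in\mathcal F_+,$$ and the energy content of $\omega'$ is not greater than that of $\omega$: $\mathcal E[\omega']\le\mathcal E[\omega]$.
   Context: Setting. $A$ is a separable C*-algebra with a densely defined, faithful, semifinite, lower semicontinuous positive trace $\tau$. $L^2(A,\tau)$ is its GNS Hilbert space, with inner product $(\cdot,\cdot)_2$ (linear in the second variable) and norm $\|\cdot\|_2$; $\mathcal M=L^\infty(A,\tau)$ is the von Neumann algebra generated by $A$ on $L^2(A,\tau)$, with unit $1_{\mathcal M}$. Elements $a\in\mathcal M$ with $\tau(a^*a)<\infty$ are identified with vectors of $L^2(A,\tau)$. $L^2_+(A,\tau)$ is the standard positive cone; $J$ is the antiunitary involution extending $a\mapsto a^*$; $L^2_h(A,\tau)=\{\xi: J\xi=\xi\}$. For $\xi\in L^2_h(A,\tau)$, $\xi\wedge 1$ is the Hilbert projection of $\xi$ onto the $L^2$-closure of $\{a=a^*\in A\cap L^2(A,\tau): a\le 1_{\mathcal M}\}$. Dirichlet form. $(\mathcal E,\mathcal F)$ is a closed, densely defined, nonnegative quadratic form on $L^2(A,\tau)$ such that: (real) $J\xi\in\mathcal F$ and $\mathcal E[J\xi]=\mathcal E[\xi]$ for $\xi\in\mathcal F$;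 (Markovian) $\xi\wedge1\in\mathcal F$ and $\mathcal E[\xi\wedge 1]\le\mathcal E[\xi]$ for $\xi\in\mathcal F\cap L^2_h(A,\tau)$; (complete) for each $n\ge1$ the form $\mathcal E_n[[\xi_{ij}]]=\sum_{i,j}\mathcal E[\xi_{ij}]$ on $\mathbb M_n(\mathcal F)\subset L^2(\mathbb M_n(A),\tau\otimes tr_n)$ ($tr_n$ the normalized trace) is real and Markovian; (regular) $\mathcal B:=A\cap\mathcal F$ is norm dense in $A$ and is a form core. The associated sesquilinear form is also denoted $\mathcal E(\cdot,\cdot)$. $\mathcal F$ is a Hilbert space with $\langle\xi,\eta\rangle_{\mathcal F}=\mathcal E(\xi,\eta)+(\xi,\eta)_2$ and norm $\|\cdot\|_{\mathcal F}$; $\mathcal F_+:=\mathcal F\cap L^2_+(A,\tau)$. Finite energy. $\omega\in A^*_+$ (positive functional) is a finite-energy functional (has finite energy) if for some $c_\omega\ge0$, $\omega(b)\le c_\omega\|b\|_{\mathcal F}$ for all $b\in\mathcal B_+:=\mathcal B\cap L^2_+(A,\tau)$. Its potential $G(\omega)$ is the unique element of $\mathcal F$ with $\omega(b)=\langle G(\omega),b\rangle_{\mathcal F}$ for all $b\in\mathcal B$; $\omega$ is extended to all of $\mathcal F$ by this formula. The energy content of $\omega$ is $\mathcal E[\omega]:=\omega(G(\omega))=\|G(\omega)\|_{\mathcal F}^2$. *)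

theory Defs
  imports "HOL-Analysis.Analysis"
begin

section \<open>C*-algebras and complex Hilbert spaces\<close>

class complex_vector = real_vector +
  fixes scaleC :: "complex \<Rightarrow> 'a \<Rightarrow> 'a"  (infixr "*\<^sub>C" 75)
  assumes scaleC_add_right: "c *\<^sub>C (x + y) = c *\<^sub>C x + c *\<^sub>C y"
    and scaleC_add_left: "(c + d) *\<^sub>C x = c *\<^sub>C x + d *\<^sub>C x"
    and scaleC_scaleC: "c *\<^sub>C d *\<^sub>C x = (c * d) *\<^sub>C x"
    and scaleC_one: "1 *\<^sub>C x = x"
    and scaleR_scaleC: "r *\<^sub>R x = complex_of_real r *\<^sub>C x"

text \<open>A C*-algebra, not assumed to be unital.\<close>

class cstar_algebra = real_normed_algebra + banach + complex_vector +
  fixes star :: "'a \<Rightarrow> 'a"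
  assumes norm_scaleC: "norm (c *\<^sub>C x) = cmod c * norm x"
    and scaleC_mult_left: "(c *\<^sub>C x) * y = c *\<^sub>C (x * y)"
    and scaleC_mult_right: "x * (c *\<^sub>C y) = c *\<^sub>C (x * y)"
    and star_add: "star (x + y) = star x + star y"
    and star_scaleC: "star (c *\<^sub>C x) = cnj c *\<^sub>C star x"
    and star_mult: "star (x * y) = star y * star x"
    and star_star: "star (star x) = x"
    and cstar_identity: "norm (star x * x) = (norm x)\<^sup>2"

text \<open>
  The complex inner product is linear in the second variable. The inner product, norm and
  topology inherited from \<^class>\<open>real_inner\<close> are those of the underlying real Hilbert space.
\<close>

class chilbert_space = real_inner + complete_space + complex_vector +
  fixes cinner :: "'a \<Rightarrow> 'a \<Rightarrow> complex"
  assumes cinner_commute: "cinner y x = cnj (cinner x y)"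
    and cinner_add_right: "cinner x (y + z) = cinner x y + cinner x z"
    and cinner_scaleC_right: "cinner x (c *\<^sub>C y) = c * cinner x y"
    and Re_cinner: "Re (cinner x y) = x \<bullet> y"

definition pos_elem :: "'a::cstar_algebra \<Rightarrow> bool" where
  "pos_elem a \<longleftrightarrow> (\<exists>b. a = star b * b)"

definition pos_dual :: "('a::cstar_algebra \<Rightarrow> complex) set" where
  "pos_dual = {\<omega>. bounded_linear \<omega> \<and> (\<forall>c a. \<omega> (c *\<^sub>C a) = c * \<omega> a) \<and>
                  (\<forall>a. pos_elem a \<longrightarrow> \<omega> a \<in> \<real>\<^sub>\<ge>\<^sub>0)}"

definition functional_le :: "('a::cstar_algebra \<Rightarrow> complex) \<Rightarrow> ('a \<Rightarrow> complex) \<Rightarrow> bool" where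
  "functional_le \<omega>' \<omega> \<longleftrightarrow> (\<forall>a. pos_elem a \<longrightarrow> \<omega> a - \<omega>' a \<in> \<real>\<^sub>\<ge>\<^sub>0)"


section \<open>Traces and the GNS space\<close>

text \<open>
  A trace is a \<open>[0,\<infinity>]\<close>-valued map on the positive elements; its values elsewhere are irrelevant.
\<close>

locale cstar_trace =
  fixes \<tau> :: "'a::cstar_algebra \<Rightarrow> ennreal"
  assumes trace_add: "\<And>a b. pos_elem a \<Longrightarrow> pos_elem b \<Longrightarrow> \<tau> (a + b) = \<tau> a + \<tau> b"
    and trace_scale: "\<And>a r. pos_elem a \<Longrightarrow> r \<ge> 0 \<Longrightarrow> \<tau> (r *\<^sub>R a) = ennreal r * \<tau> a"
    and trace_commute: "\<And>a. \<tau> (star a * a) = \<tau> (a * star a)"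
    and densely_defined: "\<And>a. pos_elem a \<Longrightarrow> a \<in> closure {b. pos_elem b \<and> \<tau> b < \<infinity>}"
    and faithful: "\<And>a. pos_elem a \<Longrightarrow> \<tau> a = 0 \<Longrightarrow> a = 0"
    and semifinite: "\<And>a. pos_elem a \<Longrightarrow>
          \<tau> a = (SUP b\<in>{b. pos_elem b \<and> pos_elem (a - b) \<and> \<tau> b < \<infinity>}. \<tau> b)"
    and lower_semicontinuous: "\<And>X a. (\<And>n. pos_elem (X n)) \<Longrightarrow> pos_elem a \<Longrightarrow>
          X \<longlonglongrightarrow> a \<Longrightarrow> \<tau> a \<le> liminf (\<lambda>n. \<tau> (X n))"

text \<open>The elements of the algebra that belong to \<open>L\<^sup>2(A,\<tau>)\<close>.\<close>

definition sq_integrable :: "('a::cstar_algebra \<Rightarrow> ennreal) \<Rightarrow> 'a set" where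
  "sq_integrable \<tau> = {a. \<tau> (star a * a) < \<infinity>}"

text \<open>
  The type \<open>'h\<close> realises \<open>L\<^sup>2(A,\<tau>)\<close>, the completion of \<^term>\<open>sq_integrable \<tau>\<close> for the norm
  \<open>\<tau>(a\<^sup>*a)\<^sup>1\<^sup>/\<^sup>2\<close>; by polarisation \<open>cinner (\<Lambda> a) (\<Lambda> b) = \<tau>(a\<^sup>*b)\<close>. The map \<open>\<Lambda>\<close> (relevant only on
  \<^term>\<open>sq_integrable \<tau>\<close>) identifies square integrable elements with vectors, \<open>\<pi>\<close> is the
  action of \<open>A\<close> by left multiplication and \<open>J\<close> the antiunitary extension of \<open>a \<mapsto> a\<^sup>*\<close>.
  The data \<open>('h, \<Lambda>)\<close> are determined by \<open>\<tau>\<close> up to a unique unitary, and \<open>\<pi>\<close> and \<open>J\<close> are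
  determined by \<open>\<tau>\<close> and \<open>\<Lambda>\<close>.
\<close>

locale gns_space = cstar_trace \<tau>
  for \<tau> :: "'a::cstar_algebra \<Rightarrow> ennreal" +
  fixes \<Lambda> :: "'a \<Rightarrow> 'h::chilbert_space"
    and \<pi> :: "'a \<Rightarrow> 'h \<Rightarrow> 'h"
    and J :: "'h \<Rightarrow> 'h"
  assumes separable: "\<exists>D::'a set. countable D \<and> closure D = UNIV"
    and Lambda_add: "\<And>a b. a \<in> sq_integrable \<tau> \<Longrightarrow> b \<in> sq_integrable \<tau> \<Longrightarrow> \<Lambda> (a + b) = \<Lambda> a + \<Lambda> b"
    and Lambda_scaleC: "\<And>c a. a \<in> sq_integrable \<tau> \<Longrightarrow> \<Lambda> (c *\<^sub>C a) = c *\<^sub>C \<Lambda> a"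
    and norm_Lambda: "\<And>a. a \<in> sq_integrable \<tau> \<Longrightarrow> ennreal ((norm (\<Lambda> a))\<^sup>2) = \<tau> (star a * a)"
    and Lambda_dense: "closure (\<Lambda> ` sq_integrable \<tau>) = UNIV"
    and pi_bounded: "\<And>a. bounded_linear (\<pi> a)"
    and pi_Lambda: "\<And>a b. b \<in> sq_integrable \<tau> \<Longrightarrow> \<pi> a (\<Lambda> b) = \<Lambda> (a * b)"
    and J_add: "\<And>\<xi> \<eta>. J (\<xi> + \<eta>) = J \<xi> + J \<eta>"
    and J_scaleC: "\<And>c \<xi>. J (c *\<^sub>C \<xi>) = cnj c *\<^sub>C J \<xi>"
    and J_cinner: "\<And>\<xi> \<eta>. cinner (J \<xi>) (J \<eta>) = cinner \<eta> \<xi>"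
    and J_invol: "\<And>\<xi>. J (J \<xi>) = \<xi>"
    and J_Lambda: "\<And>a. a \<in> sq_integrable \<tau> \<Longrightarrow> J (\<Lambda> a) = \<Lambda> (star a)"

definition L2_pos :: "('a::cstar_algebra \<Rightarrow> ennreal) \<Rightarrow> ('a \<Rightarrow> 'h::chilbert_space) \<Rightarrow> 'h set" where
  "L2_pos \<tau> \<Lambda> = closure (\<Lambda> ` {a \<in> sq_integrable \<tau>. pos_elem a})"

text \<open>
  \<open>a \<le> 1\<close> in the von Neumann algebra generated by \<open>\<pi>(A)\<close>: its order is the operator order
  on \<open>L\<^sup>2(A,\<tau>)\<close> and its unit is the identity operator.
\<close>

definition le_unit :: "('a::cstar_algebra \<Rightarrow> 'h::chilbert_space \<Rightarrow> 'h) \<Rightarrow> 'a \<Rightarrow> bool" where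
  "le_unit \<pi> a \<longleftrightarrow> (\<forall>\<xi>. Re (cinner \<xi> (\<pi> a \<xi>)) \<le> Re (cinner \<xi> \<xi>))"

definition nearest_point :: "('x \<Rightarrow> 'x \<Rightarrow> real) \<Rightarrow> 'x set \<Rightarrow> 'x \<Rightarrow> 'x" where
  "nearest_point d C x = (THE y. y \<in> C \<and> (\<forall>z\<in>C. d x y \<le> d x z))"

definition wedge_one ::
    "('a::cstar_algebra \<Rightarrow> ennreal) \<Rightarrow> ('a \<Rightarrow> 'h::chilbert_space) \<Rightarrow> ('a \<Rightarrow> 'h \<Rightarrow> 'h) \<Rightarrow> 'h \<Rightarrow> 'h" where
  "wedge_one \<tau> \<Lambda> \<pi> =
     nearest_point dist (closure (\<Lambda> ` {a \<in> sq_integrable \<tau>. star a = a \<and> le_unit \<pi> a}))"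


section \<open>Matrix amplifications\<close>

text \<open>
  An \<open>n \<times> n\<close> matrix is a function of two indices that vanishes off \<open>{..<n} \<times> {..<n}\<close>.
  \<open>L\<^sup>2(M\<^sub>n(A), \<tau> \<otimes> tr\<^sub>n)\<close>, with \<open>tr\<^sub>n\<close> the normalised trace, is identified with \<open>M\<^sub>n(L\<^sup>2(A,\<tau>))\<close>.
  Since \<open>(\<tau> \<otimes> tr\<^sub>n)(a\<^sup>*a) = (1/n) \<Sum>\<^sub>i\<^sub>j \<tau>(a\<^sub>i\<^sub>j\<^sup>*a\<^sub>i\<^sub>j)\<close>, a matrix over \<open>A\<close> is square integrable iff all its
  entries are.
\<close>

definition matrices :: "nat \<Rightarrow> 'x::zero set \<Rightarrow> (nat \<Rightarrow> nat \<Rightarrow> 'x) set" where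
  "matrices n S = {X. (\<forall>i<n. \<forall>j<n. X i j \<in> S) \<and> (\<forall>i j. \<not> (i < n \<and> j < n) \<longrightarrow> X i j = 0)}"

definition mat_cinner ::
    "nat \<Rightarrow> (nat \<Rightarrow> nat \<Rightarrow> 'h::chilbert_space) \<Rightarrow> (nat \<Rightarrow> nat \<Rightarrow> 'h) \<Rightarrow> complex" where
  "mat_cinner n X Y = (\<Sum>i<n. \<Sum>j<n. cinner (X i j) (Y i j)) / of_nat n"

definition mat_dist ::
    "nat \<Rightarrow> (nat \<Rightarrow> nat \<Rightarrow> 'h::chilbert_space) \<Rightarrow> (nat \<Rightarrow> nat \<Rightarrow> 'h) \<Rightarrow> real" where
  "mat_dist n X Y =
     sqrt (Re (mat_cinner n (\<lambda>i j. X i j - Y i j) (\<lambda>i j. X i j - Y i j)))"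

definition mat_closure ::
    "nat \<Rightarrow> (nat \<Rightarrow> nat \<Rightarrow> 'h::chilbert_space) set \<Rightarrow> (nat \<Rightarrow> nat \<Rightarrow> 'h) set" where
  "mat_closure n S = {X \<in> matrices n UNIV. \<forall>e>0. \<exists>Y\<in>S. mat_dist n X Y < e}"

definition mat_vec :: "nat \<Rightarrow> ('a \<Rightarrow> 'h::zero) \<Rightarrow> (nat \<Rightarrow> nat \<Rightarrow> 'a) \<Rightarrow> nat \<Rightarrow> nat \<Rightarrow> 'h" where
  "mat_vec n \<Lambda> a = (\<lambda>i j. if i < n \<and> j < n then \<Lambda> (a i j) else 0)"

definition mat_lmult ::
    "nat \<Rightarrow> ('a \<Rightarrow> 'h \<Rightarrow> 'h::comm_monoid_add) \<Rightarrow> (nat \<Rightarrow> nat \<Rightarrow> 'a) \<Rightarrow> (nat \<Rightarrow> nat \<Rightarrow> 'h) \<Rightarrow> nat \<Rightarrow> nat \<Rightarrow> 'h" where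
  "mat_lmult n \<pi> a X = (\<lambda>i j. if i < n \<and> j < n then \<Sum>k<n. \<pi> (a i k) (X k j) else 0)"

text \<open>The involutions on \<open>M\<^sub>n(A)\<close> and on its \<open>L\<^sup>2\<close>-space.\<close>

definition mat_adj :: "('x \<Rightarrow> 'x) \<Rightarrow> (nat \<Rightarrow> nat \<Rightarrow> 'x) \<Rightarrow> nat \<Rightarrow> nat \<Rightarrow> 'x" where
  "mat_adj s X = (\<lambda>i j. s (X j i))"

definition mat_le_unit ::
    "nat \<Rightarrow> ('a::cstar_algebra \<Rightarrow> 'h::chilbert_space \<Rightarrow> 'h) \<Rightarrow> (nat \<Rightarrow> nat \<Rightarrow> 'a) \<Rightarrow> bool" where
  "mat_le_unit n \<pi> a \<longleftrightarrow>
     (\<forall>X\<in>matrices n UNIV. Re (mat_cinner n X (mat_lmult n \<pi> a X)) \<le> Re (mat_cinner n X X))"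

definition mat_wedge_one ::
    "nat \<Rightarrow> ('a::cstar_algebra \<Rightarrow> ennreal) \<Rightarrow> ('a \<Rightarrow> 'h::chilbert_space) \<Rightarrow> ('a \<Rightarrow> 'h \<Rightarrow> 'h) \<Rightarrow>
     (nat \<Rightarrow> nat \<Rightarrow> 'h) \<Rightarrow> nat \<Rightarrow> nat \<Rightarrow> 'h" where
  "mat_wedge_one n \<tau> \<Lambda> \<pi> =
     nearest_point (mat_dist n) (mat_closure n (mat_vec n \<Lambda> `
       {a \<in> matrices n (sq_integrable \<tau>). mat_adj star a = a \<and> mat_le_unit n \<pi> a}))"


section \<open>Dirichlet forms\<close>

text \<open>A quadratic form is given by its domain \<open>\<F>\<close> and its sesquilinear form \<open>\<E>\<close>.\<close>

definition form_quad :: "('h \<Rightarrow> 'h \<Rightarrow> complex) \<Rightarrow> 'h \<Rightarrow> real" where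
  "form_quad \<E> \<xi> = Re (\<E> \<xi> \<xi>)"

definition mat_quad :: "nat \<Rightarrow> ('h \<Rightarrow> 'h \<Rightarrow> complex) \<Rightarrow> (nat \<Rightarrow> nat \<Rightarrow> 'h) \<Rightarrow> real" where
  "mat_quad n \<E> X = (\<Sum>i<n. \<Sum>j<n. form_quad \<E> (X i j))"

definition form_inner :: "('h::chilbert_space \<Rightarrow> 'h \<Rightarrow> complex) \<Rightarrow> 'h \<Rightarrow> 'h \<Rightarrow> complex" where
  "form_inner \<E> \<xi> \<eta> = \<E> \<xi> \<eta> + cinner \<xi> \<eta>"

definition form_norm :: "('h::chilbert_space \<Rightarrow> 'h \<Rightarrow> complex) \<Rightarrow> 'h \<Rightarrow> real" where
  "form_norm \<E> \<xi> = sqrt (Re (form_inner \<E> \<xi> \<xi>))"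

definition form_pos ::
    "('a::cstar_algebra \<Rightarrow> ennreal) \<Rightarrow> ('a \<Rightarrow> 'h::chilbert_space) \<Rightarrow> 'h set \<Rightarrow> 'h set" where
  "form_pos \<tau> \<Lambda> \<F> = \<F> \<inter> L2_pos \<tau> \<Lambda>"

text \<open>\<open>\<B> = A \<inter> \<F>\<close> and \<open>\<B>\<^sub>+ = \<B> \<inter> L\<^sup>2\<^sub>+(A,\<tau>)\<close>, as subsets of \<open>A\<close>.\<close>

definition form_alg ::
    "('a::cstar_algebra \<Rightarrow> ennreal) \<Rightarrow> ('a \<Rightarrow> 'h::chilbert_space) \<Rightarrow> 'h set \<Rightarrow> 'a set" where
  "form_alg \<tau> \<Lambda> \<F> = {a \<in> sq_integrable \<tau>. \<Lambda> a \<in> \<F>}"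

definition form_alg_pos ::
    "('a::cstar_algebra \<Rightarrow> ennreal) \<Rightarrow> ('a \<Rightarrow> 'h::chilbert_space) \<Rightarrow> 'h set \<Rightarrow> 'a set" where
  "form_alg_pos \<tau> \<Lambda> \<F> = {b \<in> form_alg \<tau> \<Lambda> \<F>. \<Lambda> b \<in> L2_pos \<tau> \<Lambda>}"

locale dirichlet_form = gns_space \<tau> \<Lambda> \<pi> J
  for \<tau> :: "'a::cstar_algebra \<Rightarrow> ennreal"
    and \<Lambda> :: "'a \<Rightarrow> 'h::chilbert_space"
    and \<pi> :: "'a \<Rightarrow> 'h \<Rightarrow> 'h"
    and J :: "'h \<Rightarrow> 'h" +
  fixes \<F> :: "'h set"
    and \<E> :: "'h \<Rightarrow> 'h \<Rightarrow> complex"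
  assumes dom_zero: "0 \<in> \<F>"
    and dom_add: "\<And>\<xi> \<eta>. \<xi> \<in> \<F> \<Longrightarrow> \<eta> \<in> \<F> \<Longrightarrow> \<xi> + \<eta> \<in> \<F>"
    and dom_scaleC: "\<And>c \<xi>. \<xi> \<in> \<F> \<Longrightarrow> c *\<^sub>C \<xi> \<in> \<F>"
    and form_add: "\<And>\<xi> \<eta> \<zeta>. \<xi> \<in> \<F> \<Longrightarrow> \<eta> \<in> \<F> \<Longrightarrow> \<zeta> \<in> \<F> \<Longrightarrow> \<E> \<xi> (\<eta> + \<zeta>) = \<E> \<xi> \<eta> + \<E> \<xi> \<zeta>"
    and form_scaleC: "\<And>c \<xi> \<eta>. \<xi> \<in> \<F> \<Longrightarrow> \<eta> \<in> \<F> \<Longrightarrow> \<E> \<xi> (c *\<^sub>C \<eta>) = c * \<E> \<xi> \<eta>"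
    and form_commute: "\<And>\<xi> \<eta>. \<xi> \<in> \<F> \<Longrightarrow> \<eta> \<in> \<F> \<Longrightarrow> \<E> \<eta> \<xi> = cnj (\<E> \<xi> \<eta>)"
    and form_nonneg: "\<And>\<xi>. \<xi> \<in> \<F> \<Longrightarrow> form_quad \<E> \<xi> \<ge> 0"
    and dom_dense: "closure \<F> = UNIV"
    and form_closed: "\<And>X \<xi>. (\<And>n. X n \<in> \<F>) \<Longrightarrow> X \<longlonglongrightarrow> \<xi> \<Longrightarrow>
          (\<And>e. e > 0 \<Longrightarrow> \<exists>N. \<forall>m\<ge>N. \<forall>n\<ge>N. form_quad \<E> (X m - X n) < e) \<Longrightarrow>
          \<xi> \<in> \<F> \<and> (\<lambda>n. form_quad \<E> (X n - \<xi>)) \<longlonglongrightarrow> 0"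
    and form_real: "\<And>\<xi>. \<xi> \<in> \<F> \<Longrightarrow> J \<xi> \<in> \<F> \<and> form_quad \<E> (J \<xi>) = form_quad \<E> \<xi>"
    and markovian: "\<And>\<xi>. \<xi> \<in> \<F> \<Longrightarrow> J \<xi> = \<xi> \<Longrightarrow>
          wedge_one \<tau> \<Lambda> \<pi> \<xi> \<in> \<F> \<and> form_quad \<E> (wedge_one \<tau> \<Lambda> \<pi> \<xi>) \<le> form_quad \<E> \<xi>"
    and completely_real: "\<And>n X. n \<ge> 1 \<Longrightarrow> X \<in> matrices n \<F> \<Longrightarrow>
          mat_adj J X \<in> matrices n \<F> \<and> mat_quad n \<E> (mat_adj J X) = mat_quad n \<E> X"
    and completely_markovian: "\<And>n X. n \<ge> 1 \<Longrightarrow> X \<in> matrices n \<F> \<Longrightarrow> mat_adj J X = X \<Longrightarrow>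
          mat_wedge_one n \<tau> \<Lambda> \<pi> X \<in> matrices n \<F> \<and>
          mat_quad n \<E> (mat_wedge_one n \<tau> \<Lambda> \<pi> X) \<le> mat_quad n \<E> X"
    and regular_dense: "closure (form_alg \<tau> \<Lambda> \<F>) = UNIV"
    and regular_core: "\<And>\<xi> e. \<xi> \<in> \<F> \<Longrightarrow> e > 0 \<Longrightarrow>
          \<exists>b\<in>form_alg \<tau> \<Lambda> \<F>. form_norm \<E> (\<xi> - \<Lambda> b) < e"


section \<open>Finite energy functionals\<close>

text \<open>
  For a positive functional \<open>\<omega>\<close> the values \<open>\<omega> b\<close>, \<open>b \<in> \<B>\<^sub>+\<close>, are real; \<^const>\<open>Re\<close> only
  changes the type.
\<close>

definition finite_energy ::
    "('a::cstar_algebra \<Rightarrow> ennreal) \<Rightarrow> ('a \<Rightarrow> 'h::chilbert_space) \<Rightarrow> 'h set \<Rightarrow> ('h \<Rightarrow> 'h \<Rightarrow> complex) \<Rightarrow>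
     ('a \<Rightarrow> complex) \<Rightarrow> bool" where
  "finite_energy \<tau> \<Lambda> \<F> \<E> \<omega> \<longleftrightarrow>
     (\<exists>c\<ge>0. \<forall>b\<in>form_alg_pos \<tau> \<Lambda> \<F>. Re (\<omega> b) \<le> c * form_norm \<E> (\<Lambda> b))"

text \<open>
  For \<open>\<omega>\<close> of finite energy there is exactly one such \<open>g\<close>: existence comes from the Riesz
  representation theorem in \<open>\<F>\<close>, uniqueness from \<open>\<B>\<close> being a core. Otherwise the value of
  the description operator carries no information.
\<close>

definition potential ::
    "('a::cstar_algebra \<Rightarrow> ennreal) \<Rightarrow> ('a \<Rightarrow> 'h::chilbert_space) \<Rightarrow> 'h set \<Rightarrow> ('h \<Rightarrow> 'h \<Rightarrow> complex) \<Rightarrow>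
     ('a \<Rightarrow> complex) \<Rightarrow> 'h" where
  "potential \<tau> \<Lambda> \<F> \<E> \<omega> =
     (THE g. g \<in> \<F> \<and> (\<forall>b\<in>form_alg \<tau> \<Lambda> \<F>. \<omega> b = form_inner \<E> g (\<Lambda> b)))"

text \<open>The extension of \<open>\<omega>\<close> from \<open>\<B>\<close> to \<open>\<F>\<close>.\<close>

definition energy_extension ::
    "('a::cstar_algebra \<Rightarrow> ennreal) \<Rightarrow> ('a \<Rightarrow> 'h::chilbert_space) \<Rightarrow> 'h set \<Rightarrow> ('h \<Rightarrow> 'h \<Rightarrow> complex) \<Rightarrow>
     ('a \<Rightarrow> complex) \<Rightarrow> 'h \<Rightarrow> complex" where
  "energy_extension \<tau> \<Lambda> \<F> \<E> \<omega> \<xi> = form_inner \<E> (potential \<tau> \<Lambda> \<F> \<E> \<omega>) \<xi>"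

definition energy_content ::
    "('a::cstar_algebra \<Rightarrow> ennreal) \<Rightarrow> ('a \<Rightarrow> 'h::chilbert_space) \<Rightarrow> 'h set \<Rightarrow> ('h \<Rightarrow> 'h \<Rightarrow> complex) \<Rightarrow>
     ('a \<Rightarrow> complex) \<Rightarrow> real" where
  "energy_content \<tau> \<Lambda> \<F> \<E> \<omega> = Re (energy_extension \<tau> \<Lambda> \<F> \<E> \<omega> (potential \<tau> \<Lambda> \<F> \<E> \<omega>))"

end

theory Submission
  imports Defs
begin

text \<open>
  Write \<open>\<sigma> = \<omega> - \<omega>'\<close>, a positive functional. That \<open>\<omega>'\<close> has finite energy is immediate from
  \<open>\<omega>' \<le> \<omega>\<close> on positive elements, and \<open>d = G(\<omega>) - G(\<omega>')\<close> is the potential of \<open>\<sigma>\<close>. Everything else follows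
  from one fact about a potential \<open>g\<close> of a positive functional: \<open>g\<close> is the limit, in the norm of
  \<open>\<F>\<close>, of positive elements of the form algebra \<open>\<B>\<close> (\<open>potential_approx_pos\<close>). It puts \<open>d\<close> into the
  cone of \<open>L\<^sup>2\<close>. It also shows that two potentials \<open>g\<close>, \<open>h\<close> satisfy \<open>\<langle>g,h\<rangle>\<^sub>\<F> \<ge> 0\<close>
  (\<open>potentials_inner_nonneg\<close>), and therefore
  \<open>\<E>[\<omega>] - \<E>[\<omega>'] = \<langle>G(\<omega>),d\<rangle>\<^sub>\<F> + \<langle>G(\<omega>'),d\<rangle>\<^sub>\<F> \<ge> 0\<close>.

  The approximation rests on the splitting of a self-adjoint \<open>b\<close> in \<open>\<B>\<close> into its positive and
  negative parts \<open>p\<close> and \<open>m\<close>: both lie in \<open>\<B>\<close>, and \<open>\<langle>p,m\<rangle>\<^sub>\<F> \<le> 0\<close> (\<open>form_parts\<close>). If \<open>b\<close> is close to \<open>g\<close>, then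
  \<open>\<langle>g,m\<rangle>\<^sub>\<F> \<ge> 0\<close> forces \<open>\<parallel>m\<parallel>\<^sub>\<F> \<le> \<parallel>g - b\<parallel>\<^sub>\<F>\<close>. The same splitting extends the bound defining finite
  energy from positive elements to \<open>\<B>\<close>, so that potentials exist (\<open>potential_exists\<close>).

  The splitting is obtained from the Markov property: \<open>\<epsilon>((b/\<epsilon>) \<and> 1)\<close> has at most the energy of \<open>b\<close> and
  tends in \<open>L\<^sup>2\<close> to \<open>-m\<close> as \<open>\<epsilon>\<close> tends to \<open>0\<close> (\<open>wedge_scaled_tendsto_neg_part\<close>), and closed forms are lower
  semicontinuous (\<open>form_lower_semicontinuous\<close>). The functional calculus this requires is limited to
  square roots and the decomposition of self-adjoint elements (\<open>sqrt_in_unitization\<close>,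
  \<open>pos_neg_parts\<close>), which are built by an iteration and elementary norm estimates. The faithful trace
  identifies the elements \<open>a\<^sup>*a\<close> with those of nonnegative spectrum, and a square integrable element
  in the cone of \<open>L\<^sup>2\<close> is positive in the algebra (\<open>pos_elem_if_L2_pos\<close>).
\<close>

section \<open>Square roots and positive elements of a C*-algebra\<close>

lemma star_zero [simp]: "star (0::'a::cstar_algebra) = 0"
  using star_add[of 0 0] by simp

lemma star_minus: "star (- x) = - star (x::'a::cstar_algebra)"
  using star_add[of x "- x"] by (simp add: eq_neg_iff_add_eq_0 add.commute)

lemma star_diff: "star (x - y) = star x - star (y::'a::cstar_algebra)"
  using star_add[of x "- y"] by (simp add: star_minus)

lemma star_scaleR: "star (r *\<^sub>R x) = r *\<^sub>R star (x::'a::cstar_algebra)"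
  by (simp add: scaleR_scaleC star_scaleC)

lemmas star_simps = star_add star_minus star_diff star_scaleR star_scaleC star_mult star_star

lemma norm_star [simp]: "norm (star x) = norm (x::'a::cstar_algebra)"
proof -
  have le: "norm y \<le> norm (star y)" for y :: 'a
  proof (cases "y = 0")
    case False
    have "norm y * norm y \<le> norm (star y) * norm y"
      using norm_mult_ineq[of "star y" y] by (simp add: cstar_identity power2_eq_square)
    then show ?thesis using False by simp
  qed simp
  show ?thesis using le[of x] le[of "star x"] by (simp add: star_star)
qed

lemma bounded_linear_star: "bounded_linear (star :: 'a::cstar_algebra \<Rightarrow> 'a)"
  by (rule bounded_linear_intro[of _ 1]) (simp_all add: star_simps)

lemma norm_mult_star: "norm (x * star x) = (norm (x::'a::cstar_algebra))\<^sup>2"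
  using cstar_identity[of "star x"] by (simp add: star_star)

lemma norm_le_if_mult_bound:
  fixes c :: "'a::cstar_algebra"
  assumes "C \<ge> 0" and "\<And>v. norm (c * v) \<le> C * norm v"
  shows "norm c \<le> C"
proof (cases "c = 0")
  case False
  have "norm c * norm c \<le> C * norm c"
    using assms(2)[of "star c"] by (simp add: norm_mult_star power2_eq_square)
  then show ?thesis using False by simp
qed (use assms in simp)

lemma star_mult_self_eq_0: "star x * x = 0 \<longleftrightarrow> (x::'a::cstar_algebra) = 0"
  using cstar_identity[of x] by auto

lemma scaleC_zero_left: "0 *\<^sub>C x = (0::'a::complex_vector)"
  using scaleR_scaleC[of 0 x] by simp

lemma scaleC_minus_left: "(- c) *\<^sub>C x = - (c *\<^sub>C (x::'a::complex_vector))"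
  using scaleC_add_left[of c "- c" x] by (simp add: scaleC_zero_left eq_neg_iff_add_eq_0 add.commute)

text \<open>
  In the unitization put \<open>y = 1 - k\<close>. The last hypothesis says \<open>x\<^sup>2 + y\<^sup>2 = 1\<close>, so that \<open>x + i y\<close>
  is unitary; \<open>x\<close> and \<open>y\<close> are its real and imaginary parts and hence are contractions. This
  replaces the spectral estimate for \<open>\<surd>(1 - x\<^sup>2)\<close>.
\<close>

lemma unitary_part_contraction:
  fixes x k v :: "'a::cstar_algebra"
  assumes "star x = x" "star k = k" "x * k = k * x" "x * x + k * k = 2 *\<^sub>R k"
  shows "norm (x * v) \<le> norm v" "norm (v - k * v) \<le> norm v"
proof -
  define X Y where "X = x * v" and "Y = v - k * v"
  have XY: "star X * Y = star Y * X"
    by (simp add: X_def Y_def star_simps assms(1,2) algebra_simps)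
       (metis assms(3) mult.assoc)
  have "star X * X + star Y * Y = star v * (x * x + k * k - 2 *\<^sub>R k) * v + star v * v"
    by (simp add: X_def Y_def star_simps assms(1,2) algebra_simps scaleR_2)
  then have XXYY: "star X * X + star Y * Y = star v * v"
    using assms(4) by simp
  have isometry: "norm (X + c *\<^sub>C Y) = norm v" if c: "c * cnj c = 1" "cnj c = - c" for c
  proof -
    have "star (X + c *\<^sub>C Y) * (X + c *\<^sub>C Y)
        = star X * X + (c * cnj c) *\<^sub>C (star Y * Y) + (c *\<^sub>C (star X * Y) + cnj c *\<^sub>C (star Y * X))"
      by (simp add: star_simps distrib_left distrib_right scaleC_mult_left scaleC_mult_right
          scaleC_scaleC scaleC_add_right mult.commute add_ac)
    also have "c *\<^sub>C (star X * Y) + cnj c *\<^sub>C (star Y * X) = 0"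
      unfolding XY scaleC_add_left[symmetric] c(2) by (simp add: scaleC_zero_left)
    finally have "(norm (X + c *\<^sub>C Y))\<^sup>2 = (norm v)\<^sup>2"
      using XXYY by (simp add: c(1) scaleC_one flip: cstar_identity)
    then show ?thesis by simp
  qed
  have plus: "norm (X + \<i> *\<^sub>C Y) = norm v" and minus: "norm (X + (- \<i>) *\<^sub>C Y) = norm v"
    by (rule isometry; simp)+
  have "(X + \<i> *\<^sub>C Y) + (X + (- \<i>) *\<^sub>C Y) = 2 *\<^sub>R X"
    by (simp add: scaleR_2 algebra_simps scaleC_add_left[symmetric] scaleC_zero_left)
  then have "norm (2 *\<^sub>R X) \<le> norm v + norm v"
    using norm_triangle_ineq[of "X + \<i> *\<^sub>C Y" "X + (- \<i>) *\<^sub>C Y"] plus minus by simp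
  then show "norm (x * v) \<le> norm v" by (simp add: X_def)
  have "(X + \<i> *\<^sub>C Y) - (X + (- \<i>) *\<^sub>C Y) = (2 * \<i>) *\<^sub>C Y"
    by (simp add: scaleC_minus_left scaleC_add_left[symmetric])
  then have "norm ((2 * \<i>) *\<^sub>C Y) \<le> norm v + norm v"
    using norm_triangle_ineq4[of "X + \<i> *\<^sub>C Y" "X + (- \<i>) *\<^sub>C Y"] plus minus by simp
  then show "norm (v - k * v) \<le> norm v" by (simp add: Y_def norm_scaleC norm_mult)
qed

text \<open>
  Let \<open>H = \<sigma>1 - b\<close> be a contraction in the unitization. The iteration \<open>K\<^sub>0 = 0\<close>,
  \<open>K\<^sub>n\<^sub>+\<^sub>1 = (H + K\<^sub>n\<^sup>2)/2\<close> is dominated by the same iteration \<open>t\<^sub>n\<close> for the number \<open>1\<close>, because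
  \<open>K\<^sub>n\<^sub>+\<^sub>1 - K\<^sub>n = (K\<^sub>n + K\<^sub>n\<^sub>-\<^sub>1)(K\<^sub>n - K\<^sub>n\<^sub>-\<^sub>1)/2\<close>. So it converges, also when \<open>\<parallel>H\<parallel> = 1\<close>, to some
  \<open>K = s1 - a\<close> with \<open>(1 - K)\<^sup>2 = 1 - H\<close>. Scalar and algebra parts are tracked separately, which
  shows that \<open>a\<close> lies in the algebra. The value \<open>\<sigma> = 1\<close> gives the square root of \<open>b\<close>, and \<open>\<sigma> = 0\<close>
  the square root of \<open>1 + b\<close>.
\<close>

lemma sqrt_in_unitization:
  fixes b :: "'a::cstar_algebra"
  assumes sa: "star b = b" and \<sigma>: "0 \<le> \<sigma>" "\<sigma> \<le> 1"
    and contr: "\<And>v. norm (\<sigma> *\<^sub>R v - b * v) \<le> norm v"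
  obtains a s where "star a = a" "\<And>c. c * b = b * c \<Longrightarrow> c * a = a * c"
    "\<And>v. norm (s *\<^sub>R v - a * v) \<le> norm v" "0 \<le> s" "s \<le> 1" "2 * s = \<sigma> + s\<^sup>2"
    "a * a + (2 * (1 - s)) *\<^sub>R a = b"
proof -
  define t where "t = rec_nat (0::real) (\<lambda>_ u. (1 + u\<^sup>2) / 2)"
  define s where "s = rec_nat (0::real) (\<lambda>_ u. (\<sigma> + u\<^sup>2) / 2)"
  define a where "a = rec_nat (0::'a) (\<lambda>n u. (1/2) *\<^sub>R b + s n *\<^sub>R u - (1/2) *\<^sub>R (u * u))"
  have t0: "t 0 = 0" and tS: "t (Suc n) = (1 + (t n)\<^sup>2) / 2" for n by (simp_all add: t_def)
  have s0: "s 0 = 0" and sS: "s (Suc n) = (\<sigma> + (s n)\<^sup>2) / 2" for n by (simp_all add: s_def)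
  have a0: "a 0 = 0" and aS: "a (Suc n) = (1/2) *\<^sub>R b + s n *\<^sub>R a n - (1/2) *\<^sub>R (a n * a n)" for n
    by (simp_all add: a_def)
  \<comment> \<open>the element \<open>K\<^sub>n = s\<^sub>n 1 - a\<^sub>n\<close> of the unitization, acting on the algebra by left multiplication\<close>
  define K where "K n v = s n *\<^sub>R v - a n * v" for n v
  have a_sa: "star (a n) = a n" for n
    by (induction n) (simp_all add: a0 aS star_simps sa)
  have a_comm: "c * a n = a n * c" if "c * b = b * c" for c n
  proof (induction n)
    case (Suc n)
    have "c * (a n * a n) = (a n * a n) * c" by (metis Suc mult.assoc)
    then show ?case by (simp add: aS algebra_simps Suc that)
  qed (simp add: a0)
  have ab: "b * a n = a n * b" for n by (rule a_comm) simp
  have aa: "a m * a n = a n * a m" for m n by (rule a_comm) (simp add: ab)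
  have t_nonneg: "0 \<le> t n" for n by (cases n) (simp_all add: t0 tS)
  have t_le1: "t n \<le> 1" for n
  proof (induction n)
    case (Suc n)
    have "(t n)\<^sup>2 \<le> 1" using Suc t_nonneg[of n] by (simp add: power_le_one)
    then show ?case by (simp add: tS)
  qed (simp add: t0)
  have s_nonneg: "0 \<le> s n" for n using \<sigma> by (cases n) (simp_all add: s0 sS)
  have s_le_t: "s n \<le> t n" for n
  proof (induction n)
    case (Suc n)
    have "(s n)\<^sup>2 \<le> (t n)\<^sup>2" using Suc s_nonneg[of n] by (simp add: power_mono)
    then show ?case using \<sigma> by (simp add: tS sS)
  qed (simp add: t0 s0)
  have K_Suc: "K (Suc n) v = (1/2) *\<^sub>R ((\<sigma> *\<^sub>R v - b * v) + K n (K n v))" for n v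
    by (simp add: K_def sS aS algebra_simps power2_eq_square add_divide_distrib
        flip: scaleR_add_left)
  have K_diff_arg: "K n (u - v) = K n u - K n v" for n u v
    by (simp add: K_def algebra_simps)
  have K_scale: "K n (r *\<^sub>R v) = r *\<^sub>R K n v" for n v r
    by (simp add: K_def algebra_simps)
  have K_comm: "K m (K n v) = K n (K m v)" for m n v
    by (simp add: K_def algebra_simps aa flip: mult.assoc)
  have K_bound: "norm (K n v) \<le> t n * norm v" for n v
  proof (induction n arbitrary: v)
    case (Suc n)
    have "norm (K n (K n v)) \<le> t n * (t n * norm v)"
      using Suc[of "K n v"] mult_left_mono[OF Suc[of v] t_nonneg[of n]] by linarith
    then have "norm ((\<sigma> *\<^sub>R v - b * v) + K n (K n v)) \<le> norm v + t n * (t n * norm v)"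
      using contr[of v] norm_triangle_ineq[of "\<sigma> *\<^sub>R v - b * v" "K n (K n v)"] by linarith
    then show ?case unfolding K_Suc norm_scaleR tS by (simp add: power2_eq_square algebra_simps)
  qed (simp add: K_def s0 a0 t0)
  have diff_bound: "norm (K (Suc n) v - K n v) \<le> (t (Suc n) - t n) * norm v
      \<and> \<bar>s (Suc n) - s n\<bar> \<le> t (Suc n) - t n" for n v
  proof (induction n arbitrary: v)
    case 0
    show ?case using contr[of v] \<sigma> by (simp add: K_Suc sS tS) (simp add: K_def s0 a0 t0)
  next
    case (Suc n)
    let ?d = "K (Suc n) v - K n v" and ?\<delta> = "t (Suc n) - t n"
    have tri: "norm (K (Suc n) ?d + K n ?d) \<le> (t (Suc n) + t n) * norm ?d"
      using K_bound[of "Suc n" ?d] K_bound[of n ?d] norm_triangle_ineq[of "K (Suc n) ?d" "K n ?d"]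
      by (simp add: distrib_right)
    have "K (Suc (Suc n)) v - K (Suc n) v = (1/2) *\<^sub>R (K (Suc n) (K (Suc n) v) - K n (K n v))"
      by (simp add: K_Suc[of "Suc n"]) (simp add: K_Suc[of n v] algebra_simps)
    also have "\<dots> = (1/2) *\<^sub>R (K (Suc n) ?d + K n ?d)"
      by (simp only: K_diff_arg) (simp add: K_comm[of n "Suc n"])
    finally have eq: "K (Suc (Suc n)) v - K (Suc n) v = (1/2) *\<^sub>R (K (Suc n) ?d + K n ?d)" .
    have tS2: "t (Suc (Suc n)) - t (Suc n) = (t (Suc n) + t n) * ?\<delta> / 2"
      by (simp add: tS[of "Suc n"] tS[of n] power2_eq_square field_simps)
    have "(t (Suc n) + t n) * norm ?d \<le> (t (Suc n) + t n) * (?\<delta> * norm v)"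
      using Suc[of v] t_nonneg[of n] t_nonneg[of "Suc n"] by (intro mult_left_mono) auto
    then have 1: "norm (K (Suc (Suc n)) v - K (Suc n) v) \<le> (t (Suc (Suc n)) - t (Suc n)) * norm v"
      using tri unfolding eq tS2 norm_scaleR by simp
    have sS2: "s (Suc (Suc n)) - s (Suc n) = (s (Suc n) + s n) * (s (Suc n) - s n) / 2"
      by (simp add: sS[of "Suc n"] sS[of n] power2_eq_square field_simps)
    have "\<bar>(s (Suc n) + s n) * (s (Suc n) - s n)\<bar> \<le> (t (Suc n) + t n) * ?\<delta>"
      unfolding abs_mult using Suc[of v] s_nonneg[of n] s_nonneg[of "Suc n"] s_le_t[of n] s_le_t[of "Suc n"]
      by (intro mult_mono) auto
    then have "\<bar>s (Suc (Suc n)) - s (Suc n)\<bar> \<le> t (Suc (Suc n)) - t (Suc n)"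
      unfolding sS2 tS2 by (simp add: abs_divide)
    then show ?case using 1 by blast
  qed
  have t_mono: "t n \<le> t (Suc n)" for n using diff_bound[of n 0] by linarith
  obtain T where T: "t \<longlonglongrightarrow> T"
    using incseq_convergent[OF incseq_SucI[of t, OF t_mono], of 1] t_le1 by blast
  have sumT: "summable (\<lambda>n. t (Suc n) - t n)" using telescope_summable[OF T] .
  have "norm (a (Suc n) - a n) \<le> 2 * (t (Suc n) - t n)" for n
  proof (rule norm_le_if_mult_bound)
    fix v
    have "(a (Suc n) - a n) * v = (s (Suc n) - s n) *\<^sub>R v - (K (Suc n) v - K n v)"
      by (simp add: K_def algebra_simps)
    then have "norm ((a (Suc n) - a n) * v)
        \<le> \<bar>s (Suc n) - s n\<bar> * norm v + norm (K (Suc n) v - K n v)"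
      using norm_triangle_ineq4[of "(s (Suc n) - s n) *\<^sub>R v" "K (Suc n) v - K n v"] by simp
    also have "\<dots> \<le> (t (Suc n) - t n) * norm v + (t (Suc n) - t n) * norm v"
      using diff_bound[of n v] by (intro add_mono mult_right_mono) auto
    finally show "norm ((a (Suc n) - a n) * v) \<le> 2 * (t (Suc n) - t n) * norm v"
      by (simp add: algebra_simps)
  qed (use t_mono in simp)
  then have "summable (\<lambda>n. a (Suc n) - a n)"
    by (intro summable_comparison_test'[OF summable_mult[OF sumT, of 2]]) auto
  moreover have "(\<Sum>i<n. a (Suc i) - a i) = a n" for n
    by (simp add: sum_lessThan_telescope a0)
  ultimately obtain A where A: "a \<longlonglongrightarrow> A"
    by (auto simp: summable_iff_convergent convergent_def)
  have "summable (\<lambda>n. s (Suc n) - s n)"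
    using diff_bound by (intro summable_comparison_test'[OF sumT]) auto
  moreover have "(\<Sum>i<n. s (Suc i) - s i) = s n" for n
    by (simp add: sum_lessThan_telescope s0)
  ultimately obtain S where S: "s \<longlonglongrightarrow> S"
    by (auto simp: summable_iff_convergent convergent_def)
  show ?thesis
  proof (rule that[of A S])
    show "star A = A"
      using LIMSEQ_unique[OF bounded_linear.tendsto[OF bounded_linear_star A, unfolded a_sa] A] .
    show "c * A = A * c" if c: "c * b = b * c" for c
      using LIMSEQ_unique[OF tendsto_mult[OF tendsto_const[of c] A, unfolded a_comm[OF c]]
          tendsto_mult[OF A tendsto_const[of c]]] .
    show "norm (S *\<^sub>R v - A * v) \<le> norm v" for v
    proof (rule tendsto_upperbound)
      show "(\<lambda>n. norm (K n v)) \<longlonglongrightarrow> norm (S *\<^sub>R v - A * v)"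
        unfolding K_def by (intro tendsto_intros S A)
      show "\<forall>\<^sub>F n in sequentially. norm (K n v) \<le> norm v"
        by (intro always_eventually allI order_trans[OF K_bound] mult_left_le_one_le t_nonneg t_le1 norm_ge_zero)
    qed simp
    show "0 \<le> S" by (rule LIMSEQ_le_const[OF S]) (use s_nonneg in auto)
    show "S \<le> 1" by (rule LIMSEQ_le_const2[OF S]) (meson s_le_t t_le1 order_trans)
    have "(\<lambda>n. s (Suc n)) \<longlonglongrightarrow> (\<sigma> + S\<^sup>2) / 2" unfolding sS by (intro tendsto_intros S) simp
    from arg_cong[OF LIMSEQ_unique[OF LIMSEQ_Suc[OF S] this], of "\<lambda>u. 2 * u"]
    show "2 * S = \<sigma> + S\<^sup>2" by simp
    have "(\<lambda>n. a (Suc n)) \<longlonglongrightarrow> (1/2) *\<^sub>R b + S *\<^sub>R A - (1/2) *\<^sub>R (A * A)"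
      unfolding aS by (intro tendsto_intros S A)
    then have "A = (1/2) *\<^sub>R b + S *\<^sub>R A - (1/2) *\<^sub>R (A * A)"
      using LIMSEQ_unique[OF LIMSEQ_Suc[OF A]] by blast
    then have "2 *\<^sub>R A = 2 *\<^sub>R ((1/2) *\<^sub>R b + S *\<^sub>R A - (1/2) *\<^sub>R (A * A))"
      by (rule arg_cong)
    then have "2 *\<^sub>R A = b + (2 * S) *\<^sub>R A - A * A"
      unfolding scaleR_right_distrib scaleR_right_diff_distrib scaleR_scaleR by simp
    then show "A * A + (2 * (1 - S)) *\<^sub>R A = b" by (simp add: algebra_simps)
  qed
qed

text \<open>
  The element \<open>1 - k\<close> is the square root of \<open>1 - h\<close>.
\<close>

lemma sqrt_one_minus:
  fixes h :: "'a::cstar_algebra"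
  assumes "star h = h" "norm h \<le> 1"
  obtains k where "star k = k" "\<And>c. c * h = h * c \<Longrightarrow> c * k = k * c" "h + k * k = 2 *\<^sub>R k"
proof -
  have contr: "norm (0 *\<^sub>R v - (- h) * v) \<le> norm v" for v
    using norm_mult_ineq[of h v] mult_right_mono[OF assms(2), of "norm v"] by simp
  have sa: "star (- h) = - h" using assms(1) by (simp add: star_minus)
  obtain a s where a: "star a = a" "\<And>c. c * (- h) = (- h) * c \<Longrightarrow> c * a = a * c"
    "\<And>v. norm (s *\<^sub>R v - a * v) \<le> norm v"
    and s: "0 \<le> s" "s \<le> 1" "2 * s = 0 + s\<^sup>2" and eq: "a * a + (2 * (1 - s)) *\<^sub>R a = - h"
    by (rule sqrt_in_unitization[of "(- h)" 0, OF sa order_refl zero_le_one contr]) (rule that)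
  have "s * (2 - s) = 0" using s(3) by (simp add: power2_eq_square algebra_simps)
  then have "s = 0" using s(2) by auto
  then have "a * a + 2 *\<^sub>R a = - h" using eq by simp
  then have h: "h = - (a * a + 2 *\<^sub>R a)" by simp
  have 1: "h + (- a) * (- a) = 2 *\<^sub>R (- a)" unfolding h by simp
  have 2: "c * (- a) = (- a) * c" if "c * h = h * c" for c
    using a(2)[of c] that by simp
  have 3: "star (- a) = - a" by (simp add: star_minus a(1))
  show ?thesis by (rule that[OF 3 2 1])
qed

text \<open>
  With \<open>1 - k = \<surd>(1 - x\<^sup>2)\<close> one has \<open>1 - x\<^sup>2 = (1 - k)\<^sup>2\<close>, a product of two contractions.
\<close>

lemma square_contraction:
  fixes x :: "'a::cstar_algebra"
  assumes "star x = x" "norm x \<le> 1"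
  shows "norm (v - x * x * v) \<le> norm v"
proof -
  have sa: "star (x * x) = x * x" by (simp add: star_mult assms(1))
  have "norm (x * x) \<le> 1"
    using cstar_identity[of x] assms by (simp add: power_le_one)
  from sa this obtain k where k: "star k = k" "\<And>c. c * (x * x) = (x * x) * c \<Longrightarrow> c * k = k * c"
      "x * x + k * k = 2 *\<^sub>R k"
    by (rule sqrt_one_minus) (rule that)
  have "x * k = k * x" by (rule k(2)) (simp add: mult.assoc)
  note contr = unitary_part_contraction(2)[OF assms(1) k(1) this k(3)]
  have eq: "v - x * x * v = (v - k * v) - k * (v - k * v)"
  proof -
    have "x * x * v + k * k * v = (2 *\<^sub>R k) * v" by (simp flip: k(3) distrib_right)
    then show ?thesis by (simp add: scaleR_2 algebra_simps)
  qed
  show ?thesis unfolding eq by (rule order_trans[OF contr contr])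
qed

text \<open>
  For a self-adjoint \<open>p\<close> the condition \<open>\<parallel>t1 - p\<parallel> \<le> t\<close> in the unitization means that the spectrum
  of \<open>p\<close> lies in \<open>[0,2t]\<close>. In this form positivity is visibly stable under sums.
\<close>

definition spec_nonneg :: "'a::cstar_algebra \<Rightarrow> bool" where
  "spec_nonneg p \<longleftrightarrow> star p = p \<and> (\<exists>t>0. \<forall>v. norm (t *\<^sub>R v - p * v) \<le> t * norm v)"

lemma spec_nonneg_sa: "spec_nonneg p \<Longrightarrow> star p = p"
  by (simp add: spec_nonneg_def)

lemma spec_nonneg_add:
  assumes "spec_nonneg p" "spec_nonneg q"
  shows "spec_nonneg (p + q)"
proof -
  obtain t u where t: "t > 0" "\<And>v. norm (t *\<^sub>R v - p * v) \<le> t * norm v"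
    and u: "u > 0" "\<And>v. norm (u *\<^sub>R v - q * v) \<le> u * norm v"
    using assms by (auto simp: spec_nonneg_def)
  have "norm ((t + u) *\<^sub>R v - (p + q) * v) \<le> (t + u) * norm v" for v
    using norm_triangle_ineq[of "t *\<^sub>R v - p * v" "u *\<^sub>R v - q * v"] t(2)[of v] u(2)[of v]
    by (simp add: algebra_simps)
  moreover have "t + u > 0" using t u by simp
  ultimately show ?thesis using assms unfolding spec_nonneg_def by (auto simp: star_add)
qed

lemma spec_nonneg_scaleR:
  assumes "spec_nonneg p" "0 < r"
  shows "spec_nonneg (r *\<^sub>R p)"
proof -
  obtain t where t: "t > 0" "\<And>v. norm (t *\<^sub>R v - p * v) \<le> t * norm v"
    using assms by (auto simp: spec_nonneg_def)
  have "norm ((r * t) *\<^sub>R v - (r *\<^sub>R p) * v) \<le> (r * t) * norm v" for v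
  proof -
    have "norm ((r * t) *\<^sub>R v - (r *\<^sub>R p) * v) = r * norm (t *\<^sub>R v - p * v)"
      using assms(2) norm_scaleR[of r "t *\<^sub>R v - p * v"] by (simp add: scaleR_diff_right)
    then show ?thesis using t(2)[of v] assms(2) by simp
  qed
  moreover have "r * t > 0" using t assms by simp
  ultimately show ?thesis using assms unfolding spec_nonneg_def by (auto simp: star_scaleR)
qed

lemma spec_nonneg_sqrt:
  fixes p :: "'a::cstar_algebra"
  assumes "spec_nonneg p"
  obtains z where "star z = z" "z * z = p" "\<And>c. c * p = p * c \<Longrightarrow> c * z = z * c"
proof -
  obtain t where t: "t > 0" "\<And>v. norm (t *\<^sub>R v - p * v) \<le> t * norm v" and p: "star p = p"
    using assms by (auto simp: spec_nonneg_def)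
  define b where "b = (1 / t) *\<^sub>R p"
  have contr: "norm (1 *\<^sub>R v - b * v) \<le> norm v" for v
  proof -
    have eq: "1 *\<^sub>R v - b * v = (1 / t) *\<^sub>R (t *\<^sub>R v - p * v)"
      using t(1) by (simp add: b_def algebra_simps)
    show ?thesis unfolding eq norm_scaleR using t(1) t(2)[of v] by (simp add: field_simps)
  qed
  have sa: "star b = b" using p by (simp add: b_def star_scaleR)
  obtain a s where a: "star a = a" "\<And>c. c * b = b * c \<Longrightarrow> c * a = a * c"
    "\<And>v. norm (s *\<^sub>R v - a * v) \<le> norm v"
    and s: "0 \<le> s" "s \<le> 1" "2 * s = 1 + s\<^sup>2" and eq: "a * a + (2 * (1 - s)) *\<^sub>R a = b"
    by (rule sqrt_in_unitization[of "b" 1, OF sa zero_le_one order_refl contr]) (rule that)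
  have "(s - 1)\<^sup>2 = 0" using s(3) by (simp add: power2_diff)
  then have "a * a = b" using eq by simp
  then have 1: "(sqrt t *\<^sub>R a) * (sqrt t *\<^sub>R a) = p" using t(1) by (simp add: b_def)
  have 2: "c * (sqrt t *\<^sub>R a) = (sqrt t *\<^sub>R a) * c" if "c * p = p * c" for c
    using a(2)[of c] that by (simp add: b_def)
  have 3: "star (sqrt t *\<^sub>R a) = sqrt t *\<^sub>R a" by (simp add: star_scaleR a(1))
  show ?thesis by (rule that[OF 3 1 2])
qed

lemma pos_elem_if_spec_nonneg:
  assumes "spec_nonneg p"
  shows "pos_elem p"
proof -
  obtain z where "star z = z" "z * z = p"
    using assms by (rule spec_nonneg_sqrt) (rule that)
  then have "p = star z * z" by simp
  then show ?thesis unfolding pos_elem_def by blast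
qed

text \<open>
  If \<open>K = 1 - p\<close> is self-adjoint, the sequence \<open>\<parallel>K\<^sup>n v\<parallel>\<close> is logarithmically convex. Once it increases
  it therefore grows geometrically, so linear growth forces \<open>\<parallel>K v\<parallel> \<le> \<parallel>v\<parallel>\<close>.
\<close>

lemma contraction_if_linear_growth:
  fixes p v :: "'a::cstar_algebra"
  assumes sa: "star p = p"
    and growth: "\<And>n. norm (((\<lambda>u. u - p * u) ^^ n) v) \<le> (1 + real n) * norm v"
  shows "norm (v - p * v) \<le> norm v"
proof (rule ccontr)
  assume neg: "\<not> norm (v - p * v) \<le> norm v"
  define K where "K = (\<lambda>u. u - p * u)"
  define a where "a n = norm ((K ^^ n) v)" for n
  have logconv: "(norm (K u))\<^sup>2 \<le> norm u * norm (K (K u))" for u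
  proof -
    have "star (K u) * K u = star u * K (K u)"
      by (simp add: K_def star_simps sa algebra_simps)
    then have "(norm (K u))\<^sup>2 = norm (star u * K (K u))" by (simp flip: cstar_identity)
    then show ?thesis using norm_mult_ineq[of "star u" "K (K u)"] by simp
  qed
  have v: "v \<noteq> 0" using neg by auto
  define \<rho> where "\<rho> = norm (K v) / norm v"
  have \<rho>: "\<rho> > 1" using neg v by (simp add: \<rho>_def K_def)
  have ratio: "a n > 0 \<and> \<rho> * a n \<le> a (Suc n)" for n
  proof (induction n)
    case 0
    then show ?case using v by (simp add: a_def \<rho>_def)
  next
    case (Suc n)
    have "0 < \<rho> * a n" using Suc \<rho> by simp
    then have pos: "a (Suc n) > 0" using Suc by linarith
    have "(a (Suc n))\<^sup>2 \<le> a n * a (Suc (Suc n))"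
      using logconv[of "(K ^^ n) v"] by (simp add: a_def)
    then have "\<rho> * (a (Suc n))\<^sup>2 \<le> (\<rho> * a n) * a (Suc (Suc n))"
      using \<rho> by (simp add: mult.assoc)
    also have "\<dots> \<le> a (Suc n) * a (Suc (Suc n))"
      using Suc by (intro mult_right_mono) (auto simp: a_def)
    finally have "a (Suc n) * (\<rho> * a (Suc n)) \<le> a (Suc n) * a (Suc (Suc n))"
      by (simp add: power2_eq_square mult_ac)
    then show ?case using pos by simp
  qed
  have geometric: "\<rho> ^ n * norm v \<le> a n" for n
  proof (induction n)
    case (Suc n)
    have "\<rho> ^ Suc n * norm v \<le> \<rho> * a n" using Suc \<rho> by simp
    then show ?case using ratio[of n] by linarith
  qed (simp add: a_def)
  have bound: "\<rho> ^ n \<le> 1 + real n" for n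
    using order_trans[OF geometric[of n] growth[of n, folded K_def, folded a_def]] v by simp
  define e where "e = \<rho> - 1"
  have e: "e > 0" using \<rho> by (simp add: e_def)
  obtain n :: nat where n: "real n * e\<^sup>2 > 2"
    using reals_Archimedean3[of "e\<^sup>2"] e by auto
  \<comment> \<open>squaring Bernoulli gives quadratic growth of \<open>\<rho>\<^sup>2\<^sup>n\<close>, against the linear bound\<close>
  have "1 + real n * e \<le> \<rho> ^ n"
    using Bernoulli_inequality[of e n] e by (simp add: e_def)
  then have "(1 + real n * e)\<^sup>2 \<le> (\<rho> ^ n)\<^sup>2" using e by (intro power_mono) auto
  also have "\<dots> = \<rho> ^ (2 * n)" by (simp add: power_mult[symmetric] mult.commute)
  also have "\<dots> \<le> 1 + 2 * real n" using bound[of "2 * n"] by simp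
  finally have "real n * (real n * e\<^sup>2) \<le> real n * 2 - 2 * (real n * e)"
    by (simp add: power2_eq_square algebra_simps)
  moreover have "0 < real n" using n by (cases n) auto
  then have "real n * (real n * e\<^sup>2) > real n * 2" "real n * e > 0" using n e by simp_all
  ultimately show False by linarith
qed

text \<open>
  Scale \<open>x\<close> to \<open>\<parallel>y\<parallel> \<le> 1\<close> and let \<open>a = \<bar>y\<bar>\<close> be the square root of \<open>y\<^sup>2\<close>; the parts are \<open>(a \<plusminus> y)/2\<close>. Their
  positivity is the point. For \<open>p = (a + y)/2\<close> one has \<open>p\<^sup>2 = pa\<close>, hence \<open>p(1 - p)\<^sup>n = (1 - a)\<^sup>n p\<close> is
  bounded in \<open>n\<close> and \<open>(1 - p)\<^sup>n\<close> grows at most linearly.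
\<close>

lemma pos_neg_parts:
  fixes x :: "'a::cstar_algebra"
  assumes "star x = x"
  obtains p m where "x = p - m" "p * m = 0" "m * p = 0" "spec_nonneg p" "spec_nonneg m"
proof -
  define r where "r = norm x + 1"
  have r: "r > 0" using norm_ge_zero[of x] unfolding r_def by linarith
  define y where "y = (1 / r) *\<^sub>R x"
  have y: "star y = y" "norm y \<le> 1" using assms r by (simp_all add: y_def star_scaleR r_def)
  have sa: "star (y * y) = y * y" and contr: "\<And>v. norm (1 *\<^sub>R v - y * y * v) \<le> norm v"
    using square_contraction[OF y] y(1) by (simp_all add: star_mult)
  obtain a s where a: "star a = a" "\<And>c. c * (y * y) = (y * y) * c \<Longrightarrow> c * a = a * c"
    "\<And>v. norm (s *\<^sub>R v - a * v) \<le> norm v"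
    and s: "0 \<le> s" "s \<le> 1" "2 * s = 1 + s\<^sup>2" and eq: "a * a + (2 * (1 - s)) *\<^sub>R a = (y * y)"
    by (rule sqrt_in_unitization[of "(y * y)" 1, OF sa zero_le_one order_refl contr]) (rule that)
  have "(s - 1)\<^sup>2 = 0" using s(3) by (simp add: power2_diff)
  then have s1: "s = 1" and aa: "a * a = y * y" using eq by simp_all
  have ya: "y * a = a * y" by (rule a(2)) (simp add: mult.assoc)
  have "(norm a)\<^sup>2 = (norm y)\<^sup>2" using cstar_identity[of a] cstar_identity[of y] aa a(1) y(1) by simp
  then have norm_a: "norm a \<le> 1" using y by simp
  have half: "spec_nonneg ((1/2) *\<^sub>R (a + w))"
    if w: "star w = w" "w * w = a * a" "w * a = a * w" "norm w \<le> 1" for w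
  proof -
    define p where "p = (1/2) *\<^sub>R (a + w)"
    have p_sa: "star p = p" by (simp add: p_def star_scaleR star_add w(1) a(1))
    have "(a + w) * (a + w) = 2 *\<^sub>R ((a + w) * a)"
      by (simp add: distrib_left distrib_right w(2,3) scaleR_2)
    then have pp: "p * p = p * a" by (simp add: p_def)
    have pa: "a * p = p * a" by (simp add: p_def distrib_left distrib_right w(3))
    have norm_p: "norm p \<le> 1" using norm_triangle_ineq[of a w] norm_a w(4) by (simp add: p_def)
    define K where "K = (\<lambda>u. u - p * u)"
    have pK: "norm (p * (K ^^ n) v) \<le> norm v" for n v
    proof (induction n)
      case 0
      show ?case using norm_mult_ineq[of p v] mult_right_mono[OF norm_p, of "norm v"] by simp
    next
      case (Suc n)
      let ?u = "(K ^^ n) v"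
      have "p * K ?u = p * ?u - a * (p * ?u)"
        unfolding K_def right_diff_distrib mult.assoc[symmetric] pa pp ..
      then have "norm (p * K ?u) \<le> norm (p * ?u)" using a(3)[of "p * ?u"] s1 by simp
      then show ?case using Suc by simp
    qed
    have "norm ((K ^^ n) v) \<le> (1 + real n) * norm v" for n v
    proof (induction n)
      case (Suc n)
      have "norm ((K ^^ Suc n) v) \<le> norm ((K ^^ n) v) + norm (p * (K ^^ n) v)"
        using norm_triangle_ineq4[of "(K ^^ n) v" "p * (K ^^ n) v"] by (simp add: K_def)
      then show ?case using Suc pK[of n v] by (simp add: algebra_simps)
    qed simp
    then have "norm (1 *\<^sub>R v - p * v) \<le> 1 * norm v" for v
      using contraction_if_linear_growth[OF p_sa, folded K_def] by simp
    then show ?thesis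
      using p_sa zero_less_one unfolding p_def[symmetric] spec_nonneg_def by blast
  qed
  define p m where "p = (1/2) *\<^sub>R (a + y)" and "m = (1/2) *\<^sub>R (a + - y)"
  have "spec_nonneg p" unfolding p_def by (rule half) (simp_all add: y ya aa)
  moreover have "spec_nonneg m" unfolding m_def by (rule half) (simp_all add: y ya aa star_minus)
  moreover have "p * m = 0" "m * p = 0"
  proof -
    have "(a + y) * (a + - y) = 0" "(a + - y) * (a + y) = 0"
      by (simp_all add: distrib_left distrib_right left_diff_distrib right_diff_distrib aa ya)
    then show "p * m = 0" "m * p = 0"
      unfolding p_def m_def mult_scaleR_left mult_scaleR_right by simp_all
  qed
  moreover have "x = r *\<^sub>R p - r *\<^sub>R m"
  proof -
    have "p - m = (1/2) *\<^sub>R (y + y)"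
      unfolding p_def m_def scaleR_right_diff_distrib[symmetric] by simp
    then have "p - m = y" by simp
    then show ?thesis unfolding scaleR_right_diff_distrib[symmetric] using r by (simp add: y_def)
  qed
  ultimately show ?thesis using r by (intro that[of "r *\<^sub>R p" "r *\<^sub>R m"]) (simp_all add: spec_nonneg_scaleR)
qed

text \<open>
  The element \<open>g = p(p + \<delta>)\<^sup>-\<^sup>1\<close>, found as a fixed point: with \<open>\<parallel>t1 - p\<parallel> \<le> t\<close> the equation
  \<open>(p + \<delta>)g = p\<close> reads \<open>g = (p + (t - p)g)/(t + \<delta>)\<close>, whose right-hand side contracts with factor
  \<open>t/(t + \<delta>)\<close>. It is an approximate unit for \<open>p\<close> as \<open>\<delta>\<close> tends to \<open>0\<close>.
\<close>

lemma regularized_quotient: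
  fixes p :: "'a::cstar_algebra"
  assumes p: "spec_nonneg p" and \<delta>: "\<delta> > 0"
  obtains g where "star g = g" "p * g = g * p" "p * g + \<delta> *\<^sub>R g = p" "norm g \<le> 2"
proof -
  obtain t where t: "t > 0" "\<And>v. norm (t *\<^sub>R v - p * v) \<le> t * norm v" and sa: "star p = p"
    using p by (auto simp: spec_nonneg_def)
  have td: "t + \<delta> > 0" using t \<delta> by simp
  define f where "f g = (1 / (t + \<delta>)) *\<^sub>R (p + (t *\<^sub>R g - p * g))" for g
  have "dist (f x) (f y) \<le> t / (t + \<delta>) * dist x y" for x y
  proof -
    have "f x - f y = (1 / (t + \<delta>)) *\<^sub>R (t *\<^sub>R (x - y) - p * (x - y))"
      unfolding f_def scaleR_right_diff_distrib[symmetric] by (simp add: algebra_simps)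
    then have "dist (f x) (f y) = 1 / (t + \<delta>) * norm (t *\<^sub>R (x - y) - p * (x - y))"
      using td by (simp add: dist_norm)
    also have "\<dots> \<le> 1 / (t + \<delta>) * (t * norm (x - y))"
      using td by (intro mult_left_mono t) auto
    finally show ?thesis by (simp add: dist_norm)
  qed
  then obtain g where "f g = g"
    using banach_fix_type[of "t / (t + \<delta>)" f] t \<delta> by auto
  then have "(t + \<delta>) *\<^sub>R ((1 / (t + \<delta>)) *\<^sub>R (p + (t *\<^sub>R g - p * g))) = (t + \<delta>) *\<^sub>R g"
    by (simp add: f_def)
  then have "p + (t *\<^sub>R g - p * g) = (t + \<delta>) *\<^sub>R g" using td by simp
  then have eq: "\<delta> *\<^sub>R g = p - p * g" by (simp add: algebra_simps)
  \<comment> \<open>injectivity of \<open>p + \<delta>\<close>; it makes \<open>g\<close> commute with \<open>p\<close> and self-adjoint\<close>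
  have inj: "h = 0" if "\<delta> *\<^sub>R h = - (p * h)" for h
  proof -
    have "(t + \<delta>) *\<^sub>R h = t *\<^sub>R h - p * h" using that by (simp add: algebra_simps)
    then have "norm ((t + \<delta>) *\<^sub>R h) \<le> t * norm h" using t(2)[of h] by (rule ssubst)
    then have "\<delta> * norm h \<le> 0" using td by (simp add: distrib_right)
    then show ?thesis using \<delta> by (simp add: mult_le_0_iff)
  qed
  have "\<delta> *\<^sub>R (p * g - g * p) = p * (\<delta> *\<^sub>R g) - (\<delta> *\<^sub>R g) * p"
    by (simp add: scaleR_right_diff_distrib)
  also have "\<dots> = - (p * (p * g - g * p))"
    unfolding eq by (simp add: right_diff_distrib left_diff_distrib mult.assoc)
  finally have "p * g - g * p = 0" by (rule inj)
  then have comm: "p * g = g * p" by simp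
  have "\<delta> *\<^sub>R star g = star (p - p * g)" by (simp flip: eq add: star_scaleR)
  also have "\<dots> = p - p * star g" unfolding comm by (simp add: star_diff star_mult sa)
  finally have "\<delta> *\<^sub>R (g - star g) = - (p * (g - star g))"
    using eq by (simp add: scaleR_right_diff_distrib right_diff_distrib)
  then have g_sa: "star g = g" using inj[of "g - star g"] by simp
  have "norm (g * v) \<le> 2 * norm v" for v
  proof -
    \<comment> \<open>\<open>1 - g = \<delta>(p + \<delta>)\<^sup>-\<^sup>1\<close> is a contraction\<close>
    define w where "w = v - g * v"
    have "\<delta> *\<^sub>R w = \<delta> *\<^sub>R v - (\<delta> *\<^sub>R g) * v" by (simp add: w_def scaleR_right_diff_distrib)
    also have "\<dots> = \<delta> *\<^sub>R v - p * w"
      unfolding eq by (simp add: w_def right_diff_distrib left_diff_distrib mult.assoc)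
    finally have "(t + \<delta>) *\<^sub>R w = \<delta> *\<^sub>R v + (t *\<^sub>R w - p * w)" by (simp add: scaleR_left_distrib)
    then have "norm ((t + \<delta>) *\<^sub>R w) \<le> \<delta> * norm v + t * norm w"
      using norm_triangle_ineq[of "\<delta> *\<^sub>R v" "t *\<^sub>R w - p * w"] t(2)[of w] \<delta> by simp
    then have "\<delta> * norm w \<le> \<delta> * norm v" using td by (simp add: distrib_right)
    then have "norm w \<le> norm v" using \<delta> by simp
    moreover have "g * v = v - w" by (simp add: w_def)
    ultimately show ?thesis using norm_triangle_ineq4[of v w] by simp
  qed
  then have "norm g \<le> 2" by (rule norm_le_if_mult_bound[rotated]) simp
  moreover have "p * g + \<delta> *\<^sub>R g = p" unfolding eq by simp
  ultimately show ?thesis using that[OF g_sa comm] by blast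
qed

lemma pos_elem_sa: "pos_elem x \<Longrightarrow> star x = x"
  by (auto simp: pos_elem_def star_mult star_star)

lemma pos_elem_star_mult [simp]: "pos_elem (star x * x)"
  by (auto simp: pos_elem_def)

lemma pos_elem_zero [simp]: "pos_elem 0"
  using pos_elem_star_mult[of 0] by simp

section \<open>Positive and square integrable elements\<close>

context cstar_trace
begin

lemma trace_zero: "\<tau> 0 = 0"
  using trace_scale[of 0 0] by simp

text \<open>
  An element \<open>x = a\<^sup>*a = p - m\<close> satisfies \<open>(am)\<^sup>*(am) = m x m = -m\<^sup>3\<close>, so two elements of the form
  \<open>y\<^sup>*y\<close> add up to \<open>0\<close>. The trace is additive and faithful, hence both vanish and \<open>m = 0\<close>.
\<close>

lemma spec_nonneg_if_pos_elem:
  fixes x :: 'a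
  assumes "pos_elem x"
  shows "spec_nonneg x"
proof -
  obtain a where a: "x = star a * a" using assms by (auto simp: pos_elem_def)
  obtain p m where pm: "x = p - m" "p * m = 0" and p: "spec_nonneg p" and m: "spec_nonneg m"
    by (rule pos_neg_parts[OF pos_elem_sa[OF assms]]) (rule that)
  obtain w where w: "star w = w" "w * w = m"
    using m by (rule spec_nonneg_sqrt) (rule that)
  have m_sa: "star m = m" by (rule spec_nonneg_sa[OF m])
  have "star (a * m) * (a * m) = m * (x * m)" by (simp add: star_mult m_sa a mult.assoc)
  also have "x * m = - (m * m)" by (simp add: pm(1) left_diff_distrib pm(2))
  also have "m * - (m * m) = - (star (w * m) * (w * m))"
  proof -
    have "star (w * m) * (w * m) = m * (w * w) * m" by (simp only: star_mult m_sa w(1) mult.assoc)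
    then show ?thesis by (simp add: w(2) mult.assoc)
  qed
  finally have "star (a * m) * (a * m) + star (w * m) * (w * m) = 0" by simp
  then have "\<tau> (star (a * m) * (a * m)) + \<tau> (star (w * m) * (w * m)) = 0"
    using trace_add[of "star (a * m) * (a * m)" "star (w * m) * (w * m)"] trace_zero by simp
  then have "star (w * m) * (w * m) = 0" by (intro faithful) auto
  then have "w * m = 0" by (simp add: star_mult_self_eq_0)
  then have "w * (w * m) = 0" by simp
  then have "star m * m = 0" using w(2) m_sa by (simp flip: mult.assoc)
  then have "m = 0" by (simp add: star_mult_self_eq_0)
  then show ?thesis using pm(1) p by simp
qed

lemma pos_elem_iff_spec_nonneg: "pos_elem (x::'a) \<longleftrightarrow> spec_nonneg x"
  using spec_nonneg_if_pos_elem pos_elem_if_spec_nonneg by blast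

lemma pos_elem_add: "pos_elem (a::'a) \<Longrightarrow> pos_elem b \<Longrightarrow> pos_elem (a + b)"
  by (simp add: pos_elem_iff_spec_nonneg spec_nonneg_add)

lemma sq_integrable_zero [simp]: "0 \<in> sq_integrable \<tau>"
  by (simp add: sq_integrable_def trace_zero)

lemma sq_integrable_scaleC:
  assumes "a \<in> sq_integrable \<tau>"
  shows "c *\<^sub>C a \<in> sq_integrable \<tau>"
proof -
  have "star (c *\<^sub>C a) * (c *\<^sub>C a) = ((cmod c)\<^sup>2) *\<^sub>R (star a * a)"
    by (simp add: star_scaleC scaleC_mult_left scaleC_mult_right scaleC_scaleC scaleR_scaleC
        complex_norm_square mult.commute del: of_real_power)
  then show ?thesis
    using assms by (simp add: sq_integrable_def trace_scale ennreal_mult_less_top)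
qed

lemma sq_integrable_scaleR: "a \<in> sq_integrable \<tau> \<Longrightarrow> r *\<^sub>R a \<in> sq_integrable \<tau>"
  by (simp add: scaleR_scaleC sq_integrable_scaleC)

lemma sq_integrable_minus: "a \<in> sq_integrable \<tau> \<Longrightarrow> - a \<in> sq_integrable \<tau>"
  using sq_integrable_scaleR[of a "-1"] by simp

lemma sq_integrable_add:
  assumes "a \<in> sq_integrable \<tau>" "b \<in> sq_integrable \<tau>"
  shows "a + b \<in> sq_integrable \<tau>"
proof -
  have "star (a + b) * (a + b) + star (a - b) * (a - b)
      = 2 *\<^sub>R (star a * a) + 2 *\<^sub>R (star b * b)"
    by (simp add: star_add star_diff distrib_left distrib_right left_diff_distrib
        right_diff_distrib scaleR_2)
  moreover have "pos_elem (2 *\<^sub>R (star c * c))" for c :: 'a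
    using pos_elem_add[of "star c * c" "star c * c"] by (simp add: scaleR_2)
  ultimately have "\<tau> (star (a + b) * (a + b)) + \<tau> (star (a - b) * (a - b))
      = 2 * \<tau> (star a * a) + 2 * \<tau> (star b * b)"
    using trace_add[of "star (a + b) * (a + b)" "star (a - b) * (a - b)"]
      trace_add[of "2 *\<^sub>R (star a * a)" "2 *\<^sub>R (star b * b)"]
    by (simp add: trace_scale)
  also have "\<dots> < \<infinity>" using assms by (simp add: sq_integrable_def ennreal_mult_less_top)
  finally show ?thesis by (simp add: sq_integrable_def)
qed

lemma sq_integrable_diff: "a \<in> sq_integrable \<tau> \<Longrightarrow> b \<in> sq_integrable \<tau> \<Longrightarrow> a - b \<in> sq_integrable \<tau>"
  using sq_integrable_add[of a "- b"] by (simp add: sq_integrable_minus)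

lemma sq_integrable_star: "a \<in> sq_integrable \<tau> \<Longrightarrow> star a \<in> sq_integrable \<tau>"
  using trace_commute[of a] by (simp add: sq_integrable_def star_star)

text \<open>
  For \<open>\<parallel>y\<parallel> \<le> 1\<close> write \<open>1 - y\<^sup>*y = (1 - k)\<^sup>2\<close>. Then \<open>a\<^sup>*a\<close> is the sum of \<open>(ya)\<^sup>*(ya)\<close> and
  \<open>(a - ka)\<^sup>*(a - ka)\<close>, whence \<open>\<tau>((ya)\<^sup>*(ya)) \<le> \<tau>(a\<^sup>*a)\<close>.
\<close>

lemma sq_integrable_mult_left:
  assumes a: "a \<in> sq_integrable \<tau>"
  shows "x * a \<in> sq_integrable \<tau>"
proof -
  define r where "r = norm x + 1"
  have r: "r > 0" using norm_ge_zero[of x] unfolding r_def by linarith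
  define y where "y = (1 / r) *\<^sub>R x"
  have "norm y \<le> 1" using r by (simp add: y_def r_def)
  then have ny: "norm (star y * y) \<le> 1" by (simp add: cstar_identity power_le_one)
  have sy: "star (star y * y) = star y * y" by (simp add: star_mult star_star)
  obtain k where k: "star k = k" "star y * y + k * k = 2 *\<^sub>R k"
    by (rule sqrt_one_minus[OF sy ny]) (rule that)
  have "star (y * a) * (y * a) + star (a - k * a) * (a - k * a)
      = star a * (star y * y + k * k - 2 *\<^sub>R k) * a + star a * a"
    by (simp add: star_mult star_diff k(1) distrib_left distrib_right left_diff_distrib
        right_diff_distrib scaleR_2 mult.assoc)
  then have "\<tau> (star (y * a) * (y * a)) + \<tau> (star (a - k * a) * (a - k * a)) = \<tau> (star a * a)"
    using trace_add[of "star (y * a) * (y * a)" "star (a - k * a) * (a - k * a)"] by (simp add: k(2))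
  then have "\<tau> (star (y * a) * (y * a)) \<le> \<tau> (star a * a)"
    by (metis add.right_neutral add_left_mono zero_le)
  then have "y * a \<in> sq_integrable \<tau>" using a by (auto simp: sq_integrable_def)
  then have "r *\<^sub>R (y * a) \<in> sq_integrable \<tau>" by (rule sq_integrable_scaleR)
  then show ?thesis using r by (simp add: y_def)
qed

lemma sq_integrable_mult_right: "a \<in> sq_integrable \<tau> \<Longrightarrow> a * x \<in> sq_integrable \<tau>"
  using sq_integrable_star[OF sq_integrable_mult_left[OF sq_integrable_star[of a], of "star x"]]
  by (simp add: star_mult star_star)

lemma sq_integrable_parts:
  assumes "p - m \<in> sq_integrable \<tau>" "star p = p" "star m = m" "p * m = 0" "m * p = 0"
  shows "p \<in> sq_integrable \<tau>" "m \<in> sq_integrable \<tau>"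
proof -
  have "star (p - m) * (p - m) = star p * p + star m * m"
    using assms by (simp add: star_diff left_diff_distrib right_diff_distrib)
  then have "\<tau> (star p * p) + \<tau> (star m * m) < \<infinity>"
    using assms(1) trace_add[of "star p * p" "star m * m"] by (simp add: sq_integrable_def)
  then show "p \<in> sq_integrable \<tau>" "m \<in> sq_integrable \<tau>"
    by (simp_all add: sq_integrable_def)
qed

end

section \<open>The cone of the GNS space\<close>

context gns_space
begin

lemma Lambda_scaleR: "a \<in> sq_integrable \<tau> \<Longrightarrow> \<Lambda> (r *\<^sub>R a) = r *\<^sub>R \<Lambda> a"
  by (simp add: scaleR_scaleC Lambda_scaleC)

lemma Lambda_minus: "a \<in> sq_integrable \<tau> \<Longrightarrow> \<Lambda> (- a) = - \<Lambda> a"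
  using Lambda_scaleR[of a "-1"] by simp

lemma Lambda_diff:
  "a \<in> sq_integrable \<tau> \<Longrightarrow> b \<in> sq_integrable \<tau> \<Longrightarrow> \<Lambda> (a - b) = \<Lambda> a - \<Lambda> b"
  using Lambda_add[of a "- b"] by (simp add: Lambda_minus sq_integrable_minus)

lemma Lambda_zero [simp]: "\<Lambda> 0 = 0"
  using Lambda_scaleR[of 0 0] by simp

lemma Lambda_eq_0:
  assumes "a \<in> sq_integrable \<tau>" "\<Lambda> a = 0"
  shows "a = 0"
proof -
  have "\<tau> (star a * a) = 0" using norm_Lambda[OF assms(1)] assms(2) by simp
  then show ?thesis using faithful[of "star a * a"] by (simp add: star_mult_self_eq_0)
qed

lemma trace_square_sum:
  assumes "a \<in> sq_integrable \<tau>" "b \<in> sq_integrable \<tau>"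
  shows "\<tau> (star a * a + star b * b) = ennreal ((norm (\<Lambda> a))\<^sup>2 + (norm (\<Lambda> b))\<^sup>2)"
  using assms by (simp add: trace_add ennreal_plus flip: norm_Lambda)

lemma trace_square_sum3:
  assumes "a \<in> sq_integrable \<tau>" "b \<in> sq_integrable \<tau>" "c \<in> sq_integrable \<tau>"
  shows "\<tau> (star a * a + star b * b + star c * c)
    = ennreal ((norm (\<Lambda> a))\<^sup>2 + (norm (\<Lambda> b))\<^sup>2 + (norm (\<Lambda> c))\<^sup>2)"
proof -
  have "\<tau> (star a * a + star b * b + star c * c) = \<tau> (star a * a + star b * b) + \<tau> (star c * c)"
    by (intro trace_add pos_elem_add pos_elem_star_mult)
  then show ?thesis using assms by (simp add: trace_square_sum flip: norm_Lambda ennreal_plus)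
qed

text \<open>
  The two sides are the cross terms in the expansions of \<open>(xu + v)\<^sup>*(xu + v)\<close> and
  \<open>(u + x\<^sup>*v)\<^sup>*(u + x\<^sup>*v)\<close>, both equal to \<open>u\<^sup>*x\<^sup>*v\<close> plus its adjoint. Moving the diagonal terms
  to the other side gives an identity between sums of positive elements, to which the additive
  trace applies.
\<close>

lemma inner_Lambda_adjoint:
  assumes u: "u \<in> sq_integrable \<tau>" and v: "v \<in> sq_integrable \<tau>"
  shows "\<Lambda> (x * u) \<bullet> \<Lambda> v = \<Lambda> u \<bullet> \<Lambda> (star x * v)"
proof -
  note si = sq_integrable_mult_left[OF u, of x] sq_integrable_mult_left[OF v, of "star x"] u v
  have "star (x * u + v) * (x * u + v) + star u * u + star (star x * v) * (star x * v)
      = star (u + star x * v) * (u + star x * v) + star (x * u) * (x * u) + star v * v"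
    by (simp add: star_mult star_add star_star distrib_left distrib_right mult.assoc add_ac)
  then have "ennreal ((norm (\<Lambda> (x * u + v)))\<^sup>2 + (norm (\<Lambda> u))\<^sup>2 + (norm (\<Lambda> (star x * v)))\<^sup>2)
      = ennreal ((norm (\<Lambda> (u + star x * v)))\<^sup>2 + (norm (\<Lambda> (x * u)))\<^sup>2 + (norm (\<Lambda> v))\<^sup>2)"
    by (simp only: sq_integrable_add si flip: trace_square_sum3)
  then have "(norm (\<Lambda> (x * u + v)))\<^sup>2 + (norm (\<Lambda> u))\<^sup>2 + (norm (\<Lambda> (star x * v)))\<^sup>2
      = (norm (\<Lambda> (u + star x * v)))\<^sup>2 + (norm (\<Lambda> (x * u)))\<^sup>2 + (norm (\<Lambda> v))\<^sup>2"
    by (subst (asm) ennreal_inj) auto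
  then show ?thesis
    using si by (simp add: Lambda_add power2_norm_eq_inner inner_add_left inner_add_right
        inner_commute)
qed

lemma inner_J: "J \<xi> \<bullet> J \<eta> = \<xi> \<bullet> \<eta>"
  using arg_cong[OF J_cinner[of \<xi> \<eta>], of Re] by (simp only: Re_cinner inner_commute)

lemma J_scaleR: "J (r *\<^sub>R \<xi>) = r *\<^sub>R J \<xi>"
  by (simp add: scaleR_scaleC J_scaleC)

lemma norm_J: "norm (J \<xi>) = norm \<xi>"
  by (simp add: norm_eq_sqrt_inner inner_J)

lemma bounded_linear_J: "bounded_linear J"
  by (rule bounded_linear_intro[of _ 1]) (simp_all add: J_add J_scaleR norm_J)

text \<open>
  Formally both sides are the real part of \<open>\<tau>(x\<^sup>*ax)\<close>. The traciality needed to exchange left and right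
  multiplication enters through the isometry \<open>J\<close>.
\<close>

lemma inner_Lambda_mult_star:
  assumes x: "x \<in> sq_integrable \<tau>" and a: "a \<in> sq_integrable \<tau>"
  shows "\<Lambda> (x * star x) \<bullet> \<Lambda> a = \<Lambda> x \<bullet> \<Lambda> (a * x)"
proof -
  note si = sq_integrable_star[OF x] sq_integrable_star[OF a]
  have "\<Lambda> (x * star x) \<bullet> \<Lambda> a = \<Lambda> (x * star x) \<bullet> \<Lambda> (star a)"
    using inner_J[of "\<Lambda> (x * star x)" "\<Lambda> a"] sq_integrable_mult_right[OF x, of "star x"] a
    by (simp add: J_Lambda star_mult star_star)
  also have "\<dots> = \<Lambda> (star x) \<bullet> \<Lambda> (star (a * x))"
    using inner_Lambda_adjoint[OF si, of x] by (simp add: star_mult)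
  also have "\<dots> = \<Lambda> x \<bullet> \<Lambda> (a * x)"
    using inner_J[of "\<Lambda> x" "\<Lambda> (a * x)"] sq_integrable_mult_left[OF x, of a] x
    by (simp add: J_Lambda)
  finally show ?thesis .
qed

lemma closed_eq_UNIV_if_Lambda:
  assumes "closed S" "\<And>a. a \<in> sq_integrable \<tau> \<Longrightarrow> \<Lambda> a \<in> S"
  shows "\<xi> \<in> S"
  using closure_minimal[of "\<Lambda> ` sq_integrable \<tau>" S] assms Lambda_dense by auto

lemma pi_nonneg:
  assumes "pos_elem a"
  shows "0 \<le> \<xi> \<bullet> \<pi> a \<xi>"
proof -
  obtain d where d: "a = star d * d" using assms by (auto simp: pos_elem_def)
  have "closed {\<xi>. 0 \<le> \<xi> \<bullet> \<pi> a \<xi>}"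
    by (intro closed_Collect_le continuous_intros linear_continuous_on pi_bounded)
  moreover have "0 \<le> \<Lambda> u \<bullet> \<pi> a (\<Lambda> u)" if u: "u \<in> sq_integrable \<tau>" for u
  proof -
    have "\<Lambda> u \<bullet> \<pi> a (\<Lambda> u) = \<Lambda> (d * u) \<bullet> \<Lambda> (d * u)"
      using inner_Lambda_adjoint[OF u sq_integrable_mult_left[OF u, of d], of d] u
      by (simp add: d pi_Lambda mult.assoc)
    then show ?thesis by simp
  qed
  ultimately show ?thesis using closed_eq_UNIV_if_Lambda[of "{\<xi>. 0 \<le> \<xi> \<bullet> \<pi> a \<xi>}" \<xi>] by simp
qed

lemma inner_mult_pos_nonneg:
  assumes "pos_elem a" "u \<in> sq_integrable \<tau>"
  shows "0 \<le> \<Lambda> u \<bullet> \<Lambda> (a * u)"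
  using pi_nonneg[OF assms(1), of "\<Lambda> u"] assms(2) by (simp add: pi_Lambda)

text \<open>
  The root \<open>z = \<surd>p\<close> need not be square integrable, since \<open>\<tau>(p)\<close> may be infinite; so \<open>p\<close> is replaced by
  \<open>w = pg\<close> with \<open>(p + \<delta>)g = p\<close>. Then \<open>w = (gz)(gz)\<^sup>* + \<delta>gg\<^sup>*\<close> with \<open>g\<close> and \<open>gz\<close> square integrable, and
  \<open>w\<close> tends to \<open>p\<close> in norm with \<open>\<parallel>\<Lambda>w\<parallel> \<le> \<parallel>\<Lambda>p\<parallel>\<close>. The convergence also holds in \<open>L\<^sup>2\<close>: lower
  semicontinuity bounds \<open>\<parallel>\<Lambda>w + \<Lambda>p\<parallel>\<close> from below by almost \<open>2\<parallel>\<Lambda>p\<parallel>\<close>, and the parallelogram law does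
  the rest.
\<close>

lemma Lambda_pos_approx:
  assumes p: "pos_elem p" and si: "p \<in> sq_integrable \<tau>" and e: "e > 0"
  obtains x y where "x \<in> sq_integrable \<tau>" "y \<in> sq_integrable \<tau>"
    "norm (\<Lambda> p - (\<Lambda> (x * star x) + \<Lambda> (y * star y))) < e"
proof -
  have p_sa: "star p = p" and sp: "spec_nonneg p"
    using p by (simp_all add: pos_elem_sa spec_nonneg_if_pos_elem)
  define \<delta> where "\<delta> n = 1 / (real n + 1)" for n :: nat
  have \<delta>: "\<delta> n > 0" for n by (simp add: \<delta>_def)
  have "\<exists>g. star g = g \<and> p * g = g * p \<and> p * g + \<delta> n *\<^sub>R g = p \<and> norm g \<le> 2" for n
    by (rule regularized_quotient[OF sp \<delta>[of n]]) blast
  then obtain g where g: "\<And>n. star (g n) = g n" "\<And>n. p * g n = g n * p"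
      "\<And>n. p * g n + \<delta> n *\<^sub>R g n = p" "\<And>n. norm (g n) \<le> 2"
    by metis
  define w where "w n = p * g n" for n
  have w_si: "w n \<in> sq_integrable \<tau>" for n
    unfolding w_def by (rule sq_integrable_mult_right[OF si])
  have \<delta>g: "\<delta> n *\<^sub>R g n = p - w n" for n using g(3)[of n] by (simp add: w_def algebra_simps)
  have g_si: "g n \<in> sq_integrable \<tau>" for n
  proof -
    have "g n = (1 / \<delta> n) *\<^sub>R (p - w n)" using \<delta>[of n] by (simp flip: \<delta>g)
    then show ?thesis using w_si si by (metis sq_integrable_diff sq_integrable_scaleR)
  qed
  have \<delta>_lim: "\<delta> \<longlonglongrightarrow> 0" unfolding \<delta>_def
    using LIMSEQ_inverse_real_of_nat by (simp add: inverse_eq_divide add.commute)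
  have "(\<lambda>n. p - w n) \<longlonglongrightarrow> 0"
  proof (rule Lim_null_comparison)
    show "\<forall>\<^sub>F n in sequentially. norm (p - w n) \<le> \<delta> n * 2"
      unfolding \<delta>g[symmetric] using g(4) \<delta> by (simp add: less_imp_le)
    show "(\<lambda>n. \<delta> n * 2) \<longlonglongrightarrow> 0" using tendsto_mult[OF \<delta>_lim tendsto_const[of 2]] by simp
  qed
  then have w_lim: "w \<longlonglongrightarrow> p" using tendsto_diff[OF tendsto_const[of p], of "\<lambda>n. p - w n" 0] by simp
  \<comment> \<open>lower semicontinuity of the trace is applied to the midpoints\<close>
  define c where "c n = (1/2) *\<^sub>R (w n + p)" for n
  have c_si: "c n \<in> sq_integrable \<tau>" for n
    unfolding c_def by (intro sq_integrable_scaleR sq_integrable_add w_si si)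
  have c_lim: "c \<longlonglongrightarrow> p"
  proof -
    have "c \<longlonglongrightarrow> (1/2) *\<^sub>R (p + p)" unfolding c_def by (intro tendsto_intros w_lim)
    then show ?thesis by simp
  qed
  have "(\<lambda>n. star (c n) * c n) \<longlonglongrightarrow> star p * p"
    by (intro tendsto_mult bounded_linear.tendsto[OF bounded_linear_star] c_lim)
  then have lsc: "\<tau> (star p * p) \<le> liminf (\<lambda>n. \<tau> (star (c n) * c n))"
    by (intro lower_semicontinuous) auto
  have w_le: "norm (\<Lambda> (w n)) \<le> norm (\<Lambda> p)" for n
  proof -
    have "\<Lambda> p = \<Lambda> (w n) + \<delta> n *\<^sub>R \<Lambda> (g n)"
      using \<delta>g[of n] w_si[of n] g_si[of n]
      by (metis Lambda_add Lambda_scaleR add.commute diff_add_cancel sq_integrable_scaleR)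
    moreover have "0 \<le> \<Lambda> (w n) \<bullet> \<Lambda> (g n)"
      using inner_mult_pos_nonneg[OF p g_si[of n]] by (simp add: w_def inner_commute)
    ultimately have "(norm (\<Lambda> (w n)))\<^sup>2 \<le> (norm (\<Lambda> p))\<^sup>2"
      using \<delta>[of n] by (simp add: power2_norm_eq_inner inner_add_left inner_add_right inner_commute)
    then show ?thesis by simp
  qed
  have "\<exists>n. (norm (\<Lambda> p))\<^sup>2 - e\<^sup>2 / 4 < (norm (\<Lambda> (c n)))\<^sup>2"
  proof (cases "(norm (\<Lambda> p))\<^sup>2 - e\<^sup>2 / 4 < 0")
    case True
    then show ?thesis by (meson less_le_trans zero_le_power2)
  next
    case False
    then have "ennreal ((norm (\<Lambda> p))\<^sup>2 - e\<^sup>2 / 4) < \<tau> (star p * p)"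
      using e unfolding norm_Lambda[OF si, symmetric] by (intro ennreal_lessI) auto
    then have "\<forall>\<^sub>F n in sequentially. ennreal ((norm (\<Lambda> p))\<^sup>2 - e\<^sup>2 / 4) < \<tau> (star (c n) * c n)"
      using lsc by (auto simp: le_Liminf_iff)
    then obtain n where "ennreal ((norm (\<Lambda> p))\<^sup>2 - e\<^sup>2 / 4) < \<tau> (star (c n) * c n)"
      by (auto simp: eventually_sequentially)
    then have "ennreal ((norm (\<Lambda> p))\<^sup>2 - e\<^sup>2 / 4) < ennreal ((norm (\<Lambda> (c n)))\<^sup>2)"
      by (simp add: norm_Lambda c_si)
    then show ?thesis by (meson ennreal_leI linorder_not_less)
  qed
  then obtain n where n: "(norm (\<Lambda> p))\<^sup>2 - e\<^sup>2 / 4 < (norm (\<Lambda> (c n)))\<^sup>2" ..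
  have "\<Lambda> (c n) = (1/2) *\<^sub>R (\<Lambda> (w n) + \<Lambda> p)"
    using w_si si by (simp add: c_def Lambda_scaleR Lambda_add sq_integrable_add del: scaleR_add_right)
  then have "(norm (\<Lambda> (c n)))\<^sup>2 = (norm (\<Lambda> (w n) + \<Lambda> p))\<^sup>2 / 4"
    by (simp add: power_divide)
  moreover have "(norm (\<Lambda> (w n) + \<Lambda> p))\<^sup>2 + (norm (\<Lambda> p - \<Lambda> (w n)))\<^sup>2
      = 2 * (norm (\<Lambda> (w n)))\<^sup>2 + 2 * (norm (\<Lambda> p))\<^sup>2"
    by (simp add: power2_norm_eq_inner inner_add_left inner_add_right inner_diff_left
        inner_diff_right inner_commute)
  moreover have "(norm (\<Lambda> (w n)))\<^sup>2 \<le> (norm (\<Lambda> p))\<^sup>2" using w_le by (simp add: power_mono)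
  ultimately have "(norm (\<Lambda> p - \<Lambda> (w n)))\<^sup>2 < e\<^sup>2" using n by linarith
then have wn: "norm (\<Lambda> p - \<Lambda> (w n)) < e"
    using e by (intro power2_less_imp_less[of _ e]) auto
  obtain z where z: "star z = z" "z * z = p"
    using sp by (rule spec_nonneg_sqrt) (rule that)
  define x y where "x = g n * z" and "y = sqrt (\<delta> n) *\<^sub>R g n"
  have xy: "x \<in> sq_integrable \<tau>" "y \<in> sq_integrable \<tau>"
    by (simp_all add: x_def y_def g_si sq_integrable_mult_right sq_integrable_scaleR)
  have "x * star x = g n * (z * z) * g n" by (simp only: x_def star_mult z(1) g(1) mult.assoc)
  moreover have "y * star y = (\<delta> n *\<^sub>R g n) * g n"
    using \<delta>[of n] by (simp add: y_def star_scaleR g(1) less_imp_le)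
  ultimately have "x * star x + y * star y = (p * g n + \<delta> n *\<^sub>R g n) * g n"
    by (simp add: z(2) g(2) distrib_right)
  then have "x * star x + y * star y = w n" by (simp only: g(3) w_def)
  then have "\<Lambda> (w n) = \<Lambda> (x * star x) + \<Lambda> (y * star y)"
    using xy by (metis Lambda_add sq_integrable_mult_right)
  then show ?thesis using wn that[OF xy] by simp
qed

text \<open>
  For \<open>p = xx\<^sup>*\<close> with \<open>x\<close> square integrable the inner product is \<open>(\<Lambda>x, \<pi>(a)\<Lambda>x)\<close>; the general case
  follows by the preceding approximation.
\<close>

lemma inner_Lambda_pos_nonneg:
  assumes p: "pos_elem p" "p \<in> sq_integrable \<tau>" and a: "pos_elem a" "a \<in> sq_integrable \<tau>"
  shows "0 \<le> \<Lambda> p \<bullet> \<Lambda> a"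
proof (rule ccontr)
  assume "\<not> 0 \<le> \<Lambda> p \<bullet> \<Lambda> a"
  then have neg: "- (\<Lambda> p \<bullet> \<Lambda> a) > 0" by simp
  then have "\<Lambda> a \<noteq> 0" by auto
  then have "- (\<Lambda> p \<bullet> \<Lambda> a) / norm (\<Lambda> a) > 0" using neg by (intro divide_pos_pos) auto
  then obtain x y where xy: "x \<in> sq_integrable \<tau>" "y \<in> sq_integrable \<tau>" and
      d: "norm (\<Lambda> p - (\<Lambda> (x * star x) + \<Lambda> (y * star y))) < - (\<Lambda> p \<bullet> \<Lambda> a) / norm (\<Lambda> a)"
    by (rule Lambda_pos_approx[OF p]) (rule that)
  define \<xi> where "\<xi> = \<Lambda> (x * star x) + \<Lambda> (y * star y)"
  have "0 \<le> \<xi> \<bullet> \<Lambda> a"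
    using inner_mult_pos_nonneg[OF a(1) xy(1)] inner_mult_pos_nonneg[OF a(1) xy(2)]
    by (simp add: \<xi>_def inner_add_left inner_Lambda_mult_star xy a(2))
  moreover have "norm (\<Lambda> p - \<xi>) * norm (\<Lambda> a) < - (\<Lambda> p \<bullet> \<Lambda> a)"
    using d \<open>\<Lambda> a \<noteq> 0\<close> by (fold \<xi>_def, subst (asm) pos_less_divide_eq) auto
  then have "\<bar>(\<Lambda> p - \<xi>) \<bullet> \<Lambda> a\<bar> < - (\<Lambda> p \<bullet> \<Lambda> a)"
    using Cauchy_Schwarz_ineq2[of "\<Lambda> p - \<xi>" "\<Lambda> a"] by linarith
  ultimately show False by (simp add: inner_diff_left)
qed

lemma L2_pos_inner_nonneg:
  assumes "pos_elem p" "p \<in> sq_integrable \<tau>" "\<xi> \<in> L2_pos \<tau> \<Lambda>"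
  shows "0 \<le> \<Lambda> p \<bullet> \<xi>"
proof -
  have "closed {\<xi>. 0 \<le> \<Lambda> p \<bullet> \<xi>}" by (intro closed_Collect_le continuous_intros)
  then have "L2_pos \<tau> \<Lambda> \<subseteq> {\<xi>. 0 \<le> \<Lambda> p \<bullet> \<xi>}"
    unfolding L2_pos_def using inner_Lambda_pos_nonneg[OF assms(1,2)] by (intro closure_minimal) auto
  then show ?thesis using assms(3) by auto
qed

lemma L2_pos_J:
  assumes "\<xi> \<in> L2_pos \<tau> \<Lambda>"
  shows "J \<xi> = \<xi>"
proof -
  have "closed {\<xi>. J \<xi> = \<xi>}"
    by (intro closed_Collect_eq linear_continuous_on bounded_linear_J continuous_on_id)
  then have "L2_pos \<tau> \<Lambda> \<subseteq> {\<xi>. J \<xi> = \<xi>}"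
    unfolding L2_pos_def by (intro closure_minimal) (auto simp: J_Lambda pos_elem_sa)
  then show ?thesis using assms by auto
qed

lemma Lambda_sa_if_J:
  assumes "b \<in> sq_integrable \<tau>" "J (\<Lambda> b) = \<Lambda> b"
  shows "star b = b"
proof -
  have "\<Lambda> (star b - b) = 0" using assms by (simp add: Lambda_diff sq_integrable_star J_Lambda)
  then show ?thesis
    using Lambda_eq_0[of "star b - b"] assms by (simp add: sq_integrable_diff sq_integrable_star)
qed

text \<open>
  As \<open>pm = mp = 0\<close>, the square of \<open>b\<close> is \<open>p\<^sup>2 + m\<^sup>2\<close>, and taking traces yields
  \<open>\<parallel>\<Lambda>p - \<Lambda>m\<parallel>\<^sup>2 = \<parallel>\<Lambda>p\<parallel>\<^sup>2 + \<parallel>\<Lambda>m\<parallel>\<^sup>2\<close>.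
\<close>

lemma L2_parts:
  assumes "b \<in> sq_integrable \<tau>" "star b = b"
  obtains p m where "b = p - m" "pos_elem p" "pos_elem m" "p \<in> sq_integrable \<tau>"
    "m \<in> sq_integrable \<tau>" "\<Lambda> p \<bullet> \<Lambda> m = 0"
proof -
  obtain p m where pm: "b = p - m" "p * m = 0" "m * p = 0" "spec_nonneg p" "spec_nonneg m"
    using assms(2) by (rule pos_neg_parts) (rule that)
  have sa: "star p = p" "star m = m" using pm by (simp_all add: spec_nonneg_sa)
  have si: "p \<in> sq_integrable \<tau>" "m \<in> sq_integrable \<tau>"
    by (rule sq_integrable_parts[of p m]; use assms(1) sa pm in simp)+
  have "star b * b + star 0 * 0 = star p * p + star m * m"
    using pm(2,3) by (simp add: pm(1) star_diff sa left_diff_distrib right_diff_distrib)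
  then have "ennreal ((norm (\<Lambda> b))\<^sup>2) = ennreal ((norm (\<Lambda> p))\<^sup>2 + (norm (\<Lambda> m))\<^sup>2)"
    using trace_square_sum[OF assms(1) sq_integrable_zero] trace_square_sum[OF si] by simp
  then have "(norm (\<Lambda> b))\<^sup>2 = (norm (\<Lambda> p))\<^sup>2 + (norm (\<Lambda> m))\<^sup>2"
    by (subst (asm) ennreal_inj) auto
  then have "(norm (\<Lambda> p - \<Lambda> m))\<^sup>2 = (norm (\<Lambda> p))\<^sup>2 + (norm (\<Lambda> m))\<^sup>2"
    by (simp add: pm(1) Lambda_diff si)
  then have "\<Lambda> p \<bullet> \<Lambda> m = 0"
    by (simp add: power2_norm_eq_inner inner_diff_left inner_diff_right inner_commute)
  then show ?thesis using pm si by (intro that[of p m]) (simp_all add: pos_elem_if_spec_nonneg)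
qed

text \<open>
  The negative part \<open>m\<close> of \<open>b\<close> satisfies \<open>0 \<le> (\<Lambda>m, \<Lambda>b) = -\<parallel>\<Lambda>m\<parallel>\<^sup>2\<close>. So the positive elements of the
  form algebra, defined through the cone of \<open>L\<^sup>2\<close>, are positive in the C*-algebra, where positive
  functionals and their order can be evaluated.
\<close>

lemma pos_elem_if_L2_pos:
  assumes b: "b \<in> sq_integrable \<tau>" and pos: "\<Lambda> b \<in> L2_pos \<tau> \<Lambda>"
  shows "pos_elem b"
proof -
  have "star b = b" using b L2_pos_J[OF pos] by (rule Lambda_sa_if_J)
  with b obtain p m where pm: "b = p - m" "pos_elem p" "pos_elem m" "p \<in> sq_integrable \<tau>"
      "m \<in> sq_integrable \<tau>" "\<Lambda> p \<bullet> \<Lambda> m = 0"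
    by (rule L2_parts) (rule that)
  have "0 \<le> \<Lambda> m \<bullet> \<Lambda> b" using pm pos by (intro L2_pos_inner_nonneg)
  then have "\<Lambda> m \<bullet> \<Lambda> m \<le> 0"
    using pm by (simp add: Lambda_diff inner_diff_right inner_commute)
  then have "\<Lambda> m = 0" by (metis inner_eq_zero_iff inner_ge_zero order_antisym)
  then have "m = 0" using pm(5) by (intro Lambda_eq_0)
  then show ?thesis using pm by simp
qed

end

section \<open>Nearest points and truncation\<close>

text \<open>
  The convexity hypothesis with defect \<open>q\<close> (the parallelogram law in the applications) makes every
  minimizing sequence Cauchy with respect to \<open>q\<close>. It yields nearest points of convex sets and,
  below, the Riesz representation in the form domain.
\<close>

lemma minimizing_sequence:
  fixes \<Phi> :: "'x \<Rightarrow> real" and q :: "'x \<Rightarrow> 'x \<Rightarrow> real"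
  assumes ne: "S \<noteq> {}" and lower: "\<And>x. x \<in> S \<Longrightarrow> lo \<le> \<Phi> x"
    and mid: "\<And>x y. x \<in> S \<Longrightarrow> y \<in> S \<Longrightarrow> mid x y \<in> S"
    and convex: "\<And>x y. x \<in> S \<Longrightarrow> y \<in> S \<Longrightarrow> \<Phi> (mid x y) \<le> (\<Phi> x + \<Phi> y) / 2 - q x y"
  obtains X I where "\<And>n::nat. X n \<in> S" "\<And>x. x \<in> S \<Longrightarrow> I \<le> \<Phi> x"
    "\<And>n. \<Phi> (X n) < I + 1 / (real n + 1)"
    "\<And>m n. q (X m) (X n) \<le> (1 / (real m + 1) + 1 / (real n + 1)) / 2"
proof -
  define I where "I = Inf (\<Phi> ` S)"
  have bdd: "bdd_below (\<Phi> ` S)" using lower by (auto simp: bdd_below_def)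
  have I: "I \<le> \<Phi> x" if "x \<in> S" for x
    unfolding I_def using bdd that by (auto intro: cInf_lower)
  have "\<exists>x\<in>S. \<Phi> x < I + 1 / (real n + 1)" for n
    using cInf_lessD[of "\<Phi> ` S" "I + 1 / (real n + 1)"] ne by (auto simp: I_def)
  then obtain X where X: "\<And>n. X n \<in> S" "\<And>n. \<Phi> (X n) < I + 1 / (real n + 1)" by metis
  have "q (X m) (X n) \<le> (1 / (real m + 1) + 1 / (real n + 1)) / 2" for m n
    using convex[OF X(1)[of m] X(1)[of n]] I[OF mid[OF X(1)[of m] X(1)[of n]]] X(2)[of m] X(2)[of n]
    by argo
  then show ?thesis using that X I by blast
qed

lemma inverse_sum_less:
  fixes e :: real
  assumes "e > 0"
  shows "\<exists>N. \<forall>m\<ge>N. \<forall>n\<ge>N. C * (1 / (real m + 1) + 1 / (real n + 1)) < e"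
proof -
  define D where "D = \<bar>C\<bar> + 1"
  have "D > 0" by (simp add: D_def add_nonneg_pos)
  obtain N where N: "inverse (real (Suc N)) < e / (2 * D)"
    using reals_Archimedean[of "e / (2 * D)"] assms by (auto simp: D_def)
  have le: "1 / (real n + 1) < e / (2 * D)" if "n \<ge> N" for n
  proof -
    have "1 / (real n + 1) \<le> 1 / (real N + 1)" using that by (intro divide_left_mono) auto
    then show ?thesis using N by (simp add: inverse_eq_divide add.commute)
  qed
  have "C * (1 / (real m + 1) + 1 / (real n + 1)) < e" if "m \<ge> N" "n \<ge> N" for m n
  proof -
    have "C * (1 / (real m + 1) + 1 / (real n + 1)) \<le> D * (1 / (real m + 1) + 1 / (real n + 1))"
      by (intro mult_right_mono) (auto simp: D_def)
    also have "\<dots> < D * (e / (2 * D) + e / (2 * D))"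
      using le[OF that(1)] le[OF that(2)] by (intro mult_strict_left_mono add_strict_mono) (auto simp: D_def)
    also have "\<dots> = e" using \<open>D > 0\<close> by (simp add: field_simps)
    finally show ?thesis .
  qed
  then show ?thesis by blast
qed

lemma nearest_point_closed_convex:
  fixes S :: "'h::{real_inner,complete_space} set"
  assumes S: "closed S" "convex S" "S \<noteq> {}"
  shows "nearest_point dist S x \<in> S" "\<And>z. z \<in> S \<Longrightarrow> dist x (nearest_point dist S x) \<le> dist x z"
proof -
  have par: "(dist x ((1/2) *\<^sub>R (y + z)))\<^sup>2 = ((dist x y)\<^sup>2 + (dist x z)\<^sup>2) / 2 - (dist y z)\<^sup>2 / 4" for y z
  proof -
    have "(x - y) + (x - z) = (x + x) - (y + z)" by simp
    then have "(1/2) *\<^sub>R ((x - y) + (x - z)) = (1/2) *\<^sub>R (x + x) - (1/2) *\<^sub>R (y + z)"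
      by (simp only: scaleR_right_diff_distrib)
    then have "x - (1/2) *\<^sub>R (y + z) = (1/2) *\<^sub>R ((x - y) + (x - z))"
      by (simp only: scaleR_half_double)
    then have "(dist x ((1/2) *\<^sub>R (y + z)))\<^sup>2 = (norm ((x - y) + (x - z)))\<^sup>2 / 4"
      by (simp add: dist_norm power_divide del: scaleR_right_distrib)
    moreover have "y - z = (x - z) - (x - y)" by simp
    ultimately show ?thesis
      unfolding dist_norm by (simp add: power2_norm_eq_inner inner_add_left inner_add_right
          inner_diff_left inner_diff_right inner_commute field_simps)
  qed
  have mid: "(1/2) *\<^sub>R (y + z) \<in> S" if "y \<in> S" "z \<in> S" for y z
    using convexD[OF S(2) that, of "1/2" "1/2"] by (simp add: scaleR_right_distrib)
  obtain X I where X: "\<And>n::nat. X n \<in> S" "\<And>z. z \<in> S \<Longrightarrow> I \<le> (dist x z)\<^sup>2"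
    "\<And>n. (dist x (X n))\<^sup>2 < I + 1 / (real n + 1)"
    "\<And>m n. (dist (X m) (X n))\<^sup>2 / 4 \<le> (1 / (real m + 1) + 1 / (real n + 1)) / 2"
    by (rule minimizing_sequence[of S 0 "\<lambda>y. (dist x y)\<^sup>2" "\<lambda>y z. (1/2) *\<^sub>R (y + z)"
          "\<lambda>y z. (dist y z)\<^sup>2 / 4", OF S(3) zero_le_power2 mid eq_refl[OF par]])
      (assumption, assumption, rule that)
  have "Cauchy X"
  proof (rule metric_CauchyI)
    fix e :: real assume e: "e > 0"
    obtain N where N: "\<And>m n. m \<ge> N \<Longrightarrow> n \<ge> N \<Longrightarrow> 2 * (1 / (real m + 1) + 1 / (real n + 1)) < e\<^sup>2"
      using inverse_sum_less[of "e\<^sup>2" 2] e by auto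
    have "dist (X m) (X n) < e" if "m \<ge> N" "n \<ge> N" for m n
    proof (rule power2_less_imp_less)
      show "(dist (X m) (X n))\<^sup>2 < e\<^sup>2" using N[OF that] X(4)[of m n] by simp
    qed (use e in simp)
    then show "\<exists>M. \<forall>m\<ge>M. \<forall>n\<ge>M. dist (X m) (X n) < e" by blast
  qed
  then have "convergent X" by (rule Cauchy_convergent)
  then obtain y where y: "X \<longlonglongrightarrow> y" unfolding convergent_def ..
  have yS: "y \<in> S" by (rule closed_sequentially[OF S(1) X(1) y])
  have "(\<lambda>n. (dist x (X n))\<^sup>2) \<longlonglongrightarrow> (dist x y)\<^sup>2" by (intro tendsto_intros y)
  moreover have "(\<lambda>n. I + 1 / (real n + 1)) \<longlonglongrightarrow> I + 0"
    using LIMSEQ_inverse_real_of_nat by (intro tendsto_intros) (simp add: inverse_eq_divide add.commute)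
  ultimately have "(dist x y)\<^sup>2 \<le> I + 0"
    using X(3) by (intro LIMSEQ_le[of _ _ "\<lambda>n. I + 1 / (real n + 1)"]) (auto intro: less_imp_le)
  then have ymin2: "(dist x y)\<^sup>2 \<le> (dist x z)\<^sup>2" if "z \<in> S" for z
    using X(2)[OF that] by linarith
  have ymin: "dist x y \<le> dist x z" if "z \<in> S" for z
    using ymin2[OF that] by (rule power2_le_imp_le) simp
  have "nearest_point dist S x = y"
    unfolding nearest_point_def
  proof (rule the_equality)
    fix z assume z: "z \<in> S \<and> (\<forall>w\<in>S. dist x z \<le> dist x w)"
    have eq: "dist x z = dist x y" using z ymin yS by (meson order_antisym)
    have "dist x y \<le> dist x ((1/2) *\<^sub>R (z + y))" using ymin mid z yS by blast
    then have "(dist x y)\<^sup>2 \<le> (dist x ((1/2) *\<^sub>R (z + y)))\<^sup>2" by (simp add: power_mono)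
    then have "(dist z y)\<^sup>2 \<le> 0" unfolding par eq by simp
    then show "z = y" by simp
  qed (use yS ymin in auto)
  then show "nearest_point dist S x \<in> S" "\<And>z. z \<in> S \<Longrightarrow> dist x (nearest_point dist S x) \<le> dist x z"
    using yS ymin by auto
qed

context gns_space
begin

lemma le_unit_iff:
  "le_unit \<pi> a \<longleftrightarrow> (\<forall>u\<in>sq_integrable \<tau>. \<Lambda> u \<bullet> \<Lambda> (a * u) \<le> \<Lambda> u \<bullet> \<Lambda> u)"
proof
  assume "le_unit \<pi> a"
  then show "\<forall>u\<in>sq_integrable \<tau>. \<Lambda> u \<bullet> \<Lambda> (a * u) \<le> \<Lambda> u \<bullet> \<Lambda> u"
    unfolding le_unit_def Re_cinner by (metis pi_Lambda)
next
  assume *: "\<forall>u\<in>sq_integrable \<tau>. \<Lambda> u \<bullet> \<Lambda> (a * u) \<le> \<Lambda> u \<bullet> \<Lambda> u"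
  have "closed {\<xi>. \<xi> \<bullet> \<pi> a \<xi> \<le> \<xi> \<bullet> \<xi>}"
    by (intro closed_Collect_le continuous_intros linear_continuous_on pi_bounded)
  then have "\<xi> \<in> {\<xi>. \<xi> \<bullet> \<pi> a \<xi> \<le> \<xi> \<bullet> \<xi>}" for \<xi>
    by (rule closed_eq_UNIV_if_Lambda) (simp add: pi_Lambda *)
  then show "le_unit \<pi> a" unfolding le_unit_def Re_cinner by simp
qed

lemma le_unit_if_neg:
  assumes "pos_elem (- a)"
  shows "le_unit \<pi> a"
  unfolding le_unit_iff
proof
  fix u assume u: "u \<in> sq_integrable \<tau>"
  have "0 \<le> \<Lambda> u \<bullet> \<Lambda> (- a * u)" using assms u by (rule inner_mult_pos_nonneg)
  then have "\<Lambda> u \<bullet> \<Lambda> (a * u) \<le> 0"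
    using Lambda_minus[OF sq_integrable_mult_left[OF u, of a]] by simp
  then show "\<Lambda> u \<bullet> \<Lambda> (a * u) \<le> \<Lambda> u \<bullet> \<Lambda> u" using inner_ge_zero[of "\<Lambda> u"] by linarith
qed

abbreviation below_one :: "'h set" where
  "below_one \<equiv> \<Lambda> ` {a \<in> sq_integrable \<tau>. star a = a \<and> le_unit \<pi> a}"

lemma convex_below_one: "convex below_one"
proof (rule convexI)
  fix \<xi> \<eta> :: 'h and s t :: real
  assume "\<xi> \<in> below_one" "\<eta> \<in> below_one" and st: "0 \<le> s" "0 \<le> t" "s + t = 1"
  then obtain a b where a: "\<xi> = \<Lambda> a" "a \<in> sq_integrable \<tau>" "star a = a" "le_unit \<pi> a"
    and b: "\<eta> = \<Lambda> b" "b \<in> sq_integrable \<tau>" "star b = b" "le_unit \<pi> b" by auto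
  let ?c = "s *\<^sub>R a + t *\<^sub>R b"
  have si: "?c \<in> sq_integrable \<tau>" using a b by (intro sq_integrable_add sq_integrable_scaleR)
  have "le_unit \<pi> ?c" unfolding le_unit_iff
  proof
    fix u assume u: "u \<in> sq_integrable \<tau>"
    have "\<Lambda> (?c * u) = s *\<^sub>R \<Lambda> (a * u) + t *\<^sub>R \<Lambda> (b * u)"
      using u by (simp add: distrib_right Lambda_add Lambda_scaleR sq_integrable_mult_left
          sq_integrable_scaleR)
    then have "\<Lambda> u \<bullet> \<Lambda> (?c * u) = s * (\<Lambda> u \<bullet> \<Lambda> (a * u)) + t * (\<Lambda> u \<bullet> \<Lambda> (b * u))"
      by (simp add: inner_add_right)
    also have "\<dots> \<le> s * (\<Lambda> u \<bullet> \<Lambda> u) + t * (\<Lambda> u \<bullet> \<Lambda> u)"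
      using a(4) b(4) u st by (intro add_mono mult_left_mono) (auto simp: le_unit_iff)
    also have "\<dots> = \<Lambda> u \<bullet> \<Lambda> u" using st(3) by (simp flip: distrib_right)
    finally show "\<Lambda> u \<bullet> \<Lambda> (?c * u) \<le> \<Lambda> u \<bullet> \<Lambda> u" .
  qed
  moreover have "star ?c = ?c" using a b by (simp add: star_add star_scaleR)
  moreover have "s *\<^sub>R \<xi> + t *\<^sub>R \<eta> = \<Lambda> ?c"
    using a b by (simp add: Lambda_add Lambda_scaleR sq_integrable_scaleR)
  ultimately show "s *\<^sub>R \<xi> + t *\<^sub>R \<eta> \<in> below_one" using si by blast
qed

lemma wedge_one_nearest:
  "wedge_one \<tau> \<Lambda> \<pi> \<xi> \<in> closure below_one"
  "\<eta> \<in> closure below_one \<Longrightarrow> dist \<xi> (wedge_one \<tau> \<Lambda> \<pi> \<xi>) \<le> dist \<xi> \<eta>"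
proof -
  have "0 \<in> below_one"
    using le_unit_if_neg[of 0] by (intro image_eqI[of _ _ 0]) auto
  then have "closure below_one \<noteq> {}" using closure_subset by blast
  note * = nearest_point_closed_convex[OF closed_closure convex_closure[OF convex_below_one] this]
  show "wedge_one \<tau> \<Lambda> \<pi> \<xi> \<in> closure below_one"
    "\<eta> \<in> closure below_one \<Longrightarrow> dist \<xi> (wedge_one \<tau> \<Lambda> \<pi> \<xi>) \<le> dist \<xi> \<eta>"
    unfolding wedge_one_def using * by auto
qed

text \<open>
  For \<open>\<eta> = \<Lambda>a\<close> with \<open>a \<le> 1\<close> the left-hand side is \<open>(\<Lambda>x, \<pi>(a)\<Lambda>x)\<close>.
\<close>

lemma inner_below_one:
  assumes "\<eta> \<in> closure below_one" and x: "x \<in> sq_integrable \<tau>"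
  shows "\<eta> \<bullet> \<Lambda> (x * star x) \<le> (norm (\<Lambda> x))\<^sup>2"
proof -
  have "closed {\<eta>. \<eta> \<bullet> \<Lambda> (x * star x) \<le> (norm (\<Lambda> x))\<^sup>2}"
    by (intro closed_Collect_le continuous_intros)
  moreover have "below_one \<subseteq> {\<eta>. \<eta> \<bullet> \<Lambda> (x * star x) \<le> (norm (\<Lambda> x))\<^sup>2}"
    using inner_Lambda_mult_star[OF x] x
    by (auto simp: le_unit_iff power2_norm_eq_inner inner_commute[of _ "\<Lambda> (x * star x)"])
  ultimately show ?thesis using assms(1) closure_minimal by blast
qed

text \<open>
  The vector \<open>\<eta>\<^sub>n = \<epsilon>((\<xi>/\<epsilon>) \<and> 1)\<close>, \<open>\<epsilon> = 1/(n + 1)\<close>, is the nearest point to \<open>\<xi> = \<Lambda>p - \<Lambda>m\<close> among the elements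
  bounded by \<open>\<epsilon>\<close>, and the limit is \<open>\<xi> \<and> 0\<close>. As \<open>-m\<close> is a competitor, \<open>\<parallel>\<eta>\<^sub>n - \<xi>\<parallel> \<le> \<parallel>\<Lambda>p\<parallel>\<close>, and expanding
  the square gives \<open>\<parallel>\<eta>\<^sub>n + \<Lambda>m\<parallel>\<^sup>2 \<le> 2(\<eta>\<^sub>n, \<Lambda>p)\<close>. After replacing \<open>\<Lambda>p\<close> by a nearby
  \<open>\<Lambda>(xx\<^sup>* + yy\<^sup>*)\<close> the right-hand side is of order \<open>\<epsilon>\<close>, because \<open>\<eta>\<^sub>n\<close> is bounded by \<open>\<epsilon>\<close>; the error of the
  replacement is small uniformly in \<open>n\<close>, because the \<open>\<eta>\<^sub>n\<close> are bounded in norm.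
\<close>

lemma wedge_scaled_tendsto_neg_part:
  assumes p: "pos_elem p" "p \<in> sq_integrable \<tau>" and m: "pos_elem m" "m \<in> sq_integrable \<tau>"
    and orth: "\<Lambda> p \<bullet> \<Lambda> m = 0"
  shows "(\<lambda>n. (1 / (real n + 1)) *\<^sub>R wedge_one \<tau> \<Lambda> \<pi> ((real n + 1) *\<^sub>R \<Lambda> (p - m))) \<longlonglongrightarrow> - \<Lambda> m"
proof -
  define \<xi> where "\<xi> = \<Lambda> (p - m)"
  have \<xi>: "\<xi> = \<Lambda> p - \<Lambda> m" using p m by (simp add: \<xi>_def Lambda_diff)
  define \<eta> where "\<eta> n = (1 / (real n + 1)) *\<^sub>R wedge_one \<tau> \<Lambda> \<pi> ((real n + 1) *\<^sub>R \<Lambda> (p - m))" for n :: nat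
  define W where "W n = wedge_one \<tau> \<Lambda> \<pi> ((real n + 1) *\<^sub>R \<xi>)" for n :: nat
  have \<eta>: "\<eta> n = (1 / (real n + 1)) *\<^sub>R W n" for n by (simp add: W_def \<xi>_def \<eta>_def)
  have W: "W n = (real n + 1) *\<^sub>R \<eta> n" for n by (simp add: \<eta>)
  have near: "norm (\<eta> n - \<xi>) \<le> norm (\<Lambda> p)" for n
  proof -
    let ?r = "real n + 1"
    have "pos_elem (?r *\<^sub>R m)" using m(1) by (simp add: pos_elem_iff_spec_nonneg spec_nonneg_scaleR)
    then have "le_unit \<pi> (- (?r *\<^sub>R m))" by (intro le_unit_if_neg) simp
    then have "\<Lambda> (- (?r *\<^sub>R m)) \<in> below_one"
      using m by (intro imageI) (simp add: sq_integrable_minus sq_integrable_scaleR star_minus star_scaleR pos_elem_sa)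
    moreover have "\<Lambda> (- (?r *\<^sub>R m)) = - (?r *\<^sub>R \<Lambda> m)"
      using m(2) by (simp add: Lambda_minus Lambda_scaleR sq_integrable_scaleR)
    ultimately have "- (?r *\<^sub>R \<Lambda> m) \<in> below_one" by (simp only:)
    then have "- (?r *\<^sub>R \<Lambda> m) \<in> closure below_one" by (rule subsetD[OF closure_subset])
    then have "dist (?r *\<^sub>R \<xi>) (W n) \<le> dist (?r *\<^sub>R \<xi>) (- (?r *\<^sub>R \<Lambda> m))"
      unfolding W_def by (rule wedge_one_nearest(2))
    also have "\<dots> = ?r * norm (\<Lambda> p)"
      by (simp add: dist_norm \<xi> scaleR_right_diff_distrib)
    finally have "norm (?r *\<^sub>R (\<xi> - \<eta> n)) \<le> ?r * norm (\<Lambda> p)"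
      unfolding W dist_norm by (simp only: scaleR_right_diff_distrib)
    then have "norm (\<xi> - \<eta> n) \<le> norm (\<Lambda> p)" unfolding norm_scaleR by simp
    then show ?thesis by (simp add: norm_minus_commute)
  qed
  have le: "(norm (\<eta> n + \<Lambda> m))\<^sup>2 \<le> 2 * (\<eta> n \<bullet> \<Lambda> p)" for n
  proof -
    have eq: "\<eta> n + \<Lambda> m = (\<eta> n - \<xi>) + \<Lambda> p" by (simp add: \<xi>)
    have "(norm (\<eta> n + \<Lambda> m))\<^sup>2
        = (norm (\<eta> n - \<xi>))\<^sup>2 + 2 * ((\<eta> n - \<xi>) \<bullet> \<Lambda> p) + (norm (\<Lambda> p))\<^sup>2"
      unfolding eq power2_norm_eq_inner inner_add_left inner_add_right
      by (simp add: inner_commute[of "\<Lambda> p" "\<eta> n - \<xi>"])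
    moreover have "\<xi> \<bullet> \<Lambda> p = (norm (\<Lambda> p))\<^sup>2"
      using orth inner_commute[of "\<Lambda> m" "\<Lambda> p"]
      by (simp add: \<xi> inner_diff_left power2_norm_eq_inner)
    moreover have "(norm (\<eta> n - \<xi>))\<^sup>2 \<le> (norm (\<Lambda> p))\<^sup>2" using near by (rule power_mono) simp
    ultimately show ?thesis unfolding inner_diff_left[of "\<eta> n"] by argo
  qed
  have test: "\<eta> n \<bullet> \<Lambda> (x * star x) \<le> (1 / (real n + 1)) * (norm (\<Lambda> x))\<^sup>2" if "x \<in> sq_integrable \<tau>" for n x
    unfolding \<eta> inner_scaleR_left W_def
    using inner_below_one[OF wedge_one_nearest(1) that] by (intro mult_left_mono) auto
  define R where "R = norm \<xi> + norm (\<Lambda> p) + 1"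
  have R: "norm (\<eta> n) \<le> R" "R > 0" for n
    using near[of n] norm_triangle_ineq[of "\<eta> n - \<xi>" \<xi>]
    unfolding R_def by (simp_all del: norm_scaleR add: add_nonneg_pos)
  have "(\<lambda>n. \<eta> n + \<Lambda> m) \<longlonglongrightarrow> 0"
  proof (rule LIMSEQ_I)
    fix e :: real assume e: "0 < e"
    define d where "d = e\<^sup>2 / (4 * R)"
    have "d > 0" using e R by (simp add: d_def)
    with p obtain x y where xy: "x \<in> sq_integrable \<tau>" "y \<in> sq_integrable \<tau>" and
        dxy: "norm (\<Lambda> p - (\<Lambda> (x * star x) + \<Lambda> (y * star y))) < d"
      by (rule Lambda_pos_approx) (rule that)
    define v where "v = \<Lambda> (x * star x) + \<Lambda> (y * star y)"
    define M where "M = (norm (\<Lambda> x))\<^sup>2 + (norm (\<Lambda> y))\<^sup>2"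
    have "e\<^sup>2 / 2 > 0" using e by simp
    from inverse_sum_less[OF this, of M] obtain N where
      N: "\<And>n. n \<ge> N \<Longrightarrow> M * (1 / (real n + 1) + 1 / (real n + 1)) < e\<^sup>2 / 2" by blast
    have "norm (\<eta> n + \<Lambda> m - 0) < e" if n: "n \<ge> N" for n
    proof (rule power2_less_imp_less)
      have "\<eta> n \<bullet> \<Lambda> p = \<eta> n \<bullet> v + \<eta> n \<bullet> (\<Lambda> p - v)" by (simp add: inner_diff_right)
      moreover have "\<eta> n \<bullet> v \<le> (1 / (real n + 1)) * M"
        using test[OF xy(1), of n] test[OF xy(2), of n]
        unfolding v_def M_def inner_add_right distrib_left by linarith
      moreover have "\<eta> n \<bullet> (\<Lambda> p - v) \<le> R * d"
        using norm_cauchy_schwarz[of "\<eta> n" "\<Lambda> p - v"]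
          mult_mono[OF R(1)[of n] less_imp_le[OF dxy]] R(2) unfolding v_def by fastforce
      moreover have "R * d = e\<^sup>2 / 4" using R(2) by (simp add: d_def)
      ultimately have "2 * (\<eta> n \<bullet> \<Lambda> p) \<le> M * (1 / (real n + 1) + 1 / (real n + 1)) + e\<^sup>2 / 2"
        by (simp add: algebra_simps)
      then show "(norm (\<eta> n + \<Lambda> m - 0))\<^sup>2 < e\<^sup>2" using le[of n] N[OF n] by simp
    qed (use e in simp)
    then show "\<exists>N. \<forall>n\<ge>N. norm (\<eta> n + \<Lambda> m - 0) < e" by blast
  qed
  from tendsto_diff[OF this tendsto_const[of "\<Lambda> m"]] show ?thesis by (simp add: \<eta>_def)
qed

end

section \<open>Closed nonnegative forms\<close>

locale nonneg_form =
  fixes S :: "'v::real_vector set" and B :: "'v \<Rightarrow> 'v \<Rightarrow> real"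
  assumes zero_mem: "0 \<in> S"
    and add_mem: "x \<in> S \<Longrightarrow> y \<in> S \<Longrightarrow> x + y \<in> S"
    and scale_mem: "x \<in> S \<Longrightarrow> r *\<^sub>R x \<in> S"
    and sym: "x \<in> S \<Longrightarrow> y \<in> S \<Longrightarrow> B x y = B y x"
    and add_right: "x \<in> S \<Longrightarrow> y \<in> S \<Longrightarrow> z \<in> S \<Longrightarrow> B x (y + z) = B x y + B x z"
    and scale_right: "x \<in> S \<Longrightarrow> y \<in> S \<Longrightarrow> B x (r *\<^sub>R y) = r * B x y"
    and nonneg: "x \<in> S \<Longrightarrow> 0 \<le> B x x"
begin

lemma minus_mem: "x \<in> S \<Longrightarrow> - x \<in> S"
  using scale_mem[of x "-1"] by simp

lemma diff_mem: "x \<in> S \<Longrightarrow> y \<in> S \<Longrightarrow> x - y \<in> S"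
  using add_mem[of x "- y"] by (simp add: minus_mem)

lemmas mem = zero_mem add_mem scale_mem minus_mem diff_mem

lemma minus_right: "x \<in> S \<Longrightarrow> y \<in> S \<Longrightarrow> B x (- y) = - B x y"
  using scale_right[of x y "-1"] by simp

lemma diff_right: "x \<in> S \<Longrightarrow> y \<in> S \<Longrightarrow> z \<in> S \<Longrightarrow> B x (y - z) = B x y - B x z"
  using add_right[of x y "- z"] by (simp add: minus_mem minus_right)

lemma add_left: "x \<in> S \<Longrightarrow> y \<in> S \<Longrightarrow> z \<in> S \<Longrightarrow> B (y + z) x = B y x + B z x"
  using add_right[of x y z] by (simp add: sym[of _ x] add_mem)

lemma scale_left: "x \<in> S \<Longrightarrow> y \<in> S \<Longrightarrow> B (r *\<^sub>R y) x = r * B y x"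
  using scale_right[of x y r] by (simp add: sym[of _ x] scale_mem)

lemma diff_left: "x \<in> S \<Longrightarrow> y \<in> S \<Longrightarrow> z \<in> S \<Longrightarrow> B (y - z) x = B y x - B z x"
  using diff_right[of x y z] by (simp add: sym[of _ x] diff_mem)

lemma minus_left: "x \<in> S \<Longrightarrow> y \<in> S \<Longrightarrow> B (- y) x = - B y x"
  using minus_right[of x y] by (simp add: sym[of _ x] minus_mem)

lemma quad_add: "x \<in> S \<Longrightarrow> y \<in> S \<Longrightarrow> B (x + y) (x + y) = B x x + 2 * B x y + B y y"
  by (simp add: add_left add_right add_mem sym[of y x])

lemma quad_diff: "x \<in> S \<Longrightarrow> y \<in> S \<Longrightarrow> B (x - y) (x - y) = B x x - 2 * B x y + B y y"
  by (simp add: diff_left diff_right diff_mem sym[of y x])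

lemma quad_diff_commute: "x \<in> S \<Longrightarrow> y \<in> S \<Longrightarrow> B (x - y) (x - y) = B (y - x) (y - x)"
  by (simp add: quad_diff sym[of y x])

lemma quad_midpoint:
  assumes "x \<in> S" "y \<in> S"
  shows "B ((1/2) *\<^sub>R (x + y)) ((1/2) *\<^sub>R (x + y)) = (B x x + B y y) / 2 - B (x - y) (x - y) / 4"
proof -
  have "B ((1/2) *\<^sub>R (x + y)) ((1/2) *\<^sub>R (x + y)) = B (x + y) (x + y) / 4"
    using assms by (simp only: scale_left scale_right mem)
  then show ?thesis using assms by (simp add: quad_add quad_diff field_simps)
qed

lemma cauchy_schwarz:
  assumes "x \<in> S" "y \<in> S"
  shows "B x y \<le> sqrt (B x x) * sqrt (B y y)"
proof -
  have lin: "2 * t * B x y \<le> B x x + t\<^sup>2 * B y y" for t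
  proof -
    have "0 \<le> B (x - t *\<^sub>R y) (x - t *\<^sub>R y)" using assms by (intro nonneg mem)
    also have "\<dots> = B x x - 2 * (t * B x y) + t * (t * B y y)"
      using assms by (simp add: quad_diff scale_left scale_right mem)
    finally show ?thesis by (simp add: power2_eq_square mult.assoc)
  qed
  show ?thesis
  proof (cases "B y y = 0")
    case True
    have "B x y \<le> 0"
    proof (rule ccontr)
      assume "\<not> B x y \<le> 0"
      then show False using lin[of "(B x x + 1) / (2 * B x y)"] True by (simp add: field_simps)
    qed
    then show ?thesis using True by simp
  next
    case False
    then have pos: "B y y > 0" using nonneg[OF assms(2)] by simp
    have "(B x y)\<^sup>2 \<le> B x x * B y y"
      using lin[of "B x y / B y y"] pos by (simp add: power2_eq_square field_simps)
    then have "\<bar>B x y\<bar> \<le> sqrt (B x x * B y y)" by (metis real_sqrt_abs real_sqrt_le_iff)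
    then show ?thesis by (simp add: real_sqrt_mult)
  qed
qed

lemma triangle:
  assumes "x \<in> S" "y \<in> S"
  shows "sqrt (B (x + y) (x + y)) \<le> sqrt (B x x) + sqrt (B y y)"
proof (rule real_le_lsqrt)
  show "B (x + y) (x + y) \<le> (sqrt (B x x) + sqrt (B y y))\<^sup>2"
    using cauchy_schwarz[OF assms] assms by (simp add: quad_add power2_sum nonneg)
qed (use assms in \<open>simp add: nonneg\<close>)

end

context dirichlet_form
begin

definition \<E>\<^sub>R :: "'h \<Rightarrow> 'h \<Rightarrow> real" where "\<E>\<^sub>R \<xi> \<eta> = Re (\<E> \<xi> \<eta>)"

definition \<E>\<^sub>1 :: "'h \<Rightarrow> 'h \<Rightarrow> real" where "\<E>\<^sub>1 \<xi> \<eta> = Re (form_inner \<E> \<xi> \<eta>)"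

lemma form_quad_eq: "form_quad \<E> \<xi> = \<E>\<^sub>R \<xi> \<xi>"
  by (simp add: form_quad_def \<E>\<^sub>R_def)

lemma form_norm_eq: "form_norm \<E> \<xi> = sqrt (\<E>\<^sub>1 \<xi> \<xi>)"
  by (simp add: form_norm_def \<E>\<^sub>1_def)

lemma \<E>\<^sub>1_eq: "\<E>\<^sub>1 \<xi> \<eta> = \<E>\<^sub>R \<xi> \<eta> + \<xi> \<bullet> \<eta>"
  by (simp add: \<E>\<^sub>1_def \<E>\<^sub>R_def form_inner_def Re_cinner)

sublocale E: nonneg_form \<F> \<E>\<^sub>R
proof
  fix x y z :: 'h and r :: real
  assume x: "x \<in> \<F>"
  show "r *\<^sub>R x \<in> \<F>" using x by (simp add: scaleR_scaleC dom_scaleC)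
  show "0 \<le> \<E>\<^sub>R x x" using form_nonneg[OF x] by (simp add: form_quad_eq)
  assume y: "y \<in> \<F>"
  show "x + y \<in> \<F>" using x y by (rule dom_add)
  show "\<E>\<^sub>R x y = \<E>\<^sub>R y x" using form_commute[OF x y] by (simp add: \<E>\<^sub>R_def)
  show "\<E>\<^sub>R x (r *\<^sub>R y) = r * \<E>\<^sub>R x y" using x y by (simp add: \<E>\<^sub>R_def scaleR_scaleC form_scaleC)
  assume z: "z \<in> \<F>"
  show "\<E>\<^sub>R x (y + z) = \<E>\<^sub>R x y + \<E>\<^sub>R x z" using x y z by (simp add: \<E>\<^sub>R_def form_add)
qed (rule dom_zero)

sublocale F: nonneg_form \<F> \<E>\<^sub>1
  by standard
     (simp_all add: \<E>\<^sub>1_eq E.mem E.add_right E.scale_right E.sym[of _ _] E.nonneg inner_add_right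
        inner_commute[of x y for x y] distrib_left)

lemma norm_le_\<E>\<^sub>1: "\<xi> \<in> \<F> \<Longrightarrow> (norm \<xi>)\<^sup>2 \<le> \<E>\<^sub>1 \<xi> \<xi>"
  by (simp add: \<E>\<^sub>1_eq E.nonneg power2_norm_eq_inner)

lemma \<E>\<^sub>R_le_\<E>\<^sub>1: "\<E>\<^sub>R \<xi> \<xi> \<le> \<E>\<^sub>1 \<xi> \<xi>"
  by (simp add: \<E>\<^sub>1_eq)

lemma form_complete:
  assumes X: "\<And>n. X n \<in> \<F>"
    and cauchy: "\<And>e. e > 0 \<Longrightarrow> \<exists>N. \<forall>m\<ge>N. \<forall>n\<ge>N. \<E>\<^sub>1 (X m - X n) (X m - X n) < e"
  obtains \<xi> where "\<xi> \<in> \<F>" "(\<lambda>n. \<E>\<^sub>1 (X n - \<xi>) (X n - \<xi>)) \<longlonglongrightarrow> 0"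
proof -
  have "Cauchy X"
  proof (rule metric_CauchyI)
    fix e :: real assume e: "e > 0"
    then have "e\<^sup>2 > 0" by simp
    from cauchy[OF this] obtain N where
      N: "\<And>m n. m \<ge> N \<Longrightarrow> n \<ge> N \<Longrightarrow> \<E>\<^sub>1 (X m - X n) (X m - X n) < e\<^sup>2" by blast
    have "dist (X m) (X n) < e" if "m \<ge> N" "n \<ge> N" for m n
    proof (rule power2_less_imp_less)
      show "(dist (X m) (X n))\<^sup>2 < e\<^sup>2"
        unfolding dist_norm by (rule le_less_trans[OF norm_le_\<E>\<^sub>1 N[OF that]]) (intro E.mem X)
    qed (use e in simp)
    then show "\<exists>M. \<forall>m\<ge>M. \<forall>n\<ge>M. dist (X m) (X n) < e" by blast
  qed
  then have "convergent X" by (rule Cauchy_convergent)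
  then obtain \<xi> where \<xi>: "X \<longlonglongrightarrow> \<xi>" unfolding convergent_def ..
  have "\<exists>N. \<forall>m\<ge>N. \<forall>n\<ge>N. form_quad \<E> (X m - X n) < e" if "e > 0" for e
    using cauchy[OF that] \<E>\<^sub>R_le_\<E>\<^sub>1 unfolding form_quad_eq by (meson le_less_trans)
  from form_closed[of X, OF X \<xi> this]
  have mem: "\<xi> \<in> \<F>" and lim: "(\<lambda>n. \<E>\<^sub>R (X n - \<xi>) (X n - \<xi>)) \<longlonglongrightarrow> 0"
    by (simp_all add: form_quad_eq)
  have "(\<lambda>n. (norm (X n - \<xi>))\<^sup>2) \<longlonglongrightarrow> 0"
    using tendsto_power[OF tendsto_norm[OF tendsto_diff[OF \<xi> tendsto_const[of \<xi>]]], of 2] by simp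
  from tendsto_add[OF lim this] have "(\<lambda>n. \<E>\<^sub>1 (X n - \<xi>) (X n - \<xi>)) \<longlonglongrightarrow> 0"
    by (simp add: \<E>\<^sub>1_eq power2_norm_eq_inner)
  with mem show ?thesis by (rule that)
qed

text \<open>
  Let \<open>d\<^sub>N\<close> be the infimum of the energy over the domain elements at distance at most \<open>1/(N + 1)\<close> from
  \<open>\<xi>\<close>. These numbers increase and stay below \<open>K\<close>, so by the parallelogram law almost minimizers
  \<open>Y\<^sub>N\<close> are Cauchy for the form; closedness applies to them.
\<close>

lemma form_lower_semicontinuous:
  assumes X: "\<And>n. X n \<in> \<F>" "X \<longlonglongrightarrow> \<xi>" and bound: "\<And>n. \<E>\<^sub>R (X n) (X n) \<le> K"
  shows "\<xi> \<in> \<F> \<and> \<E>\<^sub>R \<xi> \<xi> \<le> K"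
proof -
  define \<epsilon> where "\<epsilon> N = 1 / (real N + 1)" for N :: nat
  have \<epsilon>_pos: "\<epsilon> N > 0" for N by (simp add: \<epsilon>_def)
  have \<epsilon>_mono: "\<epsilon> n \<le> \<epsilon> N" if "N \<le> n" for n N
    using that unfolding \<epsilon>_def by (intro divide_left_mono) auto
  have \<epsilon>_lim: "\<epsilon> \<longlonglongrightarrow> 0"
    unfolding \<epsilon>_def using LIMSEQ_inverse_real_of_nat by (simp add: inverse_eq_divide add.commute)
  define T where "T N = {\<eta> \<in> \<F>. norm (\<eta> - \<xi>) \<le> \<epsilon> N}" for N
  define Q where "Q N = (\<lambda>\<eta>. \<E>\<^sub>R \<eta> \<eta>) ` T N" for N
  define d where "d N = Inf (Q N)" for N
  have bdd: "bdd_below (Q N)" for N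
    by (rule bdd_belowI[of _ 0]) (auto simp: Q_def T_def E.nonneg)
  have "\<exists>n. X n \<in> T N" for N
  proof -
    obtain n where "norm (X n - \<xi>) < \<epsilon> N" using LIMSEQ_D[OF X(2) \<epsilon>_pos[of N]] by blast
    then show ?thesis using X(1) by (auto simp: T_def intro: less_imp_le)
  qed
  then obtain k where k: "X (k N) \<in> T N" for N by metis
  have ne: "Q N \<noteq> {}" for N using k[of N] by (auto simp: Q_def)
  have d_le: "d N \<le> \<E>\<^sub>R \<eta> \<eta>" if "\<eta> \<in> T N" for \<eta> N
    unfolding d_def by (rule cInf_lower[OF _ bdd]) (use that in \<open>auto simp: Q_def\<close>)
  have d_K: "d N \<le> K" for N using d_le[OF k[of N]] bound[of "k N"] by linarith
  have T_mono: "T n \<subseteq> T N" if "N \<le> n" for n N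
    using \<epsilon>_mono[OF that] by (auto simp: T_def)
  have "incseq d"
  proof (rule incseq_SucI)
    show "d n \<le> d (Suc n)" for n
      unfolding d_def by (rule cInf_superset_mono[OF ne bdd]) (use T_mono[of n "Suc n"] in \<open>auto simp: Q_def\<close>)
  qed
  then obtain L where L: "d \<longlonglongrightarrow> L" "\<And>n. d n \<le> L"
    using incseq_convergent[of d K] d_K by blast
  have "\<exists>\<eta>\<in>T N. \<E>\<^sub>R \<eta> \<eta> < d N + \<epsilon> N" for N
    using cInf_lessD[OF ne[of N], of "d N + \<epsilon> N"] \<epsilon>_pos[of N] by (auto simp: d_def Q_def)
  then obtain Y where Y: "\<And>N. Y N \<in> T N" "\<And>N. \<E>\<^sub>R (Y N) (Y N) < d N + \<epsilon> N" by metis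
  have YF: "Y N \<in> \<F>" for N using Y(1)[of N] by (simp add: T_def)
  have Y_lim: "Y \<longlonglongrightarrow> \<xi>"
  proof (rule LIM_zero_cancel, rule Lim_null_comparison[OF _ \<epsilon>_lim])
    show "\<forall>\<^sub>F n in sequentially. norm (Y n - \<xi>) \<le> \<epsilon> n" using Y(1) by (simp add: T_def)
  qed
  have cauchy: "\<exists>N. \<forall>m\<ge>N. \<forall>n\<ge>N. form_quad \<E> (Y m - Y n) < e" if e: "e > 0" for e
  proof -
    have "(\<lambda>N. 4 * (L - d N) + 4 * \<epsilon> N) \<longlonglongrightarrow> 4 * (L - L) + 4 * 0"
      by (intro tendsto_intros L \<epsilon>_lim)
    then have "\<forall>\<^sub>F N in sequentially. 4 * (L - d N) + 4 * \<epsilon> N < e"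
      by (rule order_tendstoD) (use e in simp)
    then obtain N where N: "4 * (L - d N) + 4 * \<epsilon> N < e"
      by (auto simp: eventually_sequentially)
    have "form_quad \<E> (Y m - Y n) < e" if mn: "m \<ge> N" "n \<ge> N" for m n
    proof -
      have mem: "Y m \<in> T N" "Y n \<in> T N" using Y(1) T_mono mn by blast+
      have "(1/2) *\<^sub>R (Y m + Y n) - \<xi> = (1/2) *\<^sub>R ((Y m - \<xi>) + (Y n - \<xi>))"
      proof -
        have "(Y m - \<xi>) + (Y n - \<xi>) = (Y m + Y n) - (\<xi> + \<xi>)" by simp
        then show ?thesis by (simp only: scaleR_right_diff_distrib scaleR_half_double)
      qed
      then have "norm ((1/2) *\<^sub>R (Y m + Y n) - \<xi>) \<le> \<epsilon> N"
        using norm_triangle_ineq[of "Y m - \<xi>" "Y n - \<xi>"] mem unfolding T_def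
        by (simp del: scaleR_right_distrib)
      then have "(1/2) *\<^sub>R (Y m + Y n) \<in> T N"
        using mem by (simp add: T_def E.mem del: scaleR_right_distrib)
      from d_le[OF this] have "d N \<le> (\<E>\<^sub>R (Y m) (Y m) + \<E>\<^sub>R (Y n) (Y n)) / 2 - \<E>\<^sub>R (Y m - Y n) (Y m - Y n) / 4"
        by (simp only: E.quad_midpoint[OF YF YF])
      moreover have "\<E>\<^sub>R (Y m) (Y m) < L + \<epsilon> N" "\<E>\<^sub>R (Y n) (Y n) < L + \<epsilon> N"
        using Y(2)[of m] Y(2)[of n] L(2)[of m] L(2)[of n] \<epsilon>_mono[OF mn(1)] \<epsilon>_mono[OF mn(2)]
        by linarith+
      ultimately show ?thesis using N unfolding form_quad_eq by argo
    qed
    then show ?thesis by blast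
  qed
  from form_closed[of Y, OF YF Y_lim cauchy]
  have mem: "\<xi> \<in> \<F>" and lim: "(\<lambda>n. \<E>\<^sub>R (Y n - \<xi>) (Y n - \<xi>)) \<longlonglongrightarrow> 0"
    by (simp_all add: form_quad_eq)
  have "sqrt (\<E>\<^sub>R \<xi> \<xi>) \<le> sqrt (K + \<epsilon> n) + sqrt (\<E>\<^sub>R (Y n - \<xi>) (Y n - \<xi>))" for n
  proof -
    have "sqrt (\<E>\<^sub>R \<xi> \<xi>) \<le> sqrt (\<E>\<^sub>R (Y n) (Y n)) + sqrt (\<E>\<^sub>R (\<xi> - Y n) (\<xi> - Y n))"
      using E.triangle[OF YF E.diff_mem[OF mem YF], of n n] by simp
    moreover have "sqrt (\<E>\<^sub>R (Y n) (Y n)) \<le> sqrt (K + \<epsilon> n)"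
      using Y(2)[of n] d_K[of n] by simp
    ultimately show ?thesis by (simp only: E.quad_diff_commute[OF mem YF])
  qed
  moreover have "(\<lambda>n. sqrt (K + \<epsilon> n) + sqrt (\<E>\<^sub>R (Y n - \<xi>) (Y n - \<xi>))) \<longlonglongrightarrow> sqrt (K + 0) + sqrt 0"
    by (intro tendsto_intros lim \<epsilon>_lim)
  ultimately have "sqrt (\<E>\<^sub>R \<xi> \<xi>) \<le> sqrt K"
    by (intro LIMSEQ_le_const[of _ "sqrt K"]) auto
  then show ?thesis using mem by simp
qed

end

section \<open>Positive parts in the form domain and potentials\<close>

lemma pos_dual_linear:
  assumes "\<omega> \<in> pos_dual"
  shows "\<omega> (a + b) = \<omega> a + \<omega> b" "\<omega> (a - b) = \<omega> a - \<omega> b" "\<omega> (c *\<^sub>C a) = c * \<omega> a"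
    "\<omega> (r *\<^sub>R a) = r * \<omega> a"
  using assms
  by (auto simp: pos_dual_def bounded_linear.linear linear_add linear_diff scaleR_scaleC)

lemma pos_dual_nonneg:
  assumes "\<omega> \<in> pos_dual" "pos_elem a"
  shows "0 \<le> Re (\<omega> a)" "Im (\<omega> a) = 0"
  using assms by (auto simp: pos_dual_def complex_nonneg_Reals_iff)

lemma pos_dual_diff:
  assumes "\<omega> \<in> pos_dual" "\<omega>' \<in> pos_dual" "functional_le \<omega>' \<omega>"
  shows "(\<lambda>a. \<omega> a - \<omega>' a) \<in> pos_dual"
  using assms by (auto simp: pos_dual_def functional_le_def bounded_linear_sub right_diff_distrib)

context dirichlet_form
begin

abbreviation "\<B> \<equiv> form_alg \<tau> \<Lambda> \<F>"

lemma form_alg_sq: "b \<in> \<B> \<Longrightarrow> b \<in> sq_integrable \<tau>"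
  and form_alg_dom: "b \<in> \<B> \<Longrightarrow> \<Lambda> b \<in> \<F>"
  by (simp_all add: form_alg_def)

lemma form_alg_add: "a \<in> \<B> \<Longrightarrow> b \<in> \<B> \<Longrightarrow> a + b \<in> \<B>"
  by (simp add: form_alg_def sq_integrable_add Lambda_add dom_add)

lemma form_alg_scaleC: "a \<in> \<B> \<Longrightarrow> c *\<^sub>C a \<in> \<B>"
  by (simp add: form_alg_def sq_integrable_scaleC Lambda_scaleC dom_scaleC)

lemma form_alg_scaleR: "a \<in> \<B> \<Longrightarrow> r *\<^sub>R a \<in> \<B>"
  by (simp add: scaleR_scaleC form_alg_scaleC)

lemma form_alg_minus: "a \<in> \<B> \<Longrightarrow> - a \<in> \<B>"
  using form_alg_scaleR[of a "-1"] by simp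

lemma form_alg_diff: "a \<in> \<B> \<Longrightarrow> b \<in> \<B> \<Longrightarrow> a - b \<in> \<B>"
  using form_alg_add[of a "- b"] by (simp add: form_alg_minus)

lemma form_alg_star: "a \<in> \<B> \<Longrightarrow> star a \<in> \<B>"
  using form_real[of "\<Lambda> a"] by (simp add: form_alg_def sq_integrable_star J_Lambda)

lemma form_alg_zero: "0 \<in> \<B>"
  by (simp add: form_alg_def dom_zero)

lemma Lambda_form_alg:
  "a \<in> \<B> \<Longrightarrow> b \<in> \<B> \<Longrightarrow> \<Lambda> (a + b) = \<Lambda> a + \<Lambda> b"
  "a \<in> \<B> \<Longrightarrow> b \<in> \<B> \<Longrightarrow> \<Lambda> (a - b) = \<Lambda> a - \<Lambda> b"
  "a \<in> \<B> \<Longrightarrow> \<Lambda> (r *\<^sub>R a) = r *\<^sub>R \<Lambda> a"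
  "a \<in> \<B> \<Longrightarrow> \<Lambda> (c *\<^sub>C a) = c *\<^sub>C \<Lambda> a"
  by (simp_all add: form_alg_sq Lambda_add Lambda_diff Lambda_scaleR Lambda_scaleC)

lemma \<E>\<^sub>1_J:
  assumes "\<xi> \<in> \<F>" "\<eta> \<in> \<F>"
  shows "\<E>\<^sub>1 (J \<xi>) (J \<eta>) = \<E>\<^sub>1 \<xi> \<eta>"
proof -
  have quad: "\<E>\<^sub>1 (J \<zeta>) (J \<zeta>) = \<E>\<^sub>1 \<zeta> \<zeta>" if "\<zeta> \<in> \<F>" for \<zeta>
    using form_real[OF that] by (simp add: \<E>\<^sub>1_eq form_quad_eq inner_J)
  have "\<E>\<^sub>1 (J \<xi> + J \<eta>) (J \<xi> + J \<eta>) = \<E>\<^sub>1 (\<xi> + \<eta>) (\<xi> + \<eta>)"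
    using quad[OF dom_add[OF assms]] by (simp add: J_add)
  then show ?thesis using assms form_real by (simp add: F.quad_add quad)
qed

text \<open>
  By scaling, \<open>\<epsilon>((\<xi>/\<epsilon>) \<and> 1)\<close> has at most the energy of \<open>\<xi>\<close>; let \<open>\<epsilon>\<close> tend to \<open>0\<close>.
\<close>

lemma neg_part_form:
  assumes p: "pos_elem p" "p \<in> sq_integrable \<tau>" and m: "pos_elem m" "m \<in> sq_integrable \<tau>"
    and orth: "\<Lambda> p \<bullet> \<Lambda> m = 0" and dom: "p - m \<in> \<B>"
  shows "\<Lambda> m \<in> \<F>" "\<E>\<^sub>R (\<Lambda> m) (\<Lambda> m) \<le> \<E>\<^sub>R (\<Lambda> (p - m)) (\<Lambda> (p - m))"
proof -
  let ?\<xi> = "\<Lambda> (p - m)"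
  have \<xi>: "?\<xi> \<in> \<F>" "J ?\<xi> = ?\<xi>"
    using form_alg_dom[OF dom] form_alg_sq[OF dom] p m
    by (simp_all add: J_Lambda star_diff pos_elem_sa)
  have step: "(1 / r) *\<^sub>R wedge_one \<tau> \<Lambda> \<pi> (r *\<^sub>R ?\<xi>) \<in> \<F> \<and>
      \<E>\<^sub>R ((1 / r) *\<^sub>R wedge_one \<tau> \<Lambda> \<pi> (r *\<^sub>R ?\<xi>)) ((1 / r) *\<^sub>R wedge_one \<tau> \<Lambda> \<pi> (r *\<^sub>R ?\<xi>)) \<le> \<E>\<^sub>R ?\<xi> ?\<xi>"
    if r: "r > 0" for r :: real
  proof -
    let ?w = "wedge_one \<tau> \<Lambda> \<pi> (r *\<^sub>R ?\<xi>)"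
    have "r *\<^sub>R ?\<xi> \<in> \<F>" using \<xi>(1) by (rule E.scale_mem)
    moreover have "J (r *\<^sub>R ?\<xi>) = r *\<^sub>R ?\<xi>" by (simp only: J_scaleR \<xi>(2))
    ultimately have w: "?w \<in> \<F>" "\<E>\<^sub>R ?w ?w \<le> \<E>\<^sub>R (r *\<^sub>R ?\<xi>) (r *\<^sub>R ?\<xi>)"
      using markovian unfolding form_quad_eq by blast+
    have "\<E>\<^sub>R ((1 / r) *\<^sub>R ?w) ((1 / r) *\<^sub>R ?w) = (1 / r) * ((1 / r) * \<E>\<^sub>R ?w ?w)"
      by (simp only: E.scale_left E.scale_right E.mem w)
    also have "\<dots> \<le> (1 / r) * ((1 / r) * \<E>\<^sub>R (r *\<^sub>R ?\<xi>) (r *\<^sub>R ?\<xi>))"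
      using r w(2) by (intro mult_left_mono) auto
    also have "\<dots> = \<E>\<^sub>R ?\<xi> ?\<xi>"
      using r by (simp add: E.scale_left E.scale_right E.mem \<xi>(1))
    finally show ?thesis using w(1) E.scale_mem by blast
  qed
  have "- \<Lambda> m \<in> \<F> \<and> \<E>\<^sub>R (- \<Lambda> m) (- \<Lambda> m) \<le> \<E>\<^sub>R ?\<xi> ?\<xi>"
    by (rule form_lower_semicontinuous[OF _ wedge_scaled_tendsto_neg_part[OF p m orth]])
       (use step in \<open>simp_all add: add_nonneg_pos\<close>)
  then show "\<Lambda> m \<in> \<F>" "\<E>\<^sub>R (\<Lambda> m) (\<Lambda> m) \<le> \<E>\<^sub>R ?\<xi> ?\<xi>"
    using E.minus_mem[of "- \<Lambda> m"] E.minus_left E.minus_right by auto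
qed

text \<open>
  The energy of the negative part \<open>tm\<close> of \<open>p - tm\<close> is at most that of \<open>p - tm\<close>, which for large \<open>t\<close>
  is only possible if \<open>\<E>(p,m) \<le> 0\<close>; and \<open>(\<Lambda>p, \<Lambda>m) = 0\<close>.
\<close>

lemma form_parts:
  assumes b: "b \<in> \<B>" "star b = b"
  obtains p m where "b = p - m" "pos_elem p" "pos_elem m" "p \<in> \<B>" "m \<in> \<B>" "\<E>\<^sub>1 (\<Lambda> p) (\<Lambda> m) \<le> 0"
proof -
  obtain p m where pm: "b = p - m" "pos_elem p" "pos_elem m" "p \<in> sq_integrable \<tau>"
      "m \<in> sq_integrable \<tau>" "\<Lambda> p \<bullet> \<Lambda> m = 0"
    using form_alg_sq[OF b(1)] b(2) by (rule L2_parts) (rule that)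
  have mB: "m \<in> \<B>"
    using neg_part_form(1)[OF pm(2,4,3,5,6)] b(1) pm(1,5) by (simp add: form_alg_def)
  have "p = b + m" by (simp add: pm(1))
  then have pB: "p \<in> \<B>" using form_alg_add[OF b(1) mB] by simp
  note pF = form_alg_dom[OF pB] and mF = form_alg_dom[OF mB]
  have scaled: "2 * t * \<E>\<^sub>R (\<Lambda> p) (\<Lambda> m) \<le> \<E>\<^sub>R (\<Lambda> p) (\<Lambda> p)" if t: "t > 0" for t
  proof -
    have tm: "pos_elem (t *\<^sub>R m)" "t *\<^sub>R m \<in> sq_integrable \<tau>"
      using pm t by (simp_all add: pos_elem_iff_spec_nonneg spec_nonneg_scaleR sq_integrable_scaleR)
    have "\<Lambda> p \<bullet> \<Lambda> (t *\<^sub>R m) = 0" using pm by (simp add: Lambda_scaleR)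
    from neg_part_form(2)[OF pm(2,4) tm this form_alg_diff[OF pB form_alg_scaleR[OF mB]]]
    have "\<E>\<^sub>R (t *\<^sub>R \<Lambda> m) (t *\<^sub>R \<Lambda> m) \<le> \<E>\<^sub>R (\<Lambda> p - t *\<^sub>R \<Lambda> m) (\<Lambda> p - t *\<^sub>R \<Lambda> m)"
      using pm tm by (simp add: Lambda_diff Lambda_scaleR)
    also have "\<dots> = \<E>\<^sub>R (\<Lambda> p) (\<Lambda> p) - 2 * (t * \<E>\<^sub>R (\<Lambda> p) (\<Lambda> m)) + \<E>\<^sub>R (t *\<^sub>R \<Lambda> m) (t *\<^sub>R \<Lambda> m)"
      using pF mF by (simp only: E.quad_diff E.scale_mem E.scale_right)
    finally show ?thesis by simp
  qed
  have "\<E>\<^sub>R (\<Lambda> p) (\<Lambda> m) \<le> 0"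
  proof (rule ccontr)
    assume "\<not> ?thesis"
    then have pos: "\<E>\<^sub>R (\<Lambda> p) (\<Lambda> m) > 0" by simp
    \<comment> \<open>large enough for \<open>2t\<E>(p,m)\<close> to exceed \<open>\<E>[p]\<close>\<close>
    define t where "t = (\<E>\<^sub>R (\<Lambda> p) (\<Lambda> p) + 1) / \<E>\<^sub>R (\<Lambda> p) (\<Lambda> m)"
    have "t > 0" unfolding t_def using pos E.nonneg[OF pF] by (intro divide_pos_pos) auto
    from scaled[OF this] have "2 * (\<E>\<^sub>R (\<Lambda> p) (\<Lambda> p) + 1) \<le> \<E>\<^sub>R (\<Lambda> p) (\<Lambda> p)"
      using pos by (simp add: t_def)
    then show False using E.nonneg[OF pF] by argo
  qed
  then have "\<E>\<^sub>1 (\<Lambda> p) (\<Lambda> m) \<le> 0" by (simp add: \<E>\<^sub>1_eq pm(6))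
  then show ?thesis using that[OF pm(1,2,3) pB mB] by blast
qed

lemma Lambda_pos_L2: "pos_elem p \<Longrightarrow> p \<in> sq_integrable \<tau> \<Longrightarrow> \<Lambda> p \<in> L2_pos \<tau> \<Lambda>"
  unfolding L2_pos_def by (rule subsetD[OF closure_subset]) simp

lemma form_alg_pos_iff: "b \<in> form_alg_pos \<tau> \<Lambda> \<F> \<longleftrightarrow> b \<in> \<B> \<and> pos_elem b"
  using pos_elem_if_L2_pos Lambda_pos_L2 by (auto simp: form_alg_pos_def form_alg_sq)

lemma sa_functional_real:
  assumes "\<omega> \<in> pos_dual" "b \<in> \<B>" "star b = b"
  shows "Im (\<omega> b) = 0"
proof -
  obtain p m where "b = p - m" "pos_elem p" "pos_elem m"
    using assms(2,3) by (rule form_parts) (rule that)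
  then show ?thesis using assms(1) by (simp add: pos_dual_linear pos_dual_nonneg)
qed

lemma Re_functional_star:
  assumes \<omega>: "\<omega> \<in> pos_dual" and b: "b \<in> \<B>"
  shows "Re (\<omega> (star b)) = Re (\<omega> b)"
proof -
  define k where "k = \<i> *\<^sub>C (b - star b)"
  have kB: "k \<in> \<B>" unfolding k_def by (intro form_alg_scaleC form_alg_diff form_alg_star b)
  have "star k = (- \<i>) *\<^sub>C (star b - b)" by (simp add: k_def star_scaleC star_diff star_star)
  also have "\<dots> = (- \<i>) *\<^sub>C (- 1) *\<^sub>C (b - star b)"
    using scaleC_minus_left[of 1 "b - star b"] by (simp add: scaleC_one)
  also have "\<dots> = k" by (simp add: k_def scaleC_scaleC)
  finally have "Im (\<omega> k) = 0" by (rule sa_functional_real[OF \<omega> kB])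
  then show ?thesis by (simp add: k_def pos_dual_linear[OF \<omega>])
qed

lemma core_dense:
  assumes "\<xi> \<in> \<F>" "e > 0"
  obtains b where "b \<in> \<B>" "sqrt (\<E>\<^sub>1 (\<xi> - \<Lambda> b) (\<xi> - \<Lambda> b)) < e"
  using regular_core[OF assms] unfolding form_norm_eq by blast

lemma eq_0_if_orthogonal_to_core:
  assumes d: "d \<in> \<F>" and orth: "\<And>b. b \<in> \<B> \<Longrightarrow> \<E>\<^sub>1 d (\<Lambda> b) = 0"
  shows "d = 0"
proof -
  have "\<E>\<^sub>1 d d \<le> 0"
  proof (rule ccontr)
    assume "\<not> ?thesis"
    then have pos: "\<E>\<^sub>1 d d > 0" by simp
    then obtain b where b: "b \<in> \<B>" "sqrt (\<E>\<^sub>1 (d - \<Lambda> b) (d - \<Lambda> b)) < sqrt (\<E>\<^sub>1 d d)"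
      using core_dense[OF d, of "sqrt (\<E>\<^sub>1 d d)"] by (metis real_sqrt_gt_zero)
    note bF = form_alg_dom[OF b(1)]
    have "\<E>\<^sub>1 d d = \<E>\<^sub>1 d (d - \<Lambda> b)" using d bF orth[OF b(1)] by (simp add: F.diff_right)
    also have "\<dots> \<le> sqrt (\<E>\<^sub>1 d d) * sqrt (\<E>\<^sub>1 (d - \<Lambda> b) (d - \<Lambda> b))"
      using d bF by (intro F.cauchy_schwarz F.mem)
    also have "\<dots> < sqrt (\<E>\<^sub>1 d d) * sqrt (\<E>\<^sub>1 d d)"
      using b(2) pos by (intro mult_strict_left_mono) auto
    also have "\<dots> = \<E>\<^sub>1 d d" using pos by simp
    finally show False by simp
  qed
  then have "(norm d)\<^sup>2 \<le> 0" using norm_le_\<E>\<^sub>1[OF d] by linarith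
  then show ?thesis by simp
qed

definition represents :: "'h \<Rightarrow> ('a \<Rightarrow> complex) \<Rightarrow> bool" where
  "represents g \<omega> \<longleftrightarrow> g \<in> \<F> \<and> (\<forall>b\<in>\<B>. \<omega> b = form_inner \<E> g (\<Lambda> b))"

lemma represents_Re: "represents g \<omega> \<Longrightarrow> b \<in> \<B> \<Longrightarrow> \<E>\<^sub>1 g (\<Lambda> b) = Re (\<omega> b)"
  by (simp add: represents_def \<E>\<^sub>1_def)

text \<open>
  The imaginary part of \<open>\<omega>(b)\<close> is read off from the real part of \<open>\<omega>(ib)\<close>.
\<close>

lemma representsI:
  assumes g: "g \<in> \<F>" and \<omega>: "\<omega> \<in> pos_dual" and re: "\<And>b. b \<in> \<B> \<Longrightarrow> \<E>\<^sub>1 g (\<Lambda> b) = Re (\<omega> b)"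
  shows "represents g \<omega>"
  unfolding represents_def
proof (intro conjI ballI g complex_eqI)
  fix b assume b: "b \<in> \<B>"
  show "Re (\<omega> b) = Re (form_inner \<E> g (\<Lambda> b))" using re[OF b] by (simp add: \<E>\<^sub>1_def)
  have "form_inner \<E> g (\<Lambda> (\<i> *\<^sub>C b)) = \<i> * form_inner \<E> g (\<Lambda> b)"
    using b g form_alg_dom[OF b]
    by (simp add: form_inner_def Lambda_form_alg form_scaleC cinner_scaleC_right distrib_left)
  then show "Im (\<omega> b) = Im (form_inner \<E> g (\<Lambda> b))"
    using re[OF form_alg_scaleC[OF b, of \<i>]] by (simp add: \<E>\<^sub>1_def pos_dual_linear[OF \<omega>])
qed

lemma potential_eq:
  assumes "represents g \<omega>"
  shows "potential \<tau> \<Lambda> \<F> \<E> \<omega> = g"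
  unfolding potential_def
proof (rule the_equality)
  show "g \<in> \<F> \<and> (\<forall>b\<in>\<B>. \<omega> b = form_inner \<E> g (\<Lambda> b))" using assms by (simp add: represents_def)
next
  fix h assume "h \<in> \<F> \<and> (\<forall>b\<in>\<B>. \<omega> b = form_inner \<E> h (\<Lambda> b))"
  then have h: "represents h \<omega>" by (simp add: represents_def)
  have F: "g \<in> \<F>" "h \<in> \<F>" using assms h by (simp_all add: represents_def)
  have "h - g = 0"
    by (rule eq_0_if_orthogonal_to_core)
       (simp_all add: F F.mem F.diff_left form_alg_dom represents_Re[OF assms] represents_Re[OF h])
  then show "h = g" by simp
qed

text \<open>
  Finite energy bounds \<open>\<omega>\<close> on positive elements only. For self-adjoint \<open>b = p - m\<close> one has
  \<open>\<omega>(b) \<le> \<omega>(p)\<close>, and \<open>\<parallel>p\<parallel>\<^sub>\<F> \<le> \<parallel>b\<parallel>\<^sub>\<F>\<close> because \<open>\<langle>p,m\<rangle>\<^sub>\<F> \<le> 0\<close>. Passing from \<open>b\<close> to its real part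
  \<open>(b + b\<^sup>*)/2\<close> leaves \<open>Re \<omega>(b)\<close> unchanged and does not increase the norm.
\<close>

lemma finite_energy_bound:
  assumes \<omega>: "\<omega> \<in> pos_dual" and fin: "finite_energy \<tau> \<Lambda> \<F> \<E> \<omega>"
  obtains C where "C \<ge> 0" "\<And>b. b \<in> \<B> \<Longrightarrow> Re (\<omega> b) \<le> C * sqrt (\<E>\<^sub>1 (\<Lambda> b) (\<Lambda> b))"
proof -
  obtain c where c0: "c \<ge> 0" and
    cb: "\<forall>b\<in>form_alg_pos \<tau> \<Lambda> \<F>. Re (\<omega> b) \<le> c * form_norm \<E> (\<Lambda> b)"
    using fin unfolding finite_energy_def by blast
  have c: "Re (\<omega> b) \<le> c * sqrt (\<E>\<^sub>1 (\<Lambda> b) (\<Lambda> b))" if "b \<in> \<B>" "pos_elem b" for b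
    using cb that by (simp add: form_alg_pos_iff form_norm_eq)
  have sa: "Re (\<omega> b) \<le> c * sqrt (\<E>\<^sub>1 (\<Lambda> b) (\<Lambda> b))" if b: "b \<in> \<B>" "star b = b" for b
  proof -
    obtain p m where pm: "b = p - m" "pos_elem p" "pos_elem m" "p \<in> \<B>" "m \<in> \<B>" "\<E>\<^sub>1 (\<Lambda> p) (\<Lambda> m) \<le> 0"
      using b by (rule form_parts) (rule that)
    have "\<E>\<^sub>1 (\<Lambda> b) (\<Lambda> b) = \<E>\<^sub>1 (\<Lambda> p) (\<Lambda> p) - 2 * \<E>\<^sub>1 (\<Lambda> p) (\<Lambda> m) + \<E>\<^sub>1 (\<Lambda> m) (\<Lambda> m)"
      using pm by (simp add: Lambda_form_alg F.quad_diff form_alg_dom)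
    then have "\<E>\<^sub>1 (\<Lambda> p) (\<Lambda> p) \<le> \<E>\<^sub>1 (\<Lambda> b) (\<Lambda> b)"
      using pm(6) F.nonneg[OF form_alg_dom[OF pm(5)]] by linarith
    then have "c * sqrt (\<E>\<^sub>1 (\<Lambda> p) (\<Lambda> p)) \<le> c * sqrt (\<E>\<^sub>1 (\<Lambda> b) (\<Lambda> b))"
      using c0 by (intro mult_left_mono) auto
    moreover have "Re (\<omega> b) \<le> Re (\<omega> p)"
      using pos_dual_nonneg[OF \<omega> pm(3)] by (simp add: pm(1) pos_dual_linear[OF \<omega>])
    ultimately show ?thesis using c[OF pm(4,2)] by linarith
  qed
  have "Re (\<omega> b) \<le> c * sqrt (\<E>\<^sub>1 (\<Lambda> b) (\<Lambda> b))" if b: "b \<in> \<B>" for b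
  proof -
    define h where "h = (1/2) *\<^sub>R (b + star b)"
    have hB: "h \<in> \<B>" unfolding h_def by (intro form_alg_scaleR form_alg_add form_alg_star b)
    have h_sa: "star h = h" by (simp add: h_def star_scaleR star_add star_star add.commute)
    have "Re (\<omega> h) = Re (\<omega> b)"
      by (simp add: h_def pos_dual_linear[OF \<omega>] Re_functional_star[OF \<omega> b] del: scaleR_right_distrib)
    note bF = form_alg_dom[OF b] form_alg_dom[OF form_alg_star[OF b]]
    have J: "\<Lambda> (star b) = J (\<Lambda> b)" using form_alg_sq[OF b] by (simp add: J_Lambda)
    have "\<Lambda> h = (1/2) *\<^sub>R (\<Lambda> b + \<Lambda> (star b))"
      unfolding h_def by (simp only: Lambda_form_alg form_alg_add form_alg_star b)
    then have "\<E>\<^sub>1 (\<Lambda> h) (\<Lambda> h) = (\<E>\<^sub>1 (\<Lambda> b) (\<Lambda> b) + \<E>\<^sub>1 (\<Lambda> (star b)) (\<Lambda> (star b))) / 2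
        - \<E>\<^sub>1 (\<Lambda> b - \<Lambda> (star b)) (\<Lambda> b - \<Lambda> (star b)) / 4"
      by (simp only: F.quad_midpoint[OF bF])
    moreover have "\<E>\<^sub>1 (\<Lambda> (star b)) (\<Lambda> (star b)) = \<E>\<^sub>1 (\<Lambda> b) (\<Lambda> b)"
      unfolding J using bF(1) by (simp add: \<E>\<^sub>1_J)
    moreover have "0 \<le> \<E>\<^sub>1 (\<Lambda> b - \<Lambda> (star b)) (\<Lambda> b - \<Lambda> (star b))"
      using bF by (intro F.nonneg F.mem)
    ultimately have "\<E>\<^sub>1 (\<Lambda> h) (\<Lambda> h) \<le> \<E>\<^sub>1 (\<Lambda> b) (\<Lambda> b)" by argo
    then have "c * sqrt (\<E>\<^sub>1 (\<Lambda> h) (\<Lambda> h)) \<le> c * sqrt (\<E>\<^sub>1 (\<Lambda> b) (\<Lambda> b))"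
      using c0 by (intro mult_left_mono) auto
    then show ?thesis using sa[OF hB h_sa] \<open>Re (\<omega> h) = Re (\<omega> b)\<close> by linarith
  qed
  with c0 show ?thesis by (rule that)
qed

text \<open>
  The Riesz representation theorem in \<open>\<F>\<close>, by minimizing \<open>\<Phi>(b) = \<parallel>b\<parallel>\<^sub>\<F>\<^sup>2 - 2 Re \<omega>(b)\<close> over the form
  algebra. A minimizing sequence is Cauchy in \<open>\<F>\<close>, and the first variation at its limit \<open>g\<close>
  vanishes.
\<close>

lemma potential_exists:
  assumes \<omega>: "\<omega> \<in> pos_dual" and fin: "finite_energy \<tau> \<Lambda> \<F> \<E> \<omega>"
  obtains g where "represents g \<omega>"
proof -
  obtain C where C: "C \<ge> 0" "\<And>b. b \<in> \<B> \<Longrightarrow> Re (\<omega> b) \<le> C * sqrt (\<E>\<^sub>1 (\<Lambda> b) (\<Lambda> b))"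
    using assms by (rule finite_energy_bound) (rule that)
  define \<Phi> where "\<Phi> b = \<E>\<^sub>1 (\<Lambda> b) (\<Lambda> b) - 2 * Re (\<omega> b)" for b
  have lower: "- (C\<^sup>2) \<le> \<Phi> b" if "b \<in> \<B>" for b
  proof -
    define s where "s = sqrt (\<E>\<^sub>1 (\<Lambda> b) (\<Lambda> b))"
    have "\<E>\<^sub>1 (\<Lambda> b) (\<Lambda> b) = s\<^sup>2" using F.nonneg[OF form_alg_dom[OF that]] by (simp add: s_def)
    moreover have "0 \<le> (s - C)\<^sup>2" by simp
    ultimately show ?thesis using C(2)[OF that]
      unfolding \<Phi>_def s_def[symmetric] by (simp add: power2_diff mult.commute)
  qed
  have mid: "(1/2) *\<^sub>R (a + b) \<in> \<B>" if "a \<in> \<B>" "b \<in> \<B>" for a b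
    by (intro form_alg_scaleR form_alg_add that)
  have convex: "\<Phi> ((1/2) *\<^sub>R (a + b)) \<le> (\<Phi> a + \<Phi> b) / 2 - \<E>\<^sub>1 (\<Lambda> a - \<Lambda> b) (\<Lambda> a - \<Lambda> b) / 4"
    if ab: "a \<in> \<B>" "b \<in> \<B>" for a b
  proof -
    have L: "\<Lambda> ((1/2) *\<^sub>R (a + b)) = (1/2) *\<^sub>R (\<Lambda> a + \<Lambda> b)"
      by (simp only: Lambda_form_alg form_alg_add ab)
    have R: "Re (\<omega> ((1/2) *\<^sub>R (a + b))) = (Re (\<omega> a) + Re (\<omega> b)) / 2"
      by (simp add: pos_dual_linear[OF \<omega>] del: scaleR_right_distrib)
    show ?thesis
      unfolding \<Phi>_def L R F.quad_midpoint[OF form_alg_dom[OF ab(1)] form_alg_dom[OF ab(2)]]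
      by argo
  qed
  have ne: "\<B> \<noteq> {}" using form_alg_zero by blast
  obtain X I where X: "\<And>n::nat. X n \<in> \<B>" "\<And>b. b \<in> \<B> \<Longrightarrow> I \<le> \<Phi> b"
    "\<And>n. \<Phi> (X n) < I + 1 / (real n + 1)"
    "\<And>m n. \<E>\<^sub>1 (\<Lambda> (X m) - \<Lambda> (X n)) (\<Lambda> (X m) - \<Lambda> (X n)) / 4 \<le> (1 / (real m + 1) + 1 / (real n + 1)) / 2"
    by (rule minimizing_sequence[of \<B> "- (C\<^sup>2)" \<Phi> "\<lambda>a b. (1/2) *\<^sub>R (a + b)"
          "\<lambda>a b. \<E>\<^sub>1 (\<Lambda> a - \<Lambda> b) (\<Lambda> a - \<Lambda> b) / 4", OF ne lower mid convex])
      (assumption, assumption, assumption, assumption, assumption, rule that)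
  have XF: "\<Lambda> (X n) \<in> \<F>" for n by (rule form_alg_dom[OF X(1)])
  have cauchy: "\<exists>N. \<forall>m\<ge>N. \<forall>n\<ge>N. \<E>\<^sub>1 (\<Lambda> (X m) - \<Lambda> (X n)) (\<Lambda> (X m) - \<Lambda> (X n)) < e"
    if "e > 0" for e
  proof -
    have "\<E>\<^sub>1 (\<Lambda> (X m) - \<Lambda> (X n)) (\<Lambda> (X m) - \<Lambda> (X n)) \<le> 2 * (1 / (real m + 1) + 1 / (real n + 1))" for m n
      using X(4)[of m n] by argo
    then show ?thesis using inverse_sum_less[OF that, of 2] by (meson le_less_trans)
  qed
  obtain g where g: "g \<in> \<F>" "(\<lambda>n. \<E>\<^sub>1 (\<Lambda> (X n) - g) (\<Lambda> (X n) - g)) \<longlonglongrightarrow> 0"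
    by (rule form_complete[OF XF cauchy]) (assumption, rule that)
  have "\<E>\<^sub>1 g (\<Lambda> b) = Re (\<omega> b)" if b: "b \<in> \<B>" for b
  proof -
    note bF = form_alg_dom[OF b]
    define D where "D n = \<E>\<^sub>1 (\<Lambda> (X n)) (\<Lambda> b) - Re (\<omega> b)" for n
    define q where "q = \<E>\<^sub>1 (\<Lambda> b) (\<Lambda> b)"
    have q: "q \<ge> 0" unfolding q_def using bF by (rule F.nonneg)
    have "\<bar>\<E>\<^sub>1 (\<Lambda> (X n)) (\<Lambda> b) - \<E>\<^sub>1 g (\<Lambda> b)\<bar> \<le> sqrt (\<E>\<^sub>1 (\<Lambda> (X n) - g) (\<Lambda> (X n) - g)) * sqrt q" for n
    proof -
      have "\<E>\<^sub>1 (\<Lambda> (X n)) (\<Lambda> b) - \<E>\<^sub>1 g (\<Lambda> b) = \<E>\<^sub>1 (\<Lambda> (X n) - g) (\<Lambda> b)"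
        using XF g(1) bF by (simp add: F.diff_left)
      moreover have "\<E>\<^sub>1 g (\<Lambda> b) - \<E>\<^sub>1 (\<Lambda> (X n)) (\<Lambda> b) = \<E>\<^sub>1 (g - \<Lambda> (X n)) (\<Lambda> b)"
        using XF g(1) bF by (simp add: F.diff_left)
      moreover have "\<E>\<^sub>1 (g - \<Lambda> (X n)) (g - \<Lambda> (X n)) = \<E>\<^sub>1 (\<Lambda> (X n) - g) (\<Lambda> (X n) - g)"
        using XF g(1) by (rule F.quad_diff_commute[rotated])
      ultimately show ?thesis
        using F.cauchy_schwarz[OF F.diff_mem[OF XF[of n] g(1)] bF]
          F.cauchy_schwarz[OF F.diff_mem[OF g(1) XF[of n]] bF]
        unfolding q_def by (simp add: abs_le_iff)
    qed
    then have "\<forall>\<^sub>F n in sequentially. norm (\<E>\<^sub>1 (\<Lambda> (X n)) (\<Lambda> b) - \<E>\<^sub>1 g (\<Lambda> b))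
        \<le> sqrt (\<E>\<^sub>1 (\<Lambda> (X n) - g) (\<Lambda> (X n) - g)) * sqrt q" by simp
    moreover have "(\<lambda>n. sqrt (\<E>\<^sub>1 (\<Lambda> (X n) - g) (\<Lambda> (X n) - g)) * sqrt q) \<longlonglongrightarrow> 0"
      using tendsto_mult[OF tendsto_real_sqrt[OF g(2)] tendsto_const[of "sqrt q"]] by simp
    ultimately have "(\<lambda>n. \<E>\<^sub>1 (\<Lambda> (X n)) (\<Lambda> b) - \<E>\<^sub>1 g (\<Lambda> b)) \<longlonglongrightarrow> 0"
      by (rule Lim_null_comparison)
    then have Dlim: "D \<longlonglongrightarrow> \<E>\<^sub>1 g (\<Lambda> b) - Re (\<omega> b)"
      unfolding D_def by (intro tendsto_diff tendsto_const) (rule LIM_zero_cancel)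
    have var: "0 \<le> 2 * t * (\<E>\<^sub>1 g (\<Lambda> b) - Re (\<omega> b)) + t\<^sup>2 * q" for t
    proof -
      have ge: "0 \<le> 1 / (real n + 1) + 2 * t * D n + t\<^sup>2 * q" for n
      proof -
        have "I \<le> \<Phi> (X n + t *\<^sub>R b)" by (intro X form_alg_add form_alg_scaleR b)
        also have "\<Phi> (X n + t *\<^sub>R b) = \<Phi> (X n) + 2 * t * D n + t\<^sup>2 * q"
        proof -
          have "\<Lambda> (X n + t *\<^sub>R b) = \<Lambda> (X n) + t *\<^sub>R \<Lambda> b"
            using X(1)[of n] b by (simp add: Lambda_form_alg form_alg_scaleR)
          then show ?thesis
            using XF[of n] bF
            by (simp add: \<Phi>_def D_def q_def F.quad_add F.scale_mem F.scale_right F.scale_left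
                pos_dual_linear[OF \<omega>] power2_eq_square algebra_simps)
        qed
        finally show ?thesis using X(3)[of n] by linarith
      qed
      have "(\<lambda>n. 1 / (real n + 1)) \<longlonglongrightarrow> 0"
        using LIMSEQ_inverse_real_of_nat by (simp add: inverse_eq_divide add.commute)
      then have "(\<lambda>n. 1 / (real n + 1) + 2 * t * D n + t\<^sup>2 * q)
          \<longlonglongrightarrow> 0 + 2 * t * (\<E>\<^sub>1 g (\<Lambda> b) - Re (\<omega> b)) + t\<^sup>2 * q"
        by (intro tendsto_intros Dlim)
      from LIMSEQ_le_const[OF this, of 0] show ?thesis using ge by simp
    qed
    define \<delta> where "\<delta> = \<E>\<^sub>1 g (\<Lambda> b) - Re (\<omega> b)"
    \<comment> \<open>minimizes the variation up to replacing \<open>q\<close> by \<open>q + 1\<close>, which avoids division by zero\<close>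
    define t where "t = - \<delta> / (q + 1)"
    have \<delta>: "\<delta> = - ((q + 1) * t)" using q by (simp add: t_def)
    have "0 \<le> 2 * t * \<delta> + t\<^sup>2 * q" using var[of t] unfolding \<delta>_def[symmetric] .
    then have "(q + 2) * t\<^sup>2 \<le> 0" unfolding \<delta> by (simp add: power2_eq_square algebra_simps)
    then have "t\<^sup>2 \<le> 0" using q by (simp add: mult_le_0_iff)
    then have "\<delta> = 0" unfolding \<delta> by simp
    then show ?thesis by (simp add: \<delta>_def)
  qed
  then have "represents g \<omega>" by (rule representsI[OF g(1) \<omega>])
  then show ?thesis by (rule that)
qed

text \<open>
  A positive functional is real on self-adjoint elements, so \<open>Jg\<close> represents it as well.
\<close>

lemma potential_J:
  assumes \<omega>: "\<omega> \<in> pos_dual" and g: "represents g \<omega>"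
  shows "J g = g"
proof -
  have gF: "g \<in> \<F>" using g by (simp add: represents_def)
  have JgF: "J g \<in> \<F>" using form_real[OF gF] by simp
  have "J g - g = 0"
  proof (rule eq_0_if_orthogonal_to_core)
    fix b assume b: "b \<in> \<B>"
    note bF = form_alg_dom[OF b] and sB = form_alg_star[OF b]
    have "J (\<Lambda> (star b)) = \<Lambda> b"
      using form_alg_sq[OF sB] by (simp add: J_Lambda star_star)
    then have "\<E>\<^sub>1 (J g) (\<Lambda> b) = \<E>\<^sub>1 g (\<Lambda> (star b))"
      using \<E>\<^sub>1_J[OF gF form_alg_dom[OF sB]] by simp
    then show "\<E>\<^sub>1 (J g - g) (\<Lambda> b) = 0"
      using gF JgF bF represents_Re[OF g b] represents_Re[OF g sB] Re_functional_star[OF \<omega> b]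
      by (simp add: F.diff_left)
  qed (intro F.mem gF JgF)
  then show ?thesis by simp
qed

text \<open>
  Here positivity of potentials is decided. Approximate \<open>g\<close> in \<open>\<F>\<close> by a self-adjoint \<open>b = p - m\<close>. Since
  \<open>\<langle>g,m\<rangle>\<^sub>\<F> = \<omega>(m) \<ge> 0\<close> and \<open>\<langle>p,m\<rangle>\<^sub>\<F> \<le> 0\<close>, one gets \<open>\<parallel>m\<parallel>\<^sub>\<F>\<^sup>2 \<le> \<langle>g - b, m\<rangle>\<^sub>\<F>\<close>, hence \<open>\<parallel>m\<parallel>\<^sub>\<F> \<le> \<parallel>g - b\<parallel>\<^sub>\<F>\<close>: the
  negative part is negligible and \<open>p\<close> approximates \<open>g\<close> as well.
\<close>

lemma potential_approx_pos:
  assumes \<omega>: "\<omega> \<in> pos_dual" and g: "represents g \<omega>" and e: "e > 0"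
  obtains p where "p \<in> \<B>" "pos_elem p" "sqrt (\<E>\<^sub>1 (g - \<Lambda> p) (g - \<Lambda> p)) < e"
proof -
  have gF: "g \<in> \<F>" using g by (simp add: represents_def)
  have "e / 2 > 0" using e by simp
  with gF obtain a where a: "a \<in> \<B>" "sqrt (\<E>\<^sub>1 (g - \<Lambda> a) (g - \<Lambda> a)) < e / 2"
    by (rule core_dense) (rule that)
  note aF = form_alg_dom[OF a(1)]
  define b where "b = (1/2) *\<^sub>R (a + star a)"
  have bB: "b \<in> \<B>" unfolding b_def by (intro form_alg_scaleR form_alg_add form_alg_star a)
  have b_sa: "star b = b" by (simp add: b_def star_scaleR star_add star_star add.commute)
  define u where "u = g - \<Lambda> a"
  have uF: "u \<in> \<F>" "J u \<in> \<F>" unfolding u_def using form_real gF aF by (simp_all add: F.mem)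
  have Lb: "\<Lambda> b = (1/2) *\<^sub>R (\<Lambda> a + J (\<Lambda> a))"
    using form_alg_sq[OF a(1)] form_alg_star[OF a(1)]
    by (simp only: b_def Lambda_form_alg form_alg_add form_alg_star a J_Lambda)
  have "J u + J (\<Lambda> a) = J g" by (simp add: u_def flip: J_add)
  then have "J u = g - J (\<Lambda> a)" by (simp add: potential_J[OF \<omega> g] eq_diff_eq)
  then have "u + J u = (g + g) - (\<Lambda> a + J (\<Lambda> a))" by (simp add: u_def)
  then have "g - \<Lambda> b = (1/2) *\<^sub>R (u + J u)"
    unfolding Lb by (simp only: scaleR_right_diff_distrib scaleR_half_double)
  then have "\<E>\<^sub>1 (g - \<Lambda> b) (g - \<Lambda> b) = (\<E>\<^sub>1 u u + \<E>\<^sub>1 (J u) (J u)) / 2 - \<E>\<^sub>1 (u - J u) (u - J u) / 4"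
    by (simp only: F.quad_midpoint[OF uF])
  moreover have "\<E>\<^sub>1 (J u) (J u) = \<E>\<^sub>1 u u" using uF by (simp add: \<E>\<^sub>1_J)
  moreover have "0 \<le> \<E>\<^sub>1 (u - J u) (u - J u)" using uF by (intro F.nonneg F.mem)
  ultimately have "\<E>\<^sub>1 (g - \<Lambda> b) (g - \<Lambda> b) \<le> \<E>\<^sub>1 u u" by argo
  then have "sqrt (\<E>\<^sub>1 (g - \<Lambda> b) (g - \<Lambda> b)) \<le> sqrt (\<E>\<^sub>1 u u)" by simp
  then have gb: "sqrt (\<E>\<^sub>1 (g - \<Lambda> b) (g - \<Lambda> b)) < e / 2" using a(2) unfolding u_def by linarith
  obtain p m where pm: "b = p - m" "pos_elem p" "pos_elem m" "p \<in> \<B>" "m \<in> \<B>" "\<E>\<^sub>1 (\<Lambda> p) (\<Lambda> m) \<le> 0"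
    using bB b_sa by (rule form_parts) (rule that)
  note pF = form_alg_dom[OF pm(4)] and mF = form_alg_dom[OF pm(5)] and bF = form_alg_dom[OF bB]
  have "\<Lambda> b = \<Lambda> p - \<Lambda> m" using pm by (simp add: Lambda_form_alg)
  define M where "M = sqrt (\<E>\<^sub>1 (\<Lambda> m) (\<Lambda> m))"
  have MM: "M * M = \<E>\<^sub>1 (\<Lambda> m) (\<Lambda> m)" "M \<ge> 0" using F.nonneg[OF mF] by (simp_all add: M_def)
  have "\<E>\<^sub>1 (\<Lambda> m) (\<Lambda> m) \<le> \<E>\<^sub>1 (g - \<Lambda> b) (\<Lambda> m)"
  proof -
    have "\<E>\<^sub>1 (g - \<Lambda> b) (\<Lambda> m) = \<E>\<^sub>1 g (\<Lambda> m) - (\<E>\<^sub>1 (\<Lambda> p) (\<Lambda> m) - \<E>\<^sub>1 (\<Lambda> m) (\<Lambda> m))"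
      using gF bF pF mF by (simp add: F.diff_left) (simp add: \<open>\<Lambda> b = \<Lambda> p - \<Lambda> m\<close> F.diff_left)
    moreover have "0 \<le> \<E>\<^sub>1 g (\<Lambda> m)"
      using represents_Re[OF g pm(5)] pos_dual_nonneg[OF \<omega> pm(3)] by simp
    ultimately show ?thesis using pm(6) by linarith
  qed
  also have "\<dots> \<le> sqrt (\<E>\<^sub>1 (g - \<Lambda> b) (g - \<Lambda> b)) * M"
    unfolding M_def by (intro F.cauchy_schwarz F.mem gF bF mF)
  finally have "M * M \<le> sqrt (\<E>\<^sub>1 (g - \<Lambda> b) (g - \<Lambda> b)) * M" by (simp only: MM)
  then have M_le: "M \<le> sqrt (\<E>\<^sub>1 (g - \<Lambda> b) (g - \<Lambda> b))"
    using MM(2) F.nonneg[OF F.diff_mem[OF gF bF]] by (cases "M = 0") auto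
  have gp: "g - \<Lambda> p = (g - \<Lambda> b) + (- \<Lambda> m)" by (simp add: \<open>\<Lambda> b = \<Lambda> p - \<Lambda> m\<close>)
  have "sqrt (\<E>\<^sub>1 (g - \<Lambda> p) (g - \<Lambda> p))
      \<le> sqrt (\<E>\<^sub>1 (g - \<Lambda> b) (g - \<Lambda> b)) + sqrt (\<E>\<^sub>1 (- \<Lambda> m) (- \<Lambda> m))"
    unfolding gp by (rule F.triangle[OF F.diff_mem[OF gF bF] F.minus_mem[OF mF]])
  also have "\<E>\<^sub>1 (- \<Lambda> m) (- \<Lambda> m) = \<E>\<^sub>1 (\<Lambda> m) (\<Lambda> m)"
    using mF by (simp add: F.minus_left F.minus_right F.mem)
  finally have "sqrt (\<E>\<^sub>1 (g - \<Lambda> p) (g - \<Lambda> p)) < e"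
    using gb M_le unfolding M_def[symmetric] by argo
  with pm(4,2) show ?thesis by (rule that)
qed

lemma potential_pos:
  assumes "\<omega> \<in> pos_dual" "represents g \<omega>"
  shows "g \<in> form_pos \<tau> \<Lambda> \<F>"
proof -
  have gF: "g \<in> \<F>" using assms(2) by (simp add: represents_def)
  have "g \<in> L2_pos \<tau> \<Lambda>"
    unfolding L2_pos_def closure_approachable
  proof (intro allI impI)
    fix e :: real assume "0 < e"
    with assms obtain p where p: "p \<in> \<B>" "pos_elem p" "sqrt (\<E>\<^sub>1 (g - \<Lambda> p) (g - \<Lambda> p)) < e"
      by (rule potential_approx_pos) (rule that)
    have "norm (g - \<Lambda> p) \<le> sqrt (\<E>\<^sub>1 (g - \<Lambda> p) (g - \<Lambda> p))"
      using norm_le_\<E>\<^sub>1[OF F.diff_mem[OF gF form_alg_dom[OF p(1)]]] by (rule real_le_rsqrt)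
    then have "dist (\<Lambda> p) g < e" using p(3) by (simp add: dist_norm norm_minus_commute)
    then show "\<exists>\<xi>\<in>\<Lambda> ` {a \<in> sq_integrable \<tau>. pos_elem a}. dist \<xi> g < e"
      using p form_alg_sq by blast
  qed
  with gF show ?thesis by (simp add: form_pos_def)
qed

text \<open>
  If \<open>h\<close> is the limit in \<open>\<F>\<close> of positive \<open>p\<close> in the form algebra, then \<open>\<langle>g,h\<rangle>\<^sub>\<F>\<close> is the limit of
  \<open>\<langle>g,p\<rangle>\<^sub>\<F> = \<omega>(p) \<ge> 0\<close>.
\<close>

lemma potentials_inner_nonneg:
  assumes "\<omega> \<in> pos_dual" "represents g \<omega>" "\<omega>' \<in> pos_dual" "represents h \<omega>'"
  shows "0 \<le> \<E>\<^sub>1 g h"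
proof (rule ccontr)
  assume "\<not> ?thesis"
  then have neg: "- \<E>\<^sub>1 g h > 0" by simp
  have F: "g \<in> \<F>" "h \<in> \<F>" using assms by (simp_all add: represents_def)
  define r where "r = sqrt (\<E>\<^sub>1 g g) + 1"
  have r: "r > 0" using F.nonneg[OF F(1)] by (simp add: r_def add_nonneg_pos)
  then have "- \<E>\<^sub>1 g h / r > 0" using neg by (intro divide_pos_pos)
  with assms(3,4) obtain p where p: "p \<in> \<B>" "pos_elem p" "sqrt (\<E>\<^sub>1 (h - \<Lambda> p) (h - \<Lambda> p)) < - \<E>\<^sub>1 g h / r"
    by (rule potential_approx_pos) (rule that)
  note pF = form_alg_dom[OF p(1)]
  have "0 \<le> \<E>\<^sub>1 g (\<Lambda> p)" using represents_Re[OF assms(2) p(1)] pos_dual_nonneg[OF assms(1) p(2)] by simp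
  also have "\<E>\<^sub>1 g (\<Lambda> p) = \<E>\<^sub>1 g h + \<E>\<^sub>1 g (\<Lambda> p - h)" using F pF by (simp add: F.diff_right)
  finally have 1: "- \<E>\<^sub>1 g h \<le> \<E>\<^sub>1 g (\<Lambda> p - h)" by simp
  have "\<E>\<^sub>1 g (\<Lambda> p - h) \<le> sqrt (\<E>\<^sub>1 g g) * sqrt (\<E>\<^sub>1 (\<Lambda> p - h) (\<Lambda> p - h))"
    by (intro F.cauchy_schwarz F.mem F pF)
  also have "\<dots> \<le> r * sqrt (\<E>\<^sub>1 (h - \<Lambda> p) (h - \<Lambda> p))"
    unfolding F.quad_diff_commute[OF pF F(2)] using F.nonneg[OF F.diff_mem[OF F(2) pF]]
    by (intro mult_right_mono) (simp_all add: r_def)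
  also have "\<dots> < r * (- \<E>\<^sub>1 g h / r)" using p(3) r by (rule mult_strict_left_mono)
  also have "\<dots> = - \<E>\<^sub>1 g h" using r by simp
  finally show False using 1 by linarith
qed

lemma finite_energy_mono:
  assumes "functional_le \<omega>' \<omega>" "finite_energy \<tau> \<Lambda> \<F> \<E> \<omega>"
  shows "finite_energy \<tau> \<Lambda> \<F> \<E> \<omega>'"
proof -
  obtain c where c: "c \<ge> 0" "\<And>b. b \<in> form_alg_pos \<tau> \<Lambda> \<F> \<Longrightarrow> Re (\<omega> b) \<le> c * form_norm \<E> (\<Lambda> b)"
    using assms(2) unfolding finite_energy_def by blast
  have "Re (\<omega>' b) \<le> c * form_norm \<E> (\<Lambda> b)" if b: "b \<in> form_alg_pos \<tau> \<Lambda> \<F>" for b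
  proof -
    have "\<omega> b - \<omega>' b \<in> \<real>\<^sub>\<ge>\<^sub>0"
      using assms(1) b by (simp add: functional_le_def form_alg_pos_iff)
    then have "Re (\<omega>' b) \<le> Re (\<omega> b)" by (simp add: complex_nonneg_Reals_iff)
    then show ?thesis using c(2)[OF b] by linarith
  qed
  then show ?thesis using c(1) unfolding finite_energy_def by blast
qed

end

section \<open>Domination of potentials\<close>

theorem proposition3p11:
  fixes \<tau> :: "'a::cstar_algebra \<Rightarrow> ennreal"
    and \<Lambda> :: "'a \<Rightarrow> 'h::chilbert_space"
    and \<pi> :: "'a \<Rightarrow> 'h \<Rightarrow> 'h"
    and J :: "'h \<Rightarrow> 'h"
    and \<F> :: "'h set"
    and \<E> :: "'h \<Rightarrow> 'h \<Rightarrow> complex"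
    and \<omega> \<omega>' :: "'a \<Rightarrow> complex"
  assumes "dirichlet_form \<tau> \<Lambda> \<pi> J \<F> \<E>"
    and "\<omega> \<in> pos_dual"
    and "\<omega>' \<in> pos_dual"
    and "functional_le \<omega>' \<omega>"
    and "finite_energy \<tau> \<Lambda> \<F> \<E> \<omega>"
  shows "finite_energy \<tau> \<Lambda> \<F> \<E> \<omega>' \<and>
    potential \<tau> \<Lambda> \<F> \<E> \<omega> - potential \<tau> \<Lambda> \<F> \<E> \<omega>' \<in> form_pos \<tau> \<Lambda> \<F> \<and>
    energy_content \<tau> \<Lambda> \<F> \<E> \<omega>' \<le> energy_content \<tau> \<Lambda> \<F> \<E> \<omega>"
proof -
  interpret dirichlet_form \<tau> \<Lambda> \<pi> J \<F> \<E> by (rule assms(1))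
  have fin': "finite_energy \<tau> \<Lambda> \<F> \<E> \<omega>'" by (rule finite_energy_mono[OF assms(4,5)])
  obtain g where g: "represents g \<omega>" by (rule potential_exists[OF assms(2,5)])
  obtain h where h: "represents h \<omega>'" by (rule potential_exists[OF assms(3) fin'])
  note pot = potential_eq[OF g] potential_eq[OF h]
  have F: "g \<in> \<F>" "h \<in> \<F>" using g h by (simp_all add: represents_def)
  note diff = pos_dual_diff[OF assms(2,3,4)]
  have gh: "represents (g - h) (\<lambda>a. \<omega> a - \<omega>' a)"
    by (rule representsI[OF _ diff])
       (simp_all add: F F.mem F.diff_left form_alg_dom represents_Re[OF g] represents_Re[OF h])
  have "0 \<le> \<E>\<^sub>1 g (g - h)" "0 \<le> \<E>\<^sub>1 h (g - h)"
    using potentials_inner_nonneg[OF _ _ diff gh] g h assms(2,3) by blast+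
  then have "\<E>\<^sub>1 h h \<le> \<E>\<^sub>1 g g" using F by (simp add: F.diff_right F.sym[of h g])
  then have "energy_content \<tau> \<Lambda> \<F> \<E> \<omega>' \<le> energy_content \<tau> \<Lambda> \<F> \<E> \<omega>"
    by (simp add: energy_content_def energy_extension_def pot \<E>\<^sub>1_def)
  then show ?thesis using fin' potential_pos[OF diff gh] by (simp add: pot)
qed

end
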